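(* Let $\Phi:T\times\mathbb{R}^n\rightrightarrows\mathbb{R}^m$ be a set-valued normal integrand on a complete finite measure space $(T,\mathcal{A},\mu)$ that is integrably amenable at $(\bar x,\bar y)\in\operatorname{gph}E_\Phi$, with composite representation $\Phi_t(x)=F(t,g_t(x))$ for all $x\in U$ and a.e. $t\in T$, where $U$, $F$, $g$ are as in the definition of integrable amenability. Assume that: (a) there exist $\rho>0$ and $\kappa\in L^1(T,\mathbb{R}_+)$ such that $\Phi_t(x)\subset\kappa(t)\mathbb{B}$ for all $x\in\mathbb{B}_\rho(\bar x)$ and a.e. $t\in T$; (b) there is $\eta>0$ with $\mathbb{B}_\eta(\bar x)\subset U$ such that the gradients $\nabla g_t(x)$ are uniformly bounded over all $x\in\mathbb{B}_\eta(\bar x)$ and a.e. $t\in T$; (c) for all $h\in\mathbb{R}^q$ with $\|h\|\le\eta$ the function $t\mapsto\operatorname{dist}(0;F_t(g_t(\bar x)+h))$ is integrable on $T$. Then for every $\bar{\mathsf y}\in\mathcal{S}_\Phi(\bar x,\bar y)$ and every $y^*\in\mathbb{R}^m$ $$\hat D^*E_\Phi(\bar x,\bar y)(y^* )\subset\int_T\nabla g_t(\bar x)^*\circ D^*F_t(g_t(\bar x),\bar{\mathsf y}(t))(y^* )\,d\mu.$$ If in addition $\mathcal{S}_\Phi$ is inner semicompact at $(\bar x,\bar y)$, then for every $y^*\in\mathbb{R}^m$ $$D^*E_\Phi(\bar x,\bar y)(y^* )\subset\bigcup_{\bar{\mathsf y}\in\mathcal{S}_\Phi(\bar x,\bar y)}\int_T\nabla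 g_t(\bar x)^*\circ D^*F_t(g_t(\bar x),\bar{\mathsf y}(t))(y^* )\,d\mu.$$
   Context: $\mathbb{R}_+:=\{\alpha\in\mathbb{R}:\alpha>0\}$; $\mathbb{B}_r(\cdot)$ is the closed ball, $\mathbb{B}$ the closed unit ball; $\operatorname{dist}(x;\Omega)$ is the Euclidean distance with $\operatorname{dist}(x;\emptyset)=\infty$. We write $\Phi_t:=\Phi(t,\cdot)$, $F_t:=F(t,\cdot)$, $g_t:=g(t,\cdot)$; $\nabla g_t(x)^*$ is the adjoint (transpose) Jacobian and $\nabla g_t(\bar x)^*\circ A=\{\nabla g_t(\bar x)^*z^*:z^*\in A\}$. A mapping $G:T\times\mathbb{R}^d\rightrightarrows\mathbb{R}^m$ is a set-valued normal integrand if $\operatorname{gph}G_t$ is closed for all $t\in T$ and $\operatorname{gph}G\in\mathcal{A}\otimes\mathcal{B}(\mathbb{R}^d\times\mathbb{R}^m)$; it is a set-valued convex normal integrand if in addition $\operatorname{gph}G_t$ is convex for a.e. $t\in T$. The (Aumann) integral of $A:T\rightrightarrows\mathbb{R}^d$ is $\int_TA(t)d\mu=\{\int_T\mathsf{v}\,d\mu:\mathsf{v}\in L^1(T,\mathbb{R}^d),\ \mathsf{v}(t)\in A(t)\text{ a.e.}\}$. $E_\Phi(x):=\int_T\Phi_t(x)d\mu$. $\mathcal{S}_\Phi(x,y):=\{\mathsf{y}\in L^1(T,\mathbb{R}^m):\int_T\mathsf{y}\,d\mu=y,\ \mathsf{y}(t)\in\Phi_t(x)\text{ for a.e. }t\}$.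 $\mathcal{S}_\Phi$ is inner semicompact at $(\bar x,\bar y)$ if for every sequence $(x_k,y_k)\to(\bar x,\bar y)$ with $\mathcal{S}_\Phi(x_k,y_k)\neq\emptyset$ there is a sequence $\mathsf{y}_k\in\mathcal{S}_\Phi(x_k,y_k)$ containing an $L^1(T,\mathbb{R}^m)$-norm convergent subsequence. Regular normal cone: $\hat N(\bar z;\Omega)=\{z^*:\limsup_{z\to\bar z,z\in\Omega}\langle z^*,z-\bar z\rangle/\|z-\bar z\|\le0\}$ for $\bar z\in\Omega$, $\emptyset$ otherwise. Limiting normal cone: $N(\bar z;\Omega)=\{z^*:\exists z_k\to\bar z,\ z_k^*\to z^*,\ z_k^*\in\hat N(z_k;\Omega)\}$. Regular and limiting coderivatives at $(x,y)\in\operatorname{gph}G$: $\hat D^*G(x,y)(y^* )=\{x^*:(x^*,-y^* )\in\hat N((x,y);\operatorname{gph}G)\}$, $D^*G(x,y)(y^* )=\{x^*:(x^*,-y^* )\in N((x,y);\operatorname{gph}G)\}$. $\Phi$ is integrably amenable at $(\bar x,\bar y)\in\operatorname{gph}E_\Phi$ if there exist a neighborhood $U$ of $\bar x$, a set-valued convex normal integrand $F:T\times\mathbb{R}^q\rightrightarrows\mathbb{R}^m$, and a function $g:T\times U\to\mathbb{R}^q$, measurable in $t$ on $T$ and continuously differentiable in $x$ around $\bar x$, such that $\Phi_t(x)=F(t,g_t(x))$ for all $x\in U$ and a.e. $t\in T$, and such that for every $\bar{\mathsf y}\in\mathcal{S}_\Phi(\bar x,\bar y)$ the qualification condition $D^*F_t(g_t(\bar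 x),\bar{\mathsf y}(t))(0)\cap\operatorname{Ker}\nabla g_t(\bar x)^*=\{0\}$ holds for a.e. $t\in T$. *)

theory Defs
  imports "HOL-Analysis.Analysis"
begin

section \<open>Normal cones and coderivatives\<close>

definition gph :: "('a \<Rightarrow> 'b set) \<Rightarrow> ('a \<times> 'b) set" where
  "gph G = {(x, y). y \<in> G x}"

text \<open>The upper limit is taken in the extended reals, so it is \<open>-\<infinity>\<close> at an isolated point of
  \<open>\<Omega>\<close>, where the regular normal cone is therefore the whole space.\<close>

definition regular_normal_cone :: "'a::euclidean_space \<Rightarrow> 'a set \<Rightarrow> 'a set" where
  "regular_normal_cone zbar \<Omega> =
     (if zbar \<in> \<Omega>
      then {zs. Limsup (at zbar within \<Omega>)
                  (\<lambda>z. ereal ((zs \<bullet> (z - zbar)) / norm (z - zbar))) \<le> 0}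
      else {})"

definition limiting_normal_cone :: "'a::euclidean_space \<Rightarrow> 'a set \<Rightarrow> 'a set" where
  "limiting_normal_cone zbar \<Omega> =
     {zs. \<exists>z w. z \<longlonglongrightarrow> zbar \<and> w \<longlonglongrightarrow> zs \<and>
             (\<forall>k::nat. w k \<in> regular_normal_cone (z k) \<Omega>)}"

definition regular_coderivative ::
  "('a::euclidean_space \<Rightarrow> 'b::euclidean_space set) \<Rightarrow> 'a \<Rightarrow> 'b \<Rightarrow> 'b \<Rightarrow> 'a set" where
  "regular_coderivative G x y ys = {xs. (xs, - ys) \<in> regular_normal_cone (x, y) (gph G)}"

definition coderivative ::
  "('a::euclidean_space \<Rightarrow> 'b::euclidean_space set) \<Rightarrow> 'a \<Rightarrow> 'b \<Rightarrow> 'b \<Rightarrow> 'a set" where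
  "coderivative G x y ys = {xs. (xs, - ys) \<in> limiting_normal_cone (x, y) (gph G)}"


section \<open>Set-valued integrands and their Aumann integrals\<close>

definition normal_integrand ::
  "'t measure \<Rightarrow> ('t \<Rightarrow> 'a::euclidean_space \<Rightarrow> 'b::euclidean_space set) \<Rightarrow> bool" where
  "normal_integrand M G \<longleftrightarrow>
     (\<forall>t\<in>space M. closed (gph (G t))) \<and>
     {(t, x, y). t \<in> space M \<and> y \<in> G t x} \<in> sets (M \<Otimes>\<^sub>M borel)"

definition convex_normal_integrand ::
  "'t measure \<Rightarrow> ('t \<Rightarrow> 'a::euclidean_space \<Rightarrow> 'b::euclidean_space set) \<Rightarrow> bool" where
  "convex_normal_integrand M G \<longleftrightarrow>
     normal_integrand M G \<and> (AE t in M. convex (gph (G t)))"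

definition aumann_integral :: "'t measure \<Rightarrow> ('t \<Rightarrow> 'a::euclidean_space set) \<Rightarrow> 'a set" where
  "aumann_integral M A =
     {integral\<^sup>L M v | v. integrable M v \<and> (AE t in M. v t \<in> A t)}"

definition expected_map ::
  "'t measure \<Rightarrow> ('t \<Rightarrow> 'a::euclidean_space \<Rightarrow> 'b::euclidean_space set) \<Rightarrow> 'a \<Rightarrow> 'b set" where
  "expected_map M \<Phi> x = aumann_integral M (\<lambda>t. \<Phi> t x)"

text \<open>Elements of \<open>L\<^sup>1\<close> are represented by integrable functions; everything below is
  invariant under changes on null sets.\<close>

definition integrable_selections ::
  "'t measure \<Rightarrow> ('t \<Rightarrow> 'a::euclidean_space \<Rightarrow> 'b::euclidean_space set)
     \<Rightarrow> 'a \<Rightarrow> 'b \<Rightarrow> ('t \<Rightarrow> 'b) set" where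
  "integrable_selections M \<Phi> x y =
     {v. integrable M v \<and> integral\<^sup>L M v = y \<and> (AE t in M. v t \<in> \<Phi> t x)}"

definition selections_inner_semicompact ::
  "'t measure \<Rightarrow> ('t \<Rightarrow> 'a::euclidean_space \<Rightarrow> 'b::euclidean_space set)
     \<Rightarrow> 'a \<Rightarrow> 'b \<Rightarrow> bool" where
  "selections_inner_semicompact M \<Phi> xbar ybar \<longleftrightarrow>
     (\<forall>x y. x \<longlonglongrightarrow> xbar \<and> y \<longlonglongrightarrow> ybar \<and>
            (\<forall>k::nat. integrable_selections M \<Phi> (x k) (y k) \<noteq> {}) \<longrightarrow>
        (\<exists>v. (\<forall>k. v k \<in> integrable_selections M \<Phi> (x k) (y k)) \<and>
             (\<exists>r w. strict_mono (r :: nat \<Rightarrow> nat) \<and> integrable M w \<and>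
                (\<lambda>j. \<integral>t. norm (v (r j) t - w t) \<partial>M) \<longlonglongrightarrow> 0)))"

text \<open>Distance to a set with value \<open>\<infinity>\<close> for the empty set (unlike \<^const>\<open>infdist\<close>).\<close>

definition set_distance :: "'a::metric_space \<Rightarrow> 'a set \<Rightarrow> ennreal" where
  "set_distance x \<Omega> = (INF y\<in>\<Omega>. ennreal (dist x y))"

definition ennreal_integrable :: "'t measure \<Rightarrow> ('t \<Rightarrow> ennreal) \<Rightarrow> bool" where
  "ennreal_integrable M f \<longleftrightarrow> f \<in> borel_measurable M \<and> (\<integral>\<^sup>+t. f t \<partial>M) < \<infinity>"


section \<open>Integrable amenability\<close>

definition C1_around ::
  "('a::euclidean_space \<Rightarrow> 'b::euclidean_space) \<Rightarrow> 'a \<Rightarrow> bool" where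
  "C1_around f x \<longleftrightarrow>
     (\<exists>V f'. open V \<and> x \<in> V \<and>
        (\<forall>z\<in>V. (f has_derivative blinfun_apply (f' z)) (at z)) \<and> continuous_on V f')"

text \<open>\<open>adj_gradient f x\<close> is the transpose Jacobian of \<open>f\<close> at \<open>x\<close>, as a linear map.\<close>

definition adj_gradient ::
  "('a::euclidean_space \<Rightarrow> 'b::euclidean_space) \<Rightarrow> 'a \<Rightarrow> 'b \<Rightarrow> 'a" where
  "adj_gradient f x = adjoint (frechet_derivative f (at x))"

text \<open>The composite representation \<open>(U, F, g)\<close> is an explicit argument, because the dimension
  of the intermediate space is a type and cannot be quantified existentially. The functions
  \<open>g t\<close> are total, but only their values on the open set \<open>U\<close> matter. The neighbourhood of
  \<open>xbar\<close> on which \<open>g t\<close> is continuously differentiable may depend on \<open>t\<close>.\<close>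

definition integrably_amenable ::
  "'t measure \<Rightarrow> ('t \<Rightarrow> 'a::euclidean_space \<Rightarrow> 'b::euclidean_space set) \<Rightarrow> 'a \<Rightarrow> 'b \<Rightarrow>
   'a set \<Rightarrow> ('t \<Rightarrow> 'c::euclidean_space \<Rightarrow> 'b set) \<Rightarrow> ('t \<Rightarrow> 'a \<Rightarrow> 'c) \<Rightarrow> bool" where
  "integrably_amenable M \<Phi> xbar ybar U F g \<longleftrightarrow>
     (xbar, ybar) \<in> gph (expected_map M \<Phi>) \<and>
     open U \<and> xbar \<in> U \<and>
     convex_normal_integrand M F \<and>
     (\<forall>x\<in>U. (\<lambda>t. g t x) \<in> borel_measurable M) \<and>
     (\<forall>t\<in>space M. C1_around (g t) xbar) \<and>
     (AE t in M. \<forall>x\<in>U. \<Phi> t x = F t (g t x)) \<and>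
     (\<forall>v\<in>integrable_selections M \<Phi> xbar ybar.
        AE t in M. coderivative (F t) (g t xbar) (v t) 0
                     \<inter> {z. adj_gradient (g t) xbar z = 0} = {0})"

end

theory Submission
  imports Defs
begin

text \<open>Let \<open>v\<close> be a selection over \<open>xbar\<close> and let \<open>(xs, - ys)\<close> be a regular normal to the graph of the
  expected map. By (c) the values \<open>F t (g t xbar + h)\<close> contain integrably bounded points for all
  small \<open>h\<close>, so convex combinations of selections follow the curve \<open>g t (xbar + s w)\<close> and
  give \<open>xs \<bullet> w \<le> \<integral> ys \<bullet> (y - v)\<close> for every \<open>w\<close> and every integrable selection \<open>y\<close> of
  \<open>F t (g t xbar + \<nabla>g t xbar w)\<close>. A sublinear extension argument on bounded measurable
  functions \<open>h\<close>, followed by the Radon-Nikodym theorem, turns \<open>xs\<close> into a density \<open>\<zeta>\<close> with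
  \<open>xs \<bullet> w = \<integral> \<zeta> \<bullet> \<nabla>g t xbar w\<close> and \<open>\<integral> \<zeta> \<bullet> h \<le> \<integral> ys \<bullet> (y - v)\<close> for all selections \<open>y\<close> of
  \<open>F t (g t xbar + h t)\<close>; a measurable selection theorem localizes this to
  \<open>\<zeta> t \<in> D*F t (g t xbar, v t) ys\<close>. For limiting normals the inequality, rather than the densities,
  is passed to the limit, which needs no weak compactness.\<close>

section \<open>Measurable selections\<close>

text \<open>The inequality for \<open>xs\<close> is known only for displacements \<nabla>g t xbar w
  with one constant w for all t; these are too few to separate different t. Enlarging the class to
  all bounded measurable \<open>h\<close> is what permits localization, since \<open>h\<close> can
  be cut off by an indicator. The extension has to reproduce \<open>xs\<close> on the old
  displacements, and for this reason the dominating functional is a hull along their range. A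
  functional on bounded functions may fail to be countably additive; condition (c) yields a bound by
  the integral of \<theta> * norm h with \<theta> integrable, and that bound gives countable
  additivity and absolute continuity together.

  Selections must be taken from sets known only as members of a product sigma-algebra. Outer measure
  and Suslin schemes take the place of any claim that a projection is measurable.

  For limiting normals the base points move, and a selection over the limit point is not one over
  the moving points. It is mixed, with vanishing weight, with an integrably bounded point that
  corrects the argument.\<close>

definition suslin_operation :: "(nat list \<Rightarrow> 't set) \<Rightarrow> (nat list \<Rightarrow> 'y set) \<Rightarrow> ('t \<times> 'y) set" where
  "suslin_operation A C =
     {(t, y). \<exists>\<sigma>::nat \<Rightarrow> nat. \<forall>k. t \<in> A (map \<sigma> [0..<k]) \<and> y \<in> C (map \<sigma> [0..<k])}"

text \<open>No monotonicity along branches is required. Keeping the two factors apart confines all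
  measurability to the \<open>A s\<close> and all topology to the \<open>C s\<close>.\<close>

definition suslin :: "'t measure \<Rightarrow> ('t \<times> 'y::topological_space) set \<Rightarrow> bool" where
  "suslin M G \<longleftrightarrow>
     (\<exists>A C. (\<forall>s. A s \<in> sets M) \<and> (\<forall>s. closed (C s)) \<and> G = suslin_operation A C)"

section \<open>Closure properties of Suslin sets\<close>

lemma suslin_rectangle:
  assumes "A \<in> sets M" "closed C"
  shows "suslin M (A \<times> C)"
  unfolding suslin_def suslin_operation_def
  by (intro exI[of _ "\<lambda>_. A"] exI[of _ "\<lambda>_. C"]) (use assms in auto)

text \<open>The first entry of a branch names the set, the remaining entries form a branch of its
  scheme. The root precedes this choice, so it must exclude nothing; \<open>space M\<close> is the
  largest measurable set available for it.\<close>

lemma suslin_UN: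
  assumes "\<And>n::nat. suslin M (G n)"
  shows "suslin M (\<Union>n. G n)"
proof -
  obtain A C where A: "\<And>n s. A n s \<in> sets M" and C: "\<And>n s. closed (C n s)"
    and G': "\<And>n. G n = suslin_operation (A n) (C n)"
    using assms unfolding suslin_def by metis
  note G = G'[unfolded suslin_operation_def]
  define A' where "A' s = (case s of [] \<Rightarrow> space M | n # s \<Rightarrow> A n s)" for s
  define C' where "C' s = (case s of [] \<Rightarrow> UNIV | n # s \<Rightarrow> C n s)" for s
  have shift: "map \<sigma> [0..<Suc k] = \<sigma> 0 # map (\<lambda>i. \<sigma> (Suc i)) [0..<k]" for \<sigma> :: "nat \<Rightarrow> nat" and k
    by (simp add: upt_conv_Cons map_Suc_upt[symmetric] del: upt_Suc)
  have 1: "\<exists>\<sigma>. \<forall>k. t \<in> A' (map \<sigma> [0..<k]) \<and> y \<in> C' (map \<sigma> [0..<k])" if "(t, y) \<in> G n" for t y n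
  proof -
    from that obtain \<sigma> where \<sigma>: "\<And>k. t \<in> A n (map \<sigma> [0..<k]) \<and> y \<in> C n (map \<sigma> [0..<k])"
      unfolding G by auto
    have t: "t \<in> space M" using \<sigma>[of 0] A sets.sets_into_space by blast
    show ?thesis
    proof (intro exI allI)
      fix k
      show "t \<in> A' (map (case_nat n \<sigma>) [0..<k]) \<and> y \<in> C' (map (case_nat n \<sigma>) [0..<k])"
      proof (cases k)
        case 0 then show ?thesis using t by (simp add: A'_def C'_def)
      next
        case (Suc j) then show ?thesis using \<sigma>[of j]
          by (simp only: shift A'_def C'_def list.case nat.case)
      qed
    qed
  qed
  have 2: "(t, y) \<in> G (\<sigma> 0)" if "\<And>k. t \<in> A' (map \<sigma> [0..<k]) \<and> y \<in> C' (map \<sigma> [0..<k])" for t y \<sigma>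
  proof -
    have "t \<in> A (\<sigma> 0) (map (\<lambda>i. \<sigma> (Suc i)) [0..<k]) \<and> y \<in> C (\<sigma> 0) (map (\<lambda>i. \<sigma> (Suc i)) [0..<k])" for k
      using that[of "Suc k"] by (simp only: shift A'_def C'_def list.case)
    then show ?thesis unfolding G by fastforce
  qed
  have "(\<Union>n. G n) = {(t, y). \<exists>\<sigma>. \<forall>k. t \<in> A' (map \<sigma> [0..<k]) \<and> y \<in> C' (map \<sigma> [0..<k])}"
    using 1 2 by (intro set_eqI) (simp only: split_paired_all UN_iff INT_iff mem_Collect_eq case_prod_conv, blast)
  moreover have "A' s \<in> sets M" "closed (C' s)" for s
    using A C by (auto simp: A'_def C'_def split: list.split)
  ultimately show ?thesis unfolding suslin_def suslin_operation_def by blast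
qed

text \<open>By this monotonicity the entries of row \<open>n\<close> with index below
  \<open>k\<close> sit before position \<open>prod_encode (n, k)\<close>, so the interleaved scheme
  of \<open>suslin_INT\<close> reads only entries of its own prefix.\<close>

lemma prod_encode_strict_mono2: "i < k \<Longrightarrow> prod_encode (n, i) < prod_encode (n, k)"
proof -
  have "triangle a < triangle b" if "a < b" for a b :: nat
    using that by (induction rule: less_Suc_induct) auto
  then show "i < k \<Longrightarrow> prod_encode (n, i) < prod_encode (n, k)"
    by (simp add: prod_encode_def)
qed

lemma suslin_INT:
  assumes "\<And>n::nat. suslin M (G n)"
  shows "suslin M (\<Inter>n. G n)"
proof -
  obtain A C where A: "\<And>n s. A n s \<in> sets M" and C: "\<And>n s. closed (C n s)"
    and G': "\<And>n. G n = suslin_operation (A n) (C n)"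
    using assms unfolding suslin_def by metis
  note G = G'[unfolded suslin_operation_def]
  \<comment> \<open>One sequence codes countably many; level \<open>m\<close> of the new scheme carries the condition
    numbered \<open>m\<close> under the pairing, which involves only earlier entries.\<close>
  define row where "row s = (case prod_decode (length s) of (n, k) \<Rightarrow> 
      (n, map (\<lambda>i. s ! prod_encode (n, i)) [0..<k]))" for s :: "nat list"
  define A' where "A' s = A (fst (row s)) (snd (row s))" for s
  define C' where "C' s = C (fst (row s)) (snd (row s))" for s
  have row: "row (map \<sigma> [0..<prod_encode (n, k)]) = (n, map (\<lambda>i. \<sigma> (prod_encode (n, i))) [0..<k])"
    for \<sigma> n k
    by (auto simp: row_def prod_encode_strict_mono2)
  have 1: "\<exists>\<sigma>. \<forall>k. t \<in> A' (map \<sigma> [0..<k]) \<and> y \<in> C' (map \<sigma> [0..<k])" if "\<And>n. (t, y) \<in> G n" for t y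
  proof -
    from that have "\<forall>n. \<exists>\<sigma>. \<forall>k. t \<in> A n (map \<sigma> [0..<k]) \<and> y \<in> C n (map \<sigma> [0..<k])"
      unfolding G by auto
    then obtain \<sigma> where \<sigma>: "\<And>n k. t \<in> A n (map (\<sigma> n) [0..<k]) \<and> y \<in> C n (map (\<sigma> n) [0..<k])"
      by metis
    define \<tau> where "\<tau> p = (case prod_decode p of (n, i) \<Rightarrow> \<sigma> n i)" for p
    have \<tau>: "(\<lambda>i. \<tau> (prod_encode (n, i))) = \<sigma> n" for n
      by (simp add: \<tau>_def)
    show ?thesis
    proof (intro exI allI)
      fix m
      obtain n k where m: "m = prod_encode (n, k)" by (metis prod.exhaust prod_decode_inverse)
      show "t \<in> A' (map \<tau> [0..<m]) \<and> y \<in> C' (map \<tau> [0..<m])"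
        unfolding m A'_def C'_def row fst_conv snd_conv \<tau> by (rule \<sigma>)
    qed
  qed
  have 2: "(t, y) \<in> G n" if "\<And>k. t \<in> A' (map \<sigma> [0..<k]) \<and> y \<in> C' (map \<sigma> [0..<k])" for t y \<sigma> n
  proof -
    have "t \<in> A n (map (\<lambda>i. \<sigma> (prod_encode (n, i))) [0..<k]) \<and>
        y \<in> C n (map (\<lambda>i. \<sigma> (prod_encode (n, i))) [0..<k])" for k
      using that[of "prod_encode (n, k)"] unfolding A'_def C'_def row fst_conv snd_conv .
    then show ?thesis unfolding G by fastforce
  qed
  have "(\<Inter>n. G n) = {(t, y). \<exists>\<sigma>. \<forall>k. t \<in> A' (map \<sigma> [0..<k]) \<and> y \<in> C' (map \<sigma> [0..<k])}"
    using 1 2 by (intro set_eqI) (simp only: split_paired_all UN_iff INT_iff mem_Collect_eq case_prod_conv, blast)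
  moreover have "A' s \<in> sets M" "closed (C' s)" for s
    using A C by (auto simp: A'_def C'_def)
  ultimately show ?thesis unfolding suslin_def suslin_operation_def by blast
qed

lemma suslin_Un: "suslin M G \<Longrightarrow> suslin M H \<Longrightarrow> suslin M (G \<union> H)"
proof -
  assume "suslin M G" "suslin M H"
  moreover have "(\<Union>n::nat. if n = 0 then G else H) = G \<union> H" by (auto split: if_splits)
  ultimately show ?thesis using suslin_UN[of M "\<lambda>n. if n = 0 then G else H"] by simp
qed

lemma suslin_Int: "suslin M G \<Longrightarrow> suslin M H \<Longrightarrow> suslin M (G \<inter> H)"
proof -
  assume "suslin M G" "suslin M H"
  moreover have "(\<Inter>n::nat. if n = 0 then G else H) = G \<inter> H" by (auto split: if_splits)
  ultimately show ?thesis using suslin_INT[of M "\<lambda>n. if n = 0 then G else H"] by simp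
qed

lemma suslin_open:
  fixes C :: "'y::metric_space set"
  assumes "A \<in> sets M" "open C"
  shows "suslin M (A \<times> C)"
proof -
  have "fsigma_in euclidean C"
    using assms(2) by (auto intro: open_imp_fsigma_in metrizable_space_euclidean)
  then obtain D where D: "\<And>n::nat. closedin euclidean (D n)" "(\<Union>n. D n) = C"
    unfolding fsigma_in_ascending by blast
  have "suslin M (\<Union>n. A \<times> D n)"
    by (intro suslin_UN suslin_rectangle) (use assms D in auto)
  moreover have "(\<Union>n. A \<times> D n) = A \<times> C" using D(2) by blast
  ultimately show ?thesis by simp
qed

text \<open>Suslin sets need not be stable under complements, so the induction over the
  sigma-algebra carries a set and its complement together; \<open>suslin_pair_measure\<close>
  repeats the device in the product.\<close>

lemma suslin_borel:
  fixes B :: "'y::metric_space set"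
  assumes B: "B \<in> sets borel" and A: "A \<in> sets M"
  shows "suslin M (A \<times> B) \<and> suslin M (A \<times> (- B))"
proof -
  have "B \<in> sigma_sets UNIV {S. open S}" using B by (simp add: borel_def)
  then show ?thesis
  proof (induction rule: sigma_sets.induct)
    case (Basic a)
    then show ?case using suslin_open[OF A] suslin_rectangle[OF A, of "- a"] by (auto simp: closed_def)
  next
    case Empty
    then show ?case using suslin_rectangle[OF A, of "{}"] suslin_rectangle[OF A, of "UNIV"] by simp
  next
    case (Compl a)
    then show ?case unfolding Compl_eq_Diff_UNIV[symmetric] double_complement by blast
  next
    case (Union a)
    have "suslin M (\<Union>n. A \<times> a n)" using Union by (intro suslin_UN) blast
    moreover have "suslin M (\<Inter>n. A \<times> - a n)" using Union by (intro suslin_INT) blast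
    moreover have "(\<Union>n. A \<times> a n) = A \<times> (\<Union>n. a n)" "(\<Inter>n. A \<times> - a n) = A \<times> - (\<Union>n. a n)"
      by auto
    ultimately show ?case by simp
  qed
qed

lemma suslin_pair_measure:
  fixes G :: "('t \<times> 'y::metric_space) set"
  assumes "G \<in> sets (M \<Otimes>\<^sub>M borel)"
  shows "suslin M G"
proof -
  have "suslin M G \<and> suslin M (space M \<times> UNIV - G)"
    using assms unfolding sets_pair_measure space_borel
  proof (induction rule: sigma_sets.induct)
    case (Basic G)
    then obtain A B where G: "G = A \<times> B" "A \<in> sets M" "B \<in> sets borel" by auto
    have "space M \<times> UNIV - G = (space M - A) \<times> UNIV \<union> A \<times> (- B)"
      using sets.sets_into_space[OF G(2)] unfolding G(1) by blast
    moreover have "suslin M ((space M - A) \<times> (UNIV :: 'y set))"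
      using G by (intro suslin_rectangle) auto
    ultimately show ?case using suslin_borel[OF G(3,2)] by (auto simp: G(1) intro: suslin_Un)
  next
    case Empty
    have "suslin M ({} \<times> (UNIV :: 'y set))" "suslin M (space M \<times> (UNIV :: 'y set))"
      by (intro suslin_rectangle; simp)+
    then show ?case by simp
  next
    case (Compl a)
    then have "suslin M ((space M \<times> UNIV) \<inter> a)"
      by (intro suslin_Int suslin_rectangle) auto
    then show ?case using Compl by (simp add: Diff_Diff_Int)
  next
    case (Union a)
    have "suslin M (\<Union>n. a n)" using Union by (intro suslin_UN) blast
    moreover have "suslin M (\<Inter>n. space M \<times> UNIV - a n)" using Union by (intro suslin_INT) blast
    ultimately show ?case by simp
  qed
  then show ?thesis by blast
qed

section \<open>Measurable selections from Suslin sets\<close>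

lemma suslin_shrinking_fibres:
  fixes G :: "('t \<times> 'y::polish_space) set"
  assumes "suslin M G"
  obtains A C c where "\<And>s. A s \<in> sets M" "\<And>s. closed (C s)" "G = suslin_operation A C"
    "\<And>s. s \<noteq> [] \<Longrightarrow> C s \<subseteq> cball (c s) ((1/2) ^ length s)"
proof -
  obtain A C where A: "\<And>s. A s \<in> sets M" and C: "\<And>s. closed (C s)" and G: "G = suslin_operation A C"
    using assms unfolding suslin_def by metis
  obtain D :: "'y set" where D: "countable D" "\<And>X. open X \<Longrightarrow> X \<noteq> {} \<Longrightarrow> \<exists>d\<in>D. d \<in> X"
    using countable_dense_exists by metis
  have "D \<noteq> {}" using D(2)[of UNIV] by auto
  define d where "d = from_nat_into D"
  have d: "\<exists>m. dist (d m) y \<le> e" if "e > 0" for y e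
  proof -
    obtain x where "x \<in> D" "x \<in> ball y e" using D(2)[of "ball y e"] \<open>e > 0\<close> by auto
    then show ?thesis using from_nat_into_surj[OF D(1)] unfolding d_def
      by (metis dist_commute less_imp_le mem_ball)
  qed
  \<comment> \<open>Each entry now codes a pair: an entry of the old branch and the number of a
    dense point. The ball at a node is centred at the point named by its last entry, so at most one
    \<open>y\<close> survives along a branch. At the empty list the centre is an arbitrary value of
    \<open>d\<close>, and no ball is imposed there.\<close>
  define c where "c s = d (snd (prod_decode (last s)))" for s
  define A' where "A' s = A (map (\<lambda>x. fst (prod_decode x)) s)" for s
  define C' where "C' s = C (map (\<lambda>x. fst (prod_decode x)) s) \<inter>
      (if s = [] then UNIV else cball (c s) ((1/2) ^ length s))" for s
  have "(t, y) \<in> suslin_operation A' C'" if "(t, y) \<in> G" for t y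
  proof -
    obtain \<sigma> where \<sigma>: "\<And>k. t \<in> A (map \<sigma> [0..<k]) \<and> y \<in> C (map \<sigma> [0..<k])"
      using \<open>(t, y) \<in> G\<close> unfolding G suslin_operation_def by auto
    have "\<exists>m. dist (d m) y \<le> (1/2) ^ Suc k" for k by (rule d) simp
    then obtain m where m: "\<And>k. dist (d (m k)) y \<le> (1/2) ^ Suc k" by metis
    define \<tau> where "\<tau> k = prod_encode (\<sigma> k, m k)" for k
    have "t \<in> A' (map \<tau> [0..<k]) \<and> y \<in> C' (map \<tau> [0..<k])" for k
    proof (cases k)
      case 0 then show ?thesis using \<sigma>[of 0] by (simp add: A'_def C'_def)
    next
      case (Suc l)
      then show ?thesis using \<sigma>[of k] m[of l]
        by (simp add: A'_def C'_def c_def \<tau>_def comp_def)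
    qed
    then show ?thesis unfolding suslin_operation_def by blast
  qed
  moreover have "(t, y) \<in> G" if ty: "(t, y) \<in> suslin_operation A' C'" for t y
  proof -
    obtain \<tau> where \<tau>: "\<And>k. t \<in> A' (map \<tau> [0..<k]) \<and> y \<in> C' (map \<tau> [0..<k])"
      using ty unfolding suslin_operation_def by auto
    have "t \<in> A (map (\<lambda>i. fst (prod_decode (\<tau> i))) [0..<k]) \<and>
        y \<in> C (map (\<lambda>i. fst (prod_decode (\<tau> i))) [0..<k])" for k
      using \<tau>[of k] by (simp add: A'_def C'_def comp_def)
    then show ?thesis unfolding G suslin_operation_def by fastforce
  qed
  ultimately have "G = suslin_operation A' C'" by auto
  moreover have "A' s \<in> sets M" "closed (C' s)" for s
    using A C by (auto simp: A'_def C'_def)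
  moreover have "C' s \<subseteq> cball (c s) ((1/2) ^ length s)" if "s \<noteq> []" for s
    using that by (auto simp: C'_def)
  ultimately show ?thesis using that by blast
qed

text \<open>The sets need not decrease, so nonemptiness is asked of finite intersections; points
  chosen in them form a Cauchy sequence by the ball condition. The limit is also exhibited as the
  limit of the centres: in the application these take countably many values, which makes the
  selection measurable.\<close>

lemma closed_nested_cball_limit:
  fixes C :: "nat \<Rightarrow> 'y::complete_space set"
  assumes C: "\<And>k. closed (C k)" and ne: "\<And>k. (\<Inter>i\<le>k. C i) \<noteq> {}"
    and cb: "\<And>k. k > 0 \<Longrightarrow> C k \<subseteq> cball (c k) ((1/2) ^ k)"
  obtains y where "\<And>k. y \<in> C k" "c \<longlonglongrightarrow> y"
proof -
  have "\<exists>y. \<forall>i\<le>k. y \<in> C i" for k using ne[of k] by blast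
  then obtain y where y: "\<And>k i. i \<le> k \<Longrightarrow> y k \<in> C i" by metis
  have yc: "dist (c k) (y l) \<le> (1/2) ^ k" if "0 < k" "k \<le> l" for k l
    using cb[OF that(1)] y[OF that(2)] by auto
  have half: "(\<lambda>k. (1/2::real) ^ k) \<longlonglongrightarrow> 0" by (rule LIMSEQ_power_zero) simp
  have "Cauchy y"
  proof (rule metric_CauchyI)
    fix e :: real assume "0 < e"
    then have "\<forall>\<^sub>F k in sequentially. (1/2::real) ^ k < e / 2"
      using order_tendstoD(2)[OF half, of "e/2"] by simp
    then obtain N0 where N0: "\<And>k. k \<ge> N0 \<Longrightarrow> (1/2::real) ^ k < e / 2"
      unfolding eventually_sequentially by blast
    \<comment> \<open>The ball condition starts at level 1, hence the shift by one.\<close>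
    define N where "N = Suc N0"
    have "dist (y m) (y n) < e" if "m \<ge> N" "n \<ge> N" for m n
    proof -
      have "dist (y m) (y n) \<le> dist (c N) (y m) + dist (c N) (y n)" by (rule dist_triangle3)
      also have "\<dots> < e / 2 + e / 2"
        using yc[of N m] yc[of N n] N0[of N] that by (intro add_strict_mono) (auto simp: N_def)
      finally show ?thesis by simp
    qed
    then show "\<exists>M. \<forall>m\<ge>M. \<forall>n\<ge>M. dist (y m) (y n) < e" by blast
  qed
  then obtain z where z: "y \<longlonglongrightarrow> z" by (metis Cauchy_convergent convergent_def)
  have "z \<in> C k" for k
  proof (rule closed_sequentially[OF C[of k], of "\<lambda>n. y (n + k)"])
    show "y (n + k) \<in> C k" for n by (rule y) simp
    show "(\<lambda>n. y (n + k)) \<longlonglongrightarrow> z" by (rule LIMSEQ_ignore_initial_segment[OF z])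
  qed
  moreover have "c \<longlonglongrightarrow> z"
  proof (rule tendstoI)
    fix e :: real assume "e > 0"
    then have "\<forall>\<^sub>F k in sequentially. (1/2::real) ^ k < e"
      using order_tendstoD(2)[OF half, of e] by simp
    with eventually_gt_at_top[of 0] show "\<forall>\<^sub>F k in sequentially. dist (c k) z < e"
    proof eventually_elim
      case (elim k)
      then show ?case using cb[of k] \<open>z \<in> C k\<close> by auto
    qed
  qed
  ultimately show ?thesis using that by blast
qed

text \<open>The measure of the projection is approximated from within by restricting the branches of
  the scheme to a compact box \<open>\<sigma> \<le> j\<close>; inside the box the lexicographically least branch is
  measurable.\<close>

lemma suslin_selection:
  fixes G :: "('t \<times> 'y::polish_space) set"
  assumes "finite_measure M" and "suslin M G" and a: "a < outer_measure_of M (fst ` G)"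
  obtains B f where "B \<in> sets M" "a \<le> emeasure M B" "f \<in> borel_measurable M"
    "\<And>t. t \<in> B \<Longrightarrow> (t, f t) \<in> G"
proof -
  interpret finite_measure M by fact
  obtain A C c where A[measurable]: "\<And>s. A s \<in> sets M" and C: "\<And>s. closed (C s)"
    and G: "G = suslin_operation A C"
    and cC: "\<And>s. s \<noteq> [] \<Longrightarrow> C s \<subseteq> cball (c s) ((1/2) ^ length s)"
    using suslin_shrinking_fibres[OF assms(2)] by metis
  have Asp: "A s \<subseteq> space M" for s using A sets.sets_into_space by blast
  define br where "br t \<sigma> y \<longleftrightarrow> (\<forall>k. t \<in> A (map \<sigma> [0..<k]) \<and> y \<in> C (map \<sigma> [0..<k]))"
    for t y and \<sigma> :: "nat \<Rightarrow> nat"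
  \<comment> \<open>The points \<open>t\<close> admitting a branch whose first entries are bounded
    by \<open>js\<close>. These projections need not be measurable, but outer measure is continuous
    along increasing unions of arbitrary subsets, so each further bound can be chosen with the outer
    measure still above \<open>a\<close>.\<close>
  define D where "D js = {t. \<exists>\<sigma> y. (\<forall>i<length js. \<sigma> i \<le> js ! i) \<and> br t \<sigma> y}" for js
  have br_space: "t \<in> space M" if "br t \<sigma> y" for t \<sigma> y
    using that Asp unfolding br_def by blast
  have D0: "D [] = fst ` G"
    unfolding D_def G suslin_operation_def br_def by (auto simp: image_def)
  have D_step: "\<exists>n. a < outer_measure_of M (D (js @ [n]))" if "a < outer_measure_of M (D js)" for js
  proof -
    have le: "(\<forall>i<length (js @ [n]). \<sigma> i \<le> (js @ [n]) ! i) \<longleftrightarrow>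
        (\<forall>i<length js. \<sigma> i \<le> js ! i) \<and> \<sigma> (length js) \<le> n" for \<sigma> n
      by (auto simp: nth_append less_Suc_eq)
    have "D js = (\<Union>n. D (js @ [n]))"
      unfolding D_def le by blast
    moreover have "incseq (\<lambda>n. D (js @ [n]))"
      unfolding D_def le incseq_def by (auto intro: order_trans)
    moreover have "D (js @ [n]) \<subseteq> space M" for n
      unfolding D_def using br_space by blast
    ultimately have "outer_measure_of M (D js) = (SUP n. outer_measure_of M (D (js @ [n])))"
      by (subst SUP_outer_measure_of_incseq) auto
    with that show ?thesis by (simp add: less_SUP_iff)
  qed
  have "\<exists>J. \<forall>k. (length (J k) = k \<and> a < outer_measure_of M (D (J k))) \<and> (\<exists>n. J (Suc k) = J k @ [n])"
  proof (rule dependent_nat_choice)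
    show "\<exists>x. length x = 0 \<and> a < outer_measure_of M (D x)" using a D0 by auto
    show "\<exists>y. (length y = Suc k \<and> a < outer_measure_of M (D y)) \<and> (\<exists>n. y = x @ [n])"
      if x: "length x = k \<and> a < outer_measure_of M (D x)" for x k
    proof -
      obtain n where "a < outer_measure_of M (D (x @ [n]))" using D_step x by blast
      then show ?thesis using x by (intro exI[of _ "x @ [n]"]) auto
    qed
  qed
  then obtain J where lenJ: "\<And>k. length (J k) = k" and aJ: "\<And>k. a < outer_measure_of M (D (J k))"
    and Jstep: "\<And>k. \<exists>n. J (Suc k) = J k @ [n]"
    by blast
  define j where "j i = J (Suc i) ! i" for i
  have J: "J k = map j [0..<k]" for k
  proof (induction k)
    case 0 then show ?case using lenJ[of 0] by simp
  next
    case (Suc k)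
    obtain n where n: "J (Suc k) = J k @ [n]" using Jstep by blast
    then have "j k = n" using lenJ[of k] by (simp add: j_def nth_append)
    with n Suc show ?case by simp
  qed
  define bdd where "bdd s \<longleftrightarrow> (\<forall>i<length s. s ! i \<le> j i)" for s
  have bdd_take: "bdd (take l u)" if "bdd u" for l u
    using that by (auto simp: bdd_def)
  \<comment> \<open>The \<open>C\<close> side of a finite branch does not involve \<open>t\<close>:
    its sets have a common point or they do not. Therefore \<open>ok s\<close> is measurable,
    although it expresses that some \<open>y\<close> passes every node up to
    \<open>s\<close>.\<close>
  define ok where "ok s = (if (\<Inter>i\<le>length s. C (take i s)) = {} then {} else (\<Inter>i\<le>length s. A (take i s)))" for s
  have ok_meas[measurable]: "ok s \<in> sets M" for s
    unfolding ok_def by (auto intro!: sets.finite_INT)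
  have ok_take: "ok s \<subseteq> ok (take i s)" for s i
  proof
    fix t assume t: "t \<in> ok s"
    then obtain y where y: "\<And>l. l \<le> length s \<Longrightarrow> y \<in> C (take l s)"
      unfolding ok_def by (auto split: if_splits)
    have "y \<in> (\<Inter>l\<le>length (take i s). C (take l (take i s)))"
      using y by (auto simp: min_def)
    then have "(\<Inter>l\<le>length (take i s). C (take l (take i s))) \<noteq> {}" by blast
    moreover have "t \<in> (\<Inter>l\<le>length (take i s). A (take l (take i s)))"
      using t by (auto simp: ok_def min_def split: if_splits)
    ultimately show "t \<in> ok (take i s)" unfolding ok_def by (simp only: if_False)
  qed
  define ext where "ext s m = {s'. bdd (s @ s') \<and> length s' = m}" for s m
  \<comment> \<open>The \<open>t\<close> for which \<open>s\<close> has admissible extensions of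
    every finite length inside the box. This is a measurable condition, and the compactness argument
    in \<open>V_step\<close> makes it equivalent to having an infinite continuation.\<close>
  define V where "V s = (\<Inter>m. \<Union>s'\<in>ext s m. ok (s @ s'))" for s
  have V_meas[measurable]: "V s \<in> sets M" for s
    unfolding V_def by measurable
  have V_ok: "V s \<subseteq> ok s" for s
    unfolding V_def by (rule INF_lower2[of 0]) (auto simp: ext_def)
  \<comment> \<open>Koenig's lemma: if every child \<open>n\<close> dropped out at some depth
    \<open>m n\<close>, the finitely many \<open>n\<close> allowed by the box would share a depth
    \<open>K\<close>; cutting an extension of length \<open>Suc K\<close> at the depth belonging to
    its own first entry gives a contradiction.\<close>
  have V_step: "\<exists>n. t \<in> V (s @ [n])" if t: "t \<in> V s" for t s
  proof (rule ccontr)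
    assume "\<not> ?thesis"
    then have "\<forall>n. \<exists>m. t \<notin> (\<Union>s'\<in>ext (s @ [n]) m. ok (s @ n # s'))"
      unfolding V_def by auto
    then obtain m where m: "\<And>n. t \<notin> (\<Union>s'\<in>ext (s @ [n]) (m n). ok (s @ n # s'))" by metis
    define K where "K = Max (m ` {..j (length s)})"
    obtain s' where s': "bdd (s @ s')" "length s' = Suc K" "t \<in> ok (s @ s')"
      using t unfolding V_def ext_def by blast
    then obtain n r where nr: "s' = n # r" "length r = K" by (cases s') auto
    have "(s @ n # r) ! length s \<le> j (length s)"
      using s'(1) unfolding bdd_def nr by (metis add_Suc_right length_Cons length_append less_add_Suc1)
    then have "n \<le> j (length s)" by (simp add: nth_append)
    then have "m n \<le> K" unfolding K_def by (intro Max_ge) auto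
    then have len: "length (take (m n) r) = m n" using nr by simp
    have eq: "s @ n # take (m n) r = take (length s + Suc (m n)) (s @ s')"
      by (simp add: nr)
    have "bdd (s @ n # take (m n) r)"
      using bdd_take[OF s'(1)] unfolding eq .
    moreover have "t \<in> ok (s @ n # take (m n) r)"
      using ok_take s'(3) unfolding eq by blast
    ultimately show False using m[of n] len by (auto simp: ext_def)
  qed
  define B where "B = V []"
  define L where "L t = rec_nat [] (\<lambda>_ s. s @ [LEAST n. t \<in> V (s @ [n])])" for t
  have L0: "L t 0 = []" and LSuc: "L t (Suc k) = L t k @ [LEAST n. t \<in> V (L t k @ [n])]" for t k
    by (simp_all add: L_def)
  have L_meas: "(\<lambda>t. L t k) \<in> measurable M (count_space UNIV)" for k
  proof (induction k)
    case 0 then show ?case by (simp add: L0)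
  next
    case (Suc k)
    have "(\<lambda>t. s @ [LEAST n. t \<in> V (s @ [n])]) \<in> measurable M (count_space UNIV)" for s
    proof -
      have "(\<lambda>t. LEAST n. t \<in> V (s @ [n])) \<in> measurable M (count_space UNIV)"
        by measurable
      then show ?thesis by (rule measurable_compose) simp
    qed
    from measurable_compose_countable[OF this Suc] show ?case by (simp add: LSuc)
  qed
  have L_V: "t \<in> V (L t k)" if "t \<in> B" for t k
  proof (induction k)
    case 0 then show ?case using that by (simp add: L0 B_def)
  next
    case (Suc k) then show ?case unfolding LSuc by (rule LeastI_ex[OF V_step])
  qed
  have L_len: "length (L t k) = k" for t k
    by (induction k) (auto simp: L0 LSuc)
  have L_take: "take i (L t k) = L t i" if "i \<le> k" for i t k
    using that by (induction k) (auto simp: L0 LSuc L_len le_Suc_eq)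
  have L_map: "L t k = map (\<lambda>i. L t (Suc i) ! i) [0..<k]" for t k
    by (induction k) (auto simp: L0 LSuc L_len nth_append)
  have "\<exists>y. (t, y) \<in> G \<and> (\<lambda>k. c (L t k)) \<longlonglongrightarrow> y" if t: "t \<in> B" for t
  proof -
    have okL: "t \<in> ok (L t k)" for k using L_V[OF t, of k] V_ok by blast
    have tA: "t \<in> A (L t k)" for k
      using okL[of k] by (auto simp: ok_def L_len L_take split: if_splits dest!: bspec[of _ _ k])
    obtain y where y: "\<And>k. y \<in> C (L t k)" "(\<lambda>k. c (L t k)) \<longlonglongrightarrow> y"
    proof (rule closed_nested_cball_limit[of "\<lambda>k. C (L t k)" "\<lambda>k. c (L t k)"])
      show "closed (C (L t k))" for k by (rule C)
      show "(\<Inter>i\<le>k. C (L t i)) \<noteq> {}" for k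
      proof -
        have "(\<Inter>i\<le>k. C (take i (L t k))) \<noteq> {}" using okL[of k] by (auto simp: ok_def L_len split: if_splits)
        moreover have "(\<Inter>i\<le>k. C (take i (L t k))) = (\<Inter>i\<le>k. C (L t i))" by (intro INF_cong) (auto simp: L_take)
        ultimately show ?thesis by simp
      qed
      show "C (L t k) \<subseteq> cball (c (L t k)) ((1/2) ^ k)" if "k > 0" for k
        using cC[of "L t k"] that L_len[of t k] by force
    qed blast
    have "t \<in> A (map (\<lambda>i. L t (Suc i) ! i) [0..<k]) \<and> y \<in> C (map (\<lambda>i. L t (Suc i) ! i) [0..<k])" for k
      using tA[of k] y(1)[of k] unfolding L_map[of t k, symmetric] by blast
    then have "(t, y) \<in> G"
      unfolding G suslin_operation_def mem_Collect_eq case_prod_conv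
      by (intro exI[of _ "\<lambda>i. L t (Suc i) ! i"]) blast
    then show ?thesis using y(2) by blast
  qed
  then obtain f0 where f0: "\<And>t. t \<in> B \<Longrightarrow> (t, f0 t) \<in> G" "\<And>t. t \<in> B \<Longrightarrow> (\<lambda>k. c (L t k)) \<longlonglongrightarrow> f0 t"
    by metis
  have B_meas[measurable]: "B \<in> sets M" unfolding B_def by simp
  define f where "f t = (if t \<in> B then f0 t else c [])" for t
  have "f \<in> borel_measurable M"
  proof (rule borel_measurable_LIMSEQ_metric)
    have [measurable]: "(\<lambda>t. c (L t k)) \<in> borel_measurable M" for k
      by (rule measurable_compose[OF L_meas]) simp
    show "(\<lambda>t. if t \<in> B then c (L t k) else c []) \<in> borel_measurable M" for k by measurable
    show "(\<lambda>k. if t \<in> B then c (L t k) else c []) \<longlonglongrightarrow> f t" for t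
      using f0(2)[of t] by (auto simp: f_def)
  qed
  moreover have "(t, f t) \<in> G" if "t \<in> B" for t using f0(1) that by (simp add: f_def)
  moreover have "a \<le> emeasure M B"
  proof -
    \<comment> \<open>\<open>B\<close> is the decreasing intersection of the \<open>Q m\<close>.
      Each contains \<open>D (J m)\<close>, whose outer measure exceeds \<open>a\<close>, and
      finiteness of \<open>M\<close> gives continuity from above.\<close>
    define Q where "Q m = (\<Union>s'\<in>ext [] m. ok s')" for m
    have B: "B = (\<Inter>m. Q m)" by (simp add: B_def V_def Q_def)
    have Q[measurable]: "Q m \<in> sets M" for m unfolding Q_def by measurable
    have "Q (Suc m) \<subseteq> Q m" for m
    proof
      fix t assume "t \<in> Q (Suc m)"
      then obtain s where s: "bdd s" "length s = Suc m" "t \<in> ok s" unfolding Q_def ext_def by auto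
      then have "bdd (take m s)" "length (take m s) = m" "t \<in> ok (take m s)"
        using ok_take by (auto simp: bdd_def)
      then show "t \<in> Q m" unfolding Q_def ext_def by auto
    qed
    then have "decseq Q" by (rule decseq_SucI)
    have "a \<le> emeasure M (Q m)" for m
    proof -
      have "D (J m) \<subseteq> Q m"
      proof
        fix t assume "t \<in> D (J m)"
        then obtain \<sigma> y where \<sigma>: "\<And>i. i < m \<Longrightarrow> \<sigma> i \<le> j i" and br: "br t \<sigma> y"
          unfolding D_def J by auto
        have "bdd (map \<sigma> [0..<m])" using \<sigma> by (simp add: bdd_def)
        moreover have "t \<in> ok (map \<sigma> [0..<m])"
        proof -
          have "y \<in> (\<Inter>i\<le>m. C (take i (map \<sigma> [0..<m])))" "t \<in> (\<Inter>i\<le>m. A (take i (map \<sigma> [0..<m])))"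
            using br by (auto simp: br_def take_map)
          then show ?thesis unfolding ok_def by (auto simp del: INT_iff)
        qed
        ultimately show "t \<in> Q m" unfolding Q_def ext_def by auto
      qed
      then have "outer_measure_of M (D (J m)) \<le> emeasure M (Q m)"
        using outer_measure_of_mono[of "D (J m)" "Q m" M] by simp
      with aJ[of m] show ?thesis by simp
    qed
    then have "a \<le> (INF m. emeasure M (Q m))" by (rule INF_greatest)
    also have "\<dots> = emeasure M B"
      unfolding B by (rule INF_emeasure_decseq) (use \<open>decseq Q\<close> in auto)
    finally show ?thesis .
  qed
  ultimately show ?thesis using that B_meas by blast
qed

text \<open>Meant for arguments by contradiction. The set of exceptional \<open>t\<close> is a
  projection and may be nonmeasurable; negating the almost everywhere statement says that its
  measurable hull \<open>E\<close> is not null, so its outer measure exceeds some positive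
  \<open>a\<close>.\<close>

lemma measurable_selection_positive:
  fixes G :: "('t \<times> 'y::polish_space) set"
  assumes "finite_measure M" and G: "G \<in> sets (M \<Otimes>\<^sub>M borel)"
    and ne: "\<not> (AE t in M. \<forall>y. (t, y) \<notin> G)"
  obtains B f where "B \<in> sets M" "emeasure M B > 0" "f \<in> borel_measurable M"
    "\<And>t. t \<in> B \<Longrightarrow> (t, f t) \<in> G"
proof -
  interpret finite_measure M by fact
  have sub: "fst ` G \<subseteq> space M" using sets.sets_into_space[OF G] by (auto simp: space_pair_measure)
  obtain E where E: "E \<in> sets M" "fst ` G \<subseteq> E" "outer_measure_of M (fst ` G) = emeasure M E"
    using outer_measure_of_attain[OF sub] by blast
  have "emeasure M E \<noteq> 0"
  proof
    assume "emeasure M E = 0"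
    then have "E \<in> null_sets M" using E(1) by auto
    then have "AE t in M. t \<notin> E" by (rule AE_not_in)
    then have "AE t in M. \<forall>y. (t, y) \<notin> G" by eventually_elim (use E(2) in force)
    with ne show False by blast
  qed
  then have "0 < emeasure M E" by (simp add: zero_less_iff_neq_zero)
  then obtain a where a: "0 < a" "a < emeasure M E" using dense by blast
  show ?thesis
    using suslin_selection[OF assms(1) suslin_pair_measure[OF G], of a] a E(3) that
    by (metis order_less_le_trans)
qed

text \<open>Selections on sets \<open>B n\<close> that miss at most 1 / (n + 1) of the total measure
  are glued by using, at each \<open>t\<close>, the least \<open>n\<close> with \<open>t\<close> in
  \<open>B n\<close>.\<close>

lemma measurable_selection_AE:
  fixes G :: "('t \<times> 'y::polish_space) set"
  assumes "finite_measure M" and G: "G \<in> sets (M \<Otimes>\<^sub>M borel)"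
    and ne: "AE t in M. \<exists>y. (t, y) \<in> G"
  obtains f where "f \<in> borel_measurable M" "AE t in M. (t, f t) \<in> G"
proof -
  interpret finite_measure M by fact
  have sub: "fst ` G \<subseteq> space M" using sets.sets_into_space[OF G] by (auto simp: space_pair_measure)
  obtain E where E: "E \<in> sets M" "fst ` G \<subseteq> E" "outer_measure_of M (fst ` G) = emeasure M E"
    using outer_measure_of_attain[OF sub] by blast
  have "AE t in M. t \<in> E" using ne by eventually_elim (use E in force)
  then have outer: "outer_measure_of M (fst ` G) = emeasure M (space M)"
    unfolding E(3) using E(1) by (intro emeasure_eq_AE) auto
  have "\<exists>B f. B \<in> sets M \<and> measure M (space M) - 1 / Suc n \<le> measure M B \<and> f \<in> borel_measurable M
      \<and> (\<forall>t\<in>B. (t, f t) \<in> G)" for n :: nat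
  proof (cases "measure M (space M) > 0")
    case False
    obtain y :: 'y where True by blast
    show ?thesis
      by (rule exI[of _ "{}"], rule exI[of _ "\<lambda>_. y"]) (use False in \<open>auto simp: not_less intro: order_trans\<close>)
  next
    case True
    have "ennreal (measure M (space M) - 1 / Suc n) < outer_measure_of M (fst ` G)"
      unfolding outer emeasure_eq_measure using True by (intro ennreal_lessI) auto
    then obtain B f where "B \<in> sets M" "ennreal (measure M (space M) - 1 / Suc n) \<le> emeasure M B"
      "f \<in> borel_measurable M" "\<And>t. t \<in> B \<Longrightarrow> (t, f t) \<in> G"
      using suslin_selection[OF assms(1) suslin_pair_measure[OF G]] by metis
    then show ?thesis by (auto simp: emeasure_eq_measure ennreal_le_iff2)
  qed
  then obtain B f where B[measurable]: "\<And>n. B n \<in> sets M" 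
    and mB: "\<And>n::nat. measure M (space M) - 1 / Suc n \<le> measure M (B n)"
    and f[measurable]: "\<And>n. f n \<in> borel_measurable M" and fG: "\<And>n t. t \<in> B n \<Longrightarrow> (t, f n t) \<in> G"
    by metis
  define h where "h t = f (LEAST n. t \<in> B n) t" for t
  have "h \<in> borel_measurable M" unfolding h_def
    by (rule measurable_compose_countable[OF f]) measurable
  moreover have "AE t in M. (t, h t) \<in> G"
  proof -
    have "measure M (space M) - 1 / Suc n \<le> measure M (\<Union>n. B n)" for n
      using mB[of n] finite_measure_mono[OF UN_upper[of n UNIV B]] by auto
    moreover have "(\<lambda>n. measure M (space M) - 1 / Suc n) \<longlonglongrightarrow> measure M (space M) - 0"
      by (intro tendsto_intros LIMSEQ_inverse_real_of_nat[unfolded inverse_eq_divide])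
    ultimately have "measure M (space M) \<le> measure M (\<Union>n. B n)"
      by (intro LIMSEQ_le_const2) auto
    then have "measure M (space M - (\<Union>n. B n)) = 0"
      using finite_measure_compl[of "\<Union>n. B n"] measure_nonneg[of M "space M - (\<Union>n. B n)"] by simp
    then have "space M - (\<Union>n. B n) \<in> null_sets M"
      by (auto simp: emeasure_eq_measure)
    then have "AE t in M. t \<notin> space M - (\<Union>n. B n)" by (rule AE_not_in)
    with AE_space show ?thesis
    proof eventually_elim
      case (elim t)
      then obtain n where "t \<in> B n" by auto
      then have "t \<in> B (LEAST n. t \<in> B n)" by (rule LeastI)
      then show ?case unfolding h_def by (rule fG)
    qed
  qed
  ultimately show ?thesis using that by blast
qed

section \<open>Dominated extension on function spaces\<close>

text \<open>A minimal sublinear functional below \<open>p\<close> is linear: for every \<open>a\<close> the functional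
  \<open>h \<mapsto> inf\<^sub>s (m (h + s a) - s m a)\<close> is sublinear and below \<open>m\<close>, hence equal to \<open>m\<close>,
  and at \<open>-a\<close> it is at most \<open>- m a\<close>.\<close>

lemma sublinear_dominates_linear:
  fixes H :: "('t \<Rightarrow> 'a::real_vector) set" and p :: "('t \<Rightarrow> 'a) \<Rightarrow> real"
  assumes H_add: "\<And>f g. f \<in> H \<Longrightarrow> g \<in> H \<Longrightarrow> (\<lambda>t. f t + g t) \<in> H"
    and H_scale: "\<And>f c. f \<in> H \<Longrightarrow> (\<lambda>t. c *\<^sub>R f t) \<in> H"
    and p_add: "\<And>f g. f \<in> H \<Longrightarrow> g \<in> H \<Longrightarrow> p (\<lambda>t. f t + g t) \<le> p f + p g"
    and p_scale: "\<And>f c. f \<in> H \<Longrightarrow> c > 0 \<Longrightarrow> p (\<lambda>t. c *\<^sub>R f t) \<le> c * p f"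
  obtains l :: "('t \<Rightarrow> 'a) \<Rightarrow> real"
  where "\<And>f g. f \<in> H \<Longrightarrow> g \<in> H \<Longrightarrow> l (\<lambda>t. f t + g t) = l f + l g"
    and "\<And>f c. f \<in> H \<Longrightarrow> l (\<lambda>t. c *\<^sub>R f t) = c * l f"
    and "\<And>f. f \<in> H \<Longrightarrow> l f \<le> p f"
proof -
  define sub where "sub q \<longleftrightarrow> (\<forall>f\<in>H. \<forall>g\<in>H. q (\<lambda>t. f t + g t) \<le> q f + q g) \<and>
      (\<forall>f\<in>H. \<forall>c>0. q (\<lambda>t. c *\<^sub>R f t) \<le> c * q f)" for q :: "('t \<Rightarrow> 'a) \<Rightarrow> real"
  have sub_add: "q (\<lambda>t. f t + g t) \<le> q f + q g" if "sub q" "f \<in> H" "g \<in> H" for q f g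
    using that by (auto simp: sub_def)
  have sub_scale_le: "q (\<lambda>t. c *\<^sub>R f t) \<le> c * q f" if "sub q" "f \<in> H" "c > 0" for q f c
    using that by (auto simp: sub_def)
  have sub_scale: "q (\<lambda>t. c *\<^sub>R f t) = c * q f" if q: "sub q" "f \<in> H" "c > 0" for q f c
  proof -
    have "q (\<lambda>t. inverse c *\<^sub>R (c *\<^sub>R f t)) \<le> inverse c * q (\<lambda>t. c *\<^sub>R f t)"
      using q by (intro sub_scale_le H_scale) auto
    then have "q f \<le> inverse c * q (\<lambda>t. c *\<^sub>R f t)" using q by simp
    then have "c * q f \<le> q (\<lambda>t. c *\<^sub>R f t)" using q by (simp add: field_simps)
    with sub_scale_le[OF q] show ?thesis by simp
  qed
  have sub_neg: "- q (\<lambda>t. (-1) *\<^sub>R f t) \<le> q f" if q: "sub q" "f \<in> H" for q f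
  proof -
    have "q (\<lambda>t. 2 *\<^sub>R (0 *\<^sub>R f t)) = 2 * q (\<lambda>t. 0 *\<^sub>R f t)"
      using q by (intro sub_scale H_scale) auto
    then have "q (\<lambda>t. 0) = 0" by simp
    moreover have "q (\<lambda>t. f t + (-1) *\<^sub>R f t) \<le> q f + q (\<lambda>t. (-1) *\<^sub>R f t)"
      using q by (intro sub_add H_scale)
    ultimately show ?thesis by simp
  qed
  define A where "A = {q. sub q \<and> (\<forall>f\<in>H. q f \<le> p f) \<and> (\<forall>f. f \<notin> H \<longrightarrow> q f = 0)}"
  \<comment> \<open>The reversed pointwise order, so that Zorn's lemma delivers a minimal
    functional. It compares at every argument, also outside \<open>H\<close>, where nothing bounds
    the values from below; this is why \<open>A\<close> imposes the value 0 there.\<close>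
  define P where "P a b \<longleftrightarrow> (\<forall>f. b f \<le> a f)" for a b :: "('t \<Rightarrow> 'a) \<Rightarrow> real"
  have "\<exists>m\<in>A. \<forall>a\<in>A. P m a \<longrightarrow> a = m"
  proof (rule predicate_Zorn)
    show "partial_order_on A (relation_of P A)"
      by (rule partial_order_on_relation_ofI)
        (auto simp: P_def fun_eq_iff intro: order_trans antisym)
    fix C assume C: "C \<in> Chains (relation_of P A)"
    then have CA: "C \<subseteq> A" unfolding Chains_def relation_of_def by auto
    show "\<exists>u\<in>A. \<forall>a\<in>C. P a u"
    proof (cases "C = {}")
      case True
      define p' where "p' f = (if f \<in> H then p f else 0)" for f
      have "p' \<in> A" unfolding A_def sub_def p'_def using H_add H_scale p_add p_scale by auto
      then show ?thesis using True by blast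
    next
      case False
      define u where "u f = (if f \<in> H then (INF q\<in>C. q f) else 0)" for f
      \<comment> \<open>Domination at the opposite argument gives one lower bound for the whole
        chain.\<close>
      have bdd: "bdd_below ((\<lambda>q. q f) ` C)" if f: "f \<in> H" for f
      proof (rule bdd_belowI2)
        fix q assume "q \<in> C"
        then have q: "sub q" "\<And>f. f \<in> H \<Longrightarrow> q f \<le> p f" using CA by (auto simp: A_def)
        show "- p (\<lambda>t. (-1) *\<^sub>R f t) \<le> q f"
          using sub_neg[OF q(1) f] q(2)[OF H_scale[OF f, of "-1"]] by linarith
      qed
      have u_le: "u f \<le> q f" if "q \<in> C" for q f
      proof (cases "f \<in> H")
        case True then show ?thesis unfolding u_def using bdd that by (auto intro: cINF_lower)
      next
        case False then show ?thesis using that CA by (auto simp: u_def A_def)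
      qed
      have u_ge: "x \<le> u f" if "f \<in> H" "\<And>q. q \<in> C \<Longrightarrow> x \<le> q f" for x f
        unfolding u_def using that False by (auto intro: cINF_greatest)
      have "u (\<lambda>t. f t + g t) \<le> u f + u g" if f: "f \<in> H" and g: "g \<in> H" for f g
      proof -
        \<comment> \<open>The infima at \<open>f\<close> and at \<open>g\<close> may be approached
          by different members; in a chain the smaller of the two serves both.\<close>
        have *: "u (\<lambda>t. f t + g t) \<le> q1 f + q2 g" if q: "q1 \<in> C" "q2 \<in> C" for q1 q2
        proof -
          have "P q1 q2 \<or> P q2 q1" using C q unfolding Chains_def relation_of_def by auto
          then obtain q where q': "q \<in> C" "q f \<le> q1 f" "q g \<le> q2 g"
            using q unfolding P_def by (metis order_refl)
          have "sub q" using q' CA by (auto simp: A_def)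
          from sub_add[OF this f g] u_le[OF q'(1), of "\<lambda>t. f t + g t"] q' show ?thesis by linarith
        qed
        have **: "u (\<lambda>t. f t + g t) - q1 f \<le> u g" if "q1 \<in> C" for q1
          by (rule u_ge[OF g]) (use *[OF that] in \<open>simp add: diff_le_eq add.commute\<close>)
        have "u (\<lambda>t. f t + g t) - u g \<le> u f"
          by (rule u_ge[OF f]) (use ** in \<open>simp add: diff_le_eq add.commute\<close>)
        then show ?thesis by simp
      qed
      moreover have "u (\<lambda>t. c *\<^sub>R f t) \<le> c * u f" if f: "f \<in> H" and c: "c > 0" for f c
      proof -
        have "inverse c * u (\<lambda>t. c *\<^sub>R f t) \<le> u f"
        proof (rule u_ge[OF f])
          fix q assume q: "q \<in> C"
          then have "sub q" using CA by (auto simp: A_def)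
          from sub_scale_le[OF this f c] u_le[OF q, of "\<lambda>t. c *\<^sub>R f t"]
          have "u (\<lambda>t. c *\<^sub>R f t) \<le> c * q f" by linarith
          then show "inverse c * u (\<lambda>t. c *\<^sub>R f t) \<le> q f" using c by (simp add: field_simps)
        qed
        then show ?thesis using c by (simp add: field_simps)
      qed
      moreover have "u f \<le> p f" if "f \<in> H" for f
      proof -
        obtain q where "q \<in> C" using False by blast
        then show ?thesis using u_le[of q f] CA that by (force simp: A_def)
      qed
      ultimately have "u \<in> A" unfolding A_def sub_def by (auto simp: u_def)
      then show ?thesis using u_le by (auto simp: P_def)
    qed
  qed
  then obtain m where m: "m \<in> A" and min: "\<And>a. a \<in> A \<Longrightarrow> P m a \<Longrightarrow> a = m" by blast
  have sm: "sub m" and mp: "\<And>f. f \<in> H \<Longrightarrow> m f \<le> p f" and m0: "\<And>f. f \<notin> H \<Longrightarrow> m f = 0"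
    using m by (auto simp: A_def)
  have odd: "m (\<lambda>t. (-1) *\<^sub>R a t) \<le> - m a" if a: "a \<in> H" for a
  proof -
    define n where "n f = (if f \<in> H then (INF s\<in>{0..}. m (\<lambda>t. f t + s *\<^sub>R a t) - s * m a) else 0)" for f
    have ms: "m (\<lambda>t. s *\<^sub>R a t) = s * m a" if "s \<ge> 0" for s
    proof (cases "s = 0")
      case True
      have "m (\<lambda>t. 2 *\<^sub>R (0 *\<^sub>R a t)) = 2 * m (\<lambda>t. 0 *\<^sub>R a t)"
        by (intro sub_scale H_scale sm a) auto
      with True show ?thesis by simp
    next
      case False then show ?thesis using that by (intro sub_scale sm a) auto
    qed
    have bdd: "bdd_below ((\<lambda>s. m (\<lambda>t. f t + s *\<^sub>R a t) - s * m a) ` {0..})" if f: "f \<in> H" for f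
    proof (rule bdd_belowI2)
      fix s :: real assume "s \<in> {0..}"
      have "m (\<lambda>t. (f t + s *\<^sub>R a t) + (-1) *\<^sub>R f t) \<le> m (\<lambda>t. f t + s *\<^sub>R a t) + m (\<lambda>t. (-1) *\<^sub>R f t)"
        by (intro sub_add sm H_add H_scale f a)
      then show "- m (\<lambda>t. (-1) *\<^sub>R f t) \<le> m (\<lambda>t. f t + s *\<^sub>R a t) - s * m a"
        using ms[of s] \<open>s \<in> {0..}\<close> by simp
    qed
    have n_le: "n f \<le> m (\<lambda>t. f t + s *\<^sub>R a t) - s * m a" if "f \<in> H" "s \<ge> 0" for f s
      unfolding n_def using bdd[OF that(1)] that by (auto intro: cINF_lower)
    have n_ge: "x \<le> n f" if "f \<in> H" "\<And>s. s \<ge> 0 \<Longrightarrow> x \<le> m (\<lambda>t. f t + s *\<^sub>R a t) - s * m a" for x f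
      unfolding n_def using that by (auto intro: cINF_greatest)
    have nm: "n f \<le> m f" for f
      using n_le[of f 0] m0 by (cases "f \<in> H") (auto simp: n_def)
    have "n (\<lambda>t. f t + g t) \<le> n f + n g" if f: "f \<in> H" and g: "g \<in> H" for f g
    proof -
      have *: "n (\<lambda>t. f t + g t) \<le> (m (\<lambda>t. f t + r *\<^sub>R a t) - r * m a) + (m (\<lambda>t. g t + s *\<^sub>R a t) - s * m a)"
        if "r \<ge> 0" "s \<ge> 0" for r s
      proof -
        have "m (\<lambda>t. (f t + r *\<^sub>R a t) + (g t + s *\<^sub>R a t)) \<le> m (\<lambda>t. f t + r *\<^sub>R a t) + m (\<lambda>t. g t + s *\<^sub>R a t)"
          by (intro sub_add sm H_add H_scale f g a)
        moreover have "(\<lambda>t. (f t + r *\<^sub>R a t) + (g t + s *\<^sub>R a t)) = (\<lambda>t. (f t + g t) + (r + s) *\<^sub>R a t)"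
          by (simp add: algebra_simps)
        moreover have "n (\<lambda>t. f t + g t) \<le> m (\<lambda>t. (f t + g t) + (r + s) *\<^sub>R a t) - (r + s) * m a"
          using that by (intro n_le H_add f g) auto
        ultimately show ?thesis by (simp add: algebra_simps)
      qed
      have **: "n (\<lambda>t. f t + g t) - (m (\<lambda>t. f t + r *\<^sub>R a t) - r * m a) \<le> n g" if "r \<ge> 0" for r
        by (rule n_ge[OF g]) (use *[OF that] in \<open>simp add: algebra_simps\<close>)
      have "n (\<lambda>t. f t + g t) - n g \<le> n f"
        by (rule n_ge[OF f]) (use ** in \<open>simp add: algebra_simps\<close>)
      then show ?thesis by simp
    qed
    moreover have "n (\<lambda>t. c *\<^sub>R f t) \<le> c * n f" if f: "f \<in> H" and c: "c > 0" for f c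
    proof -
      have "inverse c * n (\<lambda>t. c *\<^sub>R f t) \<le> n f"
      proof (rule n_ge[OF f])
        fix s :: real assume s: "s \<ge> 0"
        have "n (\<lambda>t. c *\<^sub>R f t) \<le> m (\<lambda>t. c *\<^sub>R f t + (c * s) *\<^sub>R a t) - (c * s) * m a"
          using s c by (intro n_le H_scale f) auto
        also have "(\<lambda>t. c *\<^sub>R f t + (c * s) *\<^sub>R a t) = (\<lambda>t. c *\<^sub>R (f t + s *\<^sub>R a t))"
          by (simp add: algebra_simps)
        also have "m \<dots> = c * m (\<lambda>t. f t + s *\<^sub>R a t)"
          by (intro sub_scale sm H_add H_scale f a c)
        finally show "inverse c * n (\<lambda>t. c *\<^sub>R f t) \<le> m (\<lambda>t. f t + s *\<^sub>R a t) - s * m a"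
          using c by (simp add: field_simps)
      qed
      then show ?thesis using c by (simp add: field_simps)
    qed
    moreover have "n f \<le> p f" if "f \<in> H" for f using nm[of f] mp[OF that] by simp
    ultimately have "n \<in> A" unfolding A_def sub_def by (auto simp: n_def)
    then have "n = m" using min nm by (auto simp: P_def)
    then have "m (\<lambda>t. (-1) *\<^sub>R a t) \<le> m (\<lambda>t. (-1) *\<^sub>R a t + 1 *\<^sub>R a t) - 1 * m a"
      using n_le[of "\<lambda>t. (-1) *\<^sub>R a t" 1] H_scale[OF a, of "-1"] by simp
    then show ?thesis using ms[of 0] by simp
  qed
  have odd': "m (\<lambda>t. (-1) *\<^sub>R a t) = - m a" if "a \<in> H" for a
    using odd[OF that] sub_neg[OF sm that] by simp
  have lin_add: "m (\<lambda>t. f t + g t) = m f + m g" if f: "f \<in> H" and g: "g \<in> H" for f g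
  proof -
    have "m (\<lambda>t. (f t + g t) + (-1) *\<^sub>R g t) \<le> m (\<lambda>t. f t + g t) + m (\<lambda>t. (-1) *\<^sub>R g t)"
      by (intro sub_add sm H_add H_scale f g)
    then have "m f \<le> m (\<lambda>t. f t + g t) - m g" using odd'[OF g] by simp
    with sub_add[OF sm f g] show ?thesis by simp
  qed
  have lin_scale: "m (\<lambda>t. c *\<^sub>R f t) = c * m f" if f: "f \<in> H" for f c
  proof -
    consider "c > 0" | "c = 0" | "c < 0" by linarith
    then show ?thesis
    proof cases
      case 1 then show ?thesis by (intro sub_scale sm f)
    next
      case 2
      have "m (\<lambda>t. f t + (-1) *\<^sub>R f t) = m f + m (\<lambda>t. (-1) *\<^sub>R f t)"
        by (intro lin_add H_scale f)
      with 2 show ?thesis using odd'[OF f] by simp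
    next
      case 3
      have "m (\<lambda>t. (-1) *\<^sub>R ((- c) *\<^sub>R f t)) = - m (\<lambda>t. (- c) *\<^sub>R f t)"
        by (intro odd' H_scale f)
      also have "m (\<lambda>t. (- c) *\<^sub>R f t) = - c * m f"
        using 3 by (intro sub_scale sm f) auto
      finally show ?thesis by simp
    qed
  qed
  show ?thesis using that[of m] lin_add lin_scale mp by blast
qed

section \<open>Integral representation of dominated functionals\<close>

text \<open>Functions, not classes, standing for the essentially bounded elements. The bound holds
  only almost everywhere because the gradient bound of the theorem does.\<close>

definition bounded_measurable :: "'t measure \<Rightarrow> ('t \<Rightarrow> 'a::real_normed_vector) set" where
  "bounded_measurable M = {f \<in> borel_measurable M. \<exists>K. AE t in M. norm (f t) \<le> K}"

lemma bounded_measurable_add: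
  fixes f :: "'t \<Rightarrow> 'a::euclidean_space"
  assumes "f \<in> bounded_measurable M" "g \<in> bounded_measurable M"
  shows "(\<lambda>t. f t + g t) \<in> bounded_measurable M"
proof -
  obtain K L where "AE t in M. norm (f t) \<le> K" "AE t in M. norm (g t) \<le> L"
    using assms by (auto simp: bounded_measurable_def)
  then have "AE t in M. norm (f t + g t) \<le> K + L"
    by eventually_elim (meson add_mono norm_triangle_ineq order_trans)
  then show ?thesis using assms by (auto simp: bounded_measurable_def)
qed

lemma bounded_measurable_scaleR:
  fixes f :: "'t \<Rightarrow> 'a::euclidean_space"
  assumes "f \<in> bounded_measurable M"
  shows "(\<lambda>t. c *\<^sub>R f t) \<in> bounded_measurable M"
proof -
  obtain K where "AE t in M. norm (f t) \<le> K" using assms by (auto simp: bounded_measurable_def)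
  then have "AE t in M. norm (c *\<^sub>R f t) \<le> \<bar>c\<bar> * K" by eventually_elim (auto intro: mult_left_mono)
  then show ?thesis using assms by (auto simp: bounded_measurable_def)
qed

lemma bounded_measurable_mult_integrable:
  fixes f \<theta> :: "'t \<Rightarrow> real"
  assumes "f \<in> bounded_measurable M" "integrable M \<theta>"
  shows "integrable M (\<lambda>t. \<theta> t * f t)"
proof -
  obtain K where K: "AE t in M. norm (f t) \<le> K" and [measurable]: "f \<in> borel_measurable M"
    using assms by (auto simp: bounded_measurable_def)
  have [measurable]: "\<theta> \<in> borel_measurable M" using assms by auto
  show ?thesis
  proof (rule Bochner_Integration.integrable_bound)
    show "integrable M (\<lambda>t. K * \<theta> t)" using assms(2) by simp
    show "AE t in M. norm (\<theta> t * f t) \<le> norm (K * \<theta> t)"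
      using K
    proof eventually_elim
      case (elim t)
      then show "norm (\<theta> t * f t) \<le> norm (K * \<theta> t)"
        using norm_ge_zero[of "f t"] by (auto simp: abs_mult mult.commute[of _ "\<bar>\<theta> t\<bar>"] intro!: mult_left_mono)
    qed
  qed simp
qed

text \<open>A bounded functional on bounded functions may be purely finitely additive. The
  integrable \<theta> prevents this: along sets decreasing to the empty set dominated convergence
  forces the values to 0, and null sets receive the value 0, so Radon-Nikodym applies.\<close>

lemma dominated_functional_density:
  fixes \<Lambda> :: "('t \<Rightarrow> real) \<Rightarrow> real"
  assumes "finite_measure M" and \<theta>: "integrable M \<theta>" "\<And>t. \<theta> t \<ge> 0"
    and add: "\<And>f g. f \<in> bounded_measurable M \<Longrightarrow> g \<in> bounded_measurable M \<Longrightarrow> \<Lambda> (\<lambda>t. f t + g t) = \<Lambda> f + \<Lambda> g"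
    and scale: "\<And>f c. f \<in> bounded_measurable M \<Longrightarrow> \<Lambda> (\<lambda>t. c * f t) = c * \<Lambda> f"
    and le: "\<And>f. f \<in> bounded_measurable M \<Longrightarrow> \<Lambda> f \<le> (\<integral>t. \<theta> t * \<bar>f t\<bar> \<partial>M)"
  obtains \<zeta> where "integrable M \<zeta>" "\<And>f. f \<in> bounded_measurable M \<Longrightarrow> \<Lambda> f = (\<integral>t. \<zeta> t * f t \<partial>M)"
proof -
  interpret finite_measure M by fact
  note [measurable] = borel_measurable_integrable[OF \<theta>(1)]
  have bm_scale: "(\<lambda>t. c * f t) \<in> bounded_measurable M" if "f \<in> bounded_measurable M" for f :: "'t \<Rightarrow> real" and c
    using bounded_measurable_scaleR[OF that, of c] by simp
  have abs_le: "\<bar>\<Lambda> f\<bar> \<le> (\<integral>t. \<theta> t * \<bar>f t\<bar> \<partial>M)" if f: "f \<in> bounded_measurable M" for f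
    using le[OF f] le[OF bm_scale[OF f, of "-1"]] scale[OF f, of "-1"] by simp
  have diff: "\<Lambda> f - \<Lambda> g = \<Lambda> (\<lambda>t. f t - g t)" "(\<lambda>t. f t - g t) \<in> bounded_measurable M"
    if "f \<in> bounded_measurable M" "g \<in> bounded_measurable M" for f g
    using add[OF that(1) bm_scale[OF that(2), of "-1"]] scale[OF that(2), of "-1"]
      bounded_measurable_add[OF that(1) bm_scale[OF that(2), of "-1"]] by simp_all
  have ind: "(indicator B :: 't \<Rightarrow> real) \<in> bounded_measurable M" if "B \<in> sets M" for B
    using that by (auto simp: bounded_measurable_def intro!: exI[of _ 1] split: split_indicator)
  define I where "I B = (\<integral>t. \<theta> t * indicator B t \<partial>M)" for B
  \<comment> \<open>The value of \<open>\<Lambda>\<close> on an indicator may be negative but is at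
    least \<open>- I B\<close>; adding \<open>I B\<close> gives a positive set function with values
    at most \<open>2 * I B\<close>. The shift is undone by subtracting \<open>\<theta>\<close> in
    the definition of \<open>\<zeta>\<close>.\<close>
  define \<nu> where "\<nu> B = \<Lambda> (indicator B) + I B" for B
  have \<nu>_bounds: "0 \<le> \<nu> B" "\<nu> B \<le> 2 * I B" if "B \<in> sets M" for B
    using abs_le[OF ind[OF that]] by (auto simp: \<nu>_def I_def)
  have I_int: "integrable M (\<lambda>t. \<theta> t * indicator B t)" if "B \<in> sets M" for B
    using bounded_measurable_mult_integrable[OF ind[OF that] \<theta>(1)] .
  have Lempty: "\<Lambda> (indicator {}) = 0" using abs_le[OF ind[of "{}"]] by simp
  have \<nu>_empty: "\<nu> {} = 0" using Lempty by (simp add: \<nu>_def I_def)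
  have \<nu>_add: "\<nu> (A \<union> B) = \<nu> A + \<nu> B" if "A \<in> sets M" "B \<in> sets M" "A \<inter> B = {}" for A B
  proof -
    have i: "indicator (A \<union> B) = (\<lambda>t. indicator A t + indicator B t :: real)"
      using that(3) by (auto simp: fun_eq_iff split: split_indicator)
    have "\<Lambda> (indicator (A \<union> B)) = \<Lambda> (indicator A) + \<Lambda> (indicator B)"
      unfolding i by (rule add[OF ind[OF that(1)] ind[OF that(2)]])
    moreover have "I (A \<union> B) = I A + I B"
      unfolding I_def i ring_distribs using that by (intro Bochner_Integration.integral_add I_int)
    ultimately show ?thesis by (simp add: \<nu>_def)
  qed
  define N where "N = measure_of (space M) (sets M) (\<lambda>B. ennreal (\<nu> B))"
  have ca: "countably_additive (sets M) (\<lambda>B. ennreal (\<nu> B))"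
  proof (rule sets.empty_continuous_imp_countably_additive)
    show "positive (sets M) (\<lambda>B. ennreal (\<nu> B))" using \<nu>_empty by (simp add: positive_def)
    show "Measure_Space.additive (sets M) (\<lambda>B. ennreal (\<nu> B))"
      by (auto simp: Measure_Space.additive_def \<nu>_add \<nu>_bounds ennreal_plus)
    show "\<forall>A\<in>sets M. ennreal (\<nu> A) \<noteq> \<infinity>" by simp
    fix A :: "nat \<Rightarrow> 't set"
    assume A: "range A \<subseteq> sets M" "decseq A" "(\<Inter>i. A i) = {}"
    have "(\<lambda>i. I (A i)) \<longlonglongrightarrow> (\<integral>t. 0 \<partial>M)"
      unfolding I_def
    proof (rule integral_dominated_convergence[where w=\<theta>])
      show "AE t in M. (\<lambda>i. \<theta> t * indicator (A i) t) \<longlonglongrightarrow> 0"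
      proof (rule AE_I2)
        fix t
        have "(\<lambda>i. indicator (A i) t :: real) \<longlonglongrightarrow> indicator (\<Inter>i. A i) t"
          using A(2) by (rule LIMSEQ_indicator_decseq)
        then show "(\<lambda>i. \<theta> t * indicator (A i) t) \<longlonglongrightarrow> 0"
          using A(3) by (intro tendsto_mult_right_zero) simp
      qed
    qed (use A \<theta> in \<open>auto split: split_indicator\<close>)
    then have I0: "(\<lambda>i. 2 * I (A i)) \<longlonglongrightarrow> 0" by (auto intro: tendsto_mult_right_zero)
    have "(\<lambda>i. \<nu> (A i)) \<longlonglongrightarrow> 0"
      by (rule tendsto_sandwich[OF _ _ tendsto_const I0]) (use A \<nu>_bounds in auto)
    then show "(\<lambda>i. ennreal (\<nu> (A i))) \<longlonglongrightarrow> 0"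
      using tendsto_ennrealI[of _ 0] by simp
  qed
  have emN: "emeasure N B = ennreal (\<nu> B)" if "B \<in> sets M" for B
    unfolding N_def using that ca \<nu>_empty
    by (intro emeasure_measure_of_sigma[OF sets.sigma_algebra_axioms]) (auto simp: positive_def)
  have setsN: "sets N = sets M" and spaceN: "space N = space M" by (simp_all add: N_def)
  have "finite_measure N" by (rule finite_measureI) (simp add: spaceN emN)
  moreover have "absolutely_continuous M N"
    unfolding absolutely_continuous_def
  proof
    fix B assume B: "B \<in> null_sets M"
    then have "I B = 0"
      unfolding I_def by (intro integral_eq_zero_AE) (use AE_not_in[OF B] in \<open>auto elim!: eventually_mono\<close>)
    then have "\<nu> B = 0" using \<nu>_bounds[of B] B by auto
    then show "B \<in> null_sets N" using B by (auto simp: null_sets_def setsN emN)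
  qed
  ultimately obtain k where k[measurable]: "k \<in> borel_measurable M" and kN: "density M k = N"
    using Radon_Nikodym_finite_measure setsN by blast
  have nnk: "(\<integral>\<^sup>+t. k t * indicator B t \<partial>M) = ennreal (\<nu> B)" if "B \<in> sets M" for B
    using emeasure_density[OF k that] emN[OF that] kN by simp
  have "(\<integral>\<^sup>+t. k t \<partial>M) = (\<integral>\<^sup>+t. k t * indicator (space M) t \<partial>M)"
    by (intro nn_integral_cong) simp
  then have "(\<integral>\<^sup>+t. k t \<partial>M) \<noteq> \<infinity>" using nnk[of "space M"] by simp
  then have kfin: "AE t in M. k t \<noteq> \<infinity>" by (intro nn_integral_PInf_AE) auto
  define k' where "k' t = enn2real (k t)" for t
  have [measurable]: "k' \<in> borel_measurable M" unfolding k'_def by measurable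
  have k'ind: "has_bochner_integral M (\<lambda>t. k' t * indicator B t) (\<nu> B)" if B[measurable]: "B \<in> sets M" for B
  proof (rule has_bochner_integral_nn_integral)
    have "(\<integral>\<^sup>+t. ennreal (k' t * indicator B t) \<partial>M) = (\<integral>\<^sup>+t. k t * indicator B t \<partial>M)"
      by (rule nn_integral_cong_AE) (use kfin in eventually_elim, auto simp: k'_def less_top split: split_indicator)
    then show "(\<integral>\<^sup>+t. ennreal (k' t * indicator B t) \<partial>M) = ennreal (\<nu> B)" using nnk[OF B] by simp
  qed (use \<nu>_bounds[OF B] in \<open>auto simp: k'_def\<close>)
  have k'int: "integrable M k'"
  proof -
    have "integrable M (\<lambda>t. k' t * indicator (space M) t)" using k'ind[of "space M"] by (auto simp: has_bochner_integral_iff)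
    moreover have "integrable M (\<lambda>t. k' t * indicator (space M) t) \<longleftrightarrow> integrable M k'"
      by (rule Bochner_Integration.integrable_cong) auto
    ultimately show ?thesis by blast
  qed
  define \<zeta> where "\<zeta> t = k' t - \<theta> t" for t
  have \<zeta>: "integrable M \<zeta>" unfolding \<zeta>_def using k'int \<theta> by simp
  have \<zeta>_int: "integrable M (\<lambda>t. \<zeta> t * f t)" if "f \<in> bounded_measurable M" for f
    using bounded_measurable_mult_integrable[OF that \<zeta>] .
  have \<zeta>_ind: "\<Lambda> (indicator B) = (\<integral>t. \<zeta> t * indicator B t \<partial>M)" if B: "B \<in> sets M" for B
    using k'ind[OF B] I_int[OF B]
    by (auto simp: \<zeta>_def left_diff_distrib has_bochner_integral_iff \<nu>_def I_def)
  have simple: "\<Lambda> s = (\<integral>t. \<zeta> t * s t \<partial>M)" "s \<in> bounded_measurable M" if s: "simple_function M s" for s :: "'t \<Rightarrow> real"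
  proof -
    have fin: "finite (s ` space M)" using s by (rule simple_functionD)
    show sb: "s \<in> bounded_measurable M"
      using borel_measurable_simple_function[OF s] finite_imp_bounded[OF fin]
      by (auto simp: bounded_measurable_def bounded_iff intro: AE_I2)
    define E where "E c = s -` {c} \<inter> space M" for c
    have E: "E c \<in> sets M" for c unfolding E_def using s by (rule simple_functionD)
    have sum: "\<Lambda> (\<lambda>t. \<Sum>c\<in>X. c * indicator (E c) t) = (\<integral>t. \<zeta> t * (\<Sum>c\<in>X. c * indicator (E c) t) \<partial>M)
        \<and> (\<lambda>t. \<Sum>c\<in>X. c * indicator (E c) t) \<in> bounded_measurable M" if "finite X" for X
      using that
    proof (induction X rule: finite_induct)
      case empty
      have "indicator {} = (\<lambda>t::'t. 0::real)" by (auto simp: fun_eq_iff)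
      then show ?case using Lempty ind[of "{}"] by simp
    next
      case (insert c X)
      let ?g = "\<lambda>t. \<Sum>c\<in>X. c * indicator (E c) t"
      have g: "?g \<in> bounded_measurable M" using insert by blast
      have c: "(\<lambda>t. c * indicator (E c) t) \<in> bounded_measurable M" by (rule bm_scale[OF ind[OF E]])
      have "\<Lambda> (\<lambda>t. c * indicator (E c) t + ?g t) = c * \<Lambda> (indicator (E c)) + \<Lambda> ?g"
        using add[OF c g] scale[OF ind[OF E[of c]], of c] by simp
      also have "\<dots> = (\<integral>t. \<zeta> t * (c * indicator (E c) t) \<partial>M) + (\<integral>t. \<zeta> t * ?g t \<partial>M)"
        using insert by (simp add: \<zeta>_ind[OF E] mult.left_commute)
      also have "\<dots> = (\<integral>t. \<zeta> t * (c * indicator (E c) t + ?g t) \<partial>M)"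
        unfolding distrib_left by (rule Bochner_Integration.integral_add[OF \<zeta>_int[OF c] \<zeta>_int[OF g], symmetric])
      finally show ?case
        unfolding sum.insert[OF insert(1,2)] using bounded_measurable_add[OF c g] by blast
    qed
    define X where "X = s ` space M"
    have fin: "finite X" using fin by (simp add: X_def)
    let ?s = "\<lambda>t. \<Sum>c\<in>X. c * indicator (E c) t"
    have eq: "s t = ?s t" if "t \<in> space M" for t
      unfolding X_def E_def mult.commute[of _ "indicator _ _"]
      using simple_function_indicator_representation_banach[OF s that] unfolding real_scaleR_def .
    have sb': "?s \<in> bounded_measurable M" using sum[OF fin] by blast
    \<comment> \<open>\<open>\<Lambda>\<close> acts on total functions, so agreement of
      \<open>s\<close> with its simple form on \<open>space M\<close> alone does not at once give
      equal values; the domination closes this gap.\<close>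
    have "\<bar>\<Lambda> (\<lambda>t. s t - ?s t)\<bar> \<le> (\<integral>t. \<theta> t * \<bar>s t - ?s t\<bar> \<partial>M)"
      by (rule abs_le[OF diff(2)[OF sb sb']])
    also have "\<dots> = (\<integral>t. 0 \<partial>M)"
      by (rule Bochner_Integration.integral_cong) (use eq in auto)
    finally have "\<Lambda> s = \<Lambda> ?s" using diff(1)[OF sb sb'] by simp
    also have "\<dots> = (\<integral>t. \<zeta> t * ?s t \<partial>M)" using sum[OF fin] by blast
    also have "\<dots> = (\<integral>t. \<zeta> t * s t \<partial>M)"
      by (rule Bochner_Integration.integral_cong) (use eq in auto)
    finally show "\<Lambda> s = (\<integral>t. \<zeta> t * s t \<partial>M)" .
  qed
  have "\<Lambda> f = (\<integral>t. \<zeta> t * f t \<partial>M)" if f: "f \<in> bounded_measurable M" for f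
  proof -
    obtain K where K: "AE t in M. \<bar>f t\<bar> \<le> K" and [measurable]: "f \<in> borel_measurable M"
      using f by (auto simp: bounded_measurable_def)
    obtain s where s: "\<And>i. simple_function M (s i)" "\<And>t. t \<in> space M \<Longrightarrow> (\<lambda>i. s i t) \<longlonglongrightarrow> f t"
      "\<And>i t. t \<in> space M \<Longrightarrow> \<bar>s i t\<bar> \<le> 2 * \<bar>f t\<bar>"
      using borel_measurable_implies_sequence_metric[of f M 0] unfolding dist_real_def by auto metis
    note [measurable] = borel_measurable_simple_function[OF s(1)] borel_measurable_integrable[OF \<zeta>]
    have b: "AE t in M. \<bar>s i t\<bar> \<le> 2 * K" for i
      using K AE_space
    proof eventually_elim
      case (elim t)
      then show ?case using s(3)[of t i] by linarith
    qed
    have "(\<lambda>i. \<integral>t. \<zeta> t * s i t \<partial>M) \<longlonglongrightarrow> (\<integral>t. \<zeta> t * f t \<partial>M)"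
    proof (rule integral_dominated_convergence[where w="\<lambda>t. \<bar>\<zeta> t\<bar> * (2 * K)"])
      show "AE t in M. norm (\<zeta> t * s i t) \<le> \<bar>\<zeta> t\<bar> * (2 * K)" for i
        using b[of i] by eventually_elim (auto simp: abs_mult intro!: mult_left_mono)
    qed (use s(2) \<zeta> in \<open>auto intro!: tendsto_intros\<close>)
    moreover have "(\<lambda>i. \<Lambda> (s i)) \<longlonglongrightarrow> \<Lambda> f"
    proof -
      have "(\<lambda>i. \<integral>t. \<theta> t * \<bar>f t - s i t\<bar> \<partial>M) \<longlonglongrightarrow> (\<integral>t. 0 \<partial>M)"
      proof (rule integral_dominated_convergence[where w="\<lambda>t. \<bar>\<theta> t\<bar> * (3 * K)"])
        show "AE t in M. norm (\<theta> t * \<bar>f t - s i t\<bar>) \<le> \<bar>\<theta> t\<bar> * (3 * K)" for i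
          using b[of i] K
        proof eventually_elim
          case (elim t)
          then have "\<bar>f t - s i t\<bar> \<le> 3 * K" by linarith
          then show "norm (\<theta> t * \<bar>f t - s i t\<bar>) \<le> \<bar>\<theta> t\<bar> * (3 * K)"
            by (simp add: abs_mult mult_left_mono)
        qed
        show "AE t in M. (\<lambda>i. \<theta> t * \<bar>f t - s i t\<bar>) \<longlonglongrightarrow> 0"
        proof (rule AE_I2)
          fix t assume "t \<in> space M"
          then have "(\<lambda>i. \<theta> t * \<bar>f t - s i t\<bar>) \<longlonglongrightarrow> \<theta> t * \<bar>f t - f t\<bar>"
            by (intro tendsto_intros s(2))
          then show "(\<lambda>i. \<theta> t * \<bar>f t - s i t\<bar>) \<longlonglongrightarrow> 0" by simp
        qed
      qed (use \<theta> in auto)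
      then have lim: "(\<lambda>i. \<integral>t. \<theta> t * \<bar>f t - s i t\<bar> \<partial>M) \<longlonglongrightarrow> 0" by simp
      have "(\<lambda>i. \<Lambda> f - \<Lambda> (s i)) \<longlonglongrightarrow> 0"
        by (rule Lim_null_comparison[OF _ lim])
          (use diff[OF f simple(2)[OF s(1)]] abs_le in \<open>auto intro!: always_eventually\<close>)
      then have "(\<lambda>i. \<Lambda> f - (\<Lambda> f - \<Lambda> (s i))) \<longlonglongrightarrow> \<Lambda> f - 0" by (intro tendsto_intros)
      then show ?thesis by simp
    qed
    ultimately show ?thesis using simple(1)[OF s(1)] LIMSEQ_unique by simp
  qed
  with \<zeta> show ?thesis using that by blast
qed

text \<open>The scalar result is applied along each basis vector; their unit length lets the same
  \<open>\<theta>\<close> dominate every coordinate.\<close>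

lemma vector_dominated_functional_density:
  fixes l :: "('t \<Rightarrow> 'a::euclidean_space) \<Rightarrow> real"
  assumes "finite_measure M" and \<theta>: "integrable M \<theta>" "\<And>t. \<theta> t \<ge> 0"
    and add: "\<And>f g. f \<in> bounded_measurable M \<Longrightarrow> g \<in> bounded_measurable M \<Longrightarrow> l (\<lambda>t. f t + g t) = l f + l g"
    and scale: "\<And>f c. f \<in> bounded_measurable M \<Longrightarrow> l (\<lambda>t. c *\<^sub>R f t) = c * l f"
    and le: "\<And>f. f \<in> bounded_measurable M \<Longrightarrow> l f \<le> (\<integral>t. \<theta> t * norm (f t) \<partial>M)"
  obtains \<zeta> where "integrable M \<zeta>"
    "\<And>f. f \<in> bounded_measurable M \<Longrightarrow> integrable M (\<lambda>t. \<zeta> t \<bullet> f t)"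
    "\<And>f. f \<in> bounded_measurable M \<Longrightarrow> l f = (\<integral>t. \<zeta> t \<bullet> f t \<partial>M)"
proof -
  have bm_b: "(\<lambda>t. f t *\<^sub>R b) \<in> bounded_measurable M" if "f \<in> bounded_measurable M" "b \<in> Basis" for f and b :: 'a
    using that by (auto simp: bounded_measurable_def)
  have bm_i: "(\<lambda>t. f t \<bullet> b) \<in> bounded_measurable M" if f: "f \<in> bounded_measurable M" and b: "b \<in> Basis"
    for f and b :: 'a
  proof -
    obtain K where "AE t in M. norm (f t) \<le> K" using f by (auto simp: bounded_measurable_def)
    then have "AE t in M. norm (f t \<bullet> b) \<le> K"
      by eventually_elim (use Basis_le_norm[OF b] order_trans in auto)
    then show ?thesis using f by (auto simp: bounded_measurable_def)
  qed
  have "\<exists>\<zeta>. integrable M \<zeta> \<and> (\<forall>f\<in>bounded_measurable M. l (\<lambda>t. f t *\<^sub>R b) = (\<integral>t. \<zeta> t * f t \<partial>M))"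
    if b: "b \<in> Basis" for b
  proof -
    obtain \<zeta> where "integrable M \<zeta>"
      "\<And>f. f \<in> bounded_measurable M \<Longrightarrow> l (\<lambda>t. f t *\<^sub>R b) = (\<integral>t. \<zeta> t * f t \<partial>M)"
    proof (rule dominated_functional_density[OF assms(1) \<theta>, of "\<lambda>f. l (\<lambda>t. f t *\<^sub>R b)"])
      fix f g :: "'t \<Rightarrow> real" and c :: real
      assume f: "f \<in> bounded_measurable M"
      show "l (\<lambda>t. (c * f t) *\<^sub>R b) = c * l (\<lambda>t. f t *\<^sub>R b)"
        using scale[OF bm_b[OF f b], of c] by simp
      show "l (\<lambda>t. f t *\<^sub>R b) \<le> (\<integral>t. \<theta> t * \<bar>f t\<bar> \<partial>M)"
        using le[OF bm_b[OF f b]] b by simp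
      assume g: "g \<in> bounded_measurable M"
      show "l (\<lambda>t. (f t + g t) *\<^sub>R b) = l (\<lambda>t. f t *\<^sub>R b) + l (\<lambda>t. g t *\<^sub>R b)"
        using add[OF bm_b[OF f b] bm_b[OF g b]] by (simp add: scaleR_add_left)
    qed blast
    then show ?thesis by blast
  qed
  then obtain Z where Z: "\<And>b. b \<in> Basis \<Longrightarrow> integrable M (Z b)"
    "\<And>b f. b \<in> Basis \<Longrightarrow> f \<in> bounded_measurable M \<Longrightarrow> l (\<lambda>t. f t *\<^sub>R b) = (\<integral>t. Z b t * f t \<partial>M)"
    by metis
  define \<zeta> where "\<zeta> t = (\<Sum>b\<in>Basis. Z b t *\<^sub>R b)" for t
  have "integrable M \<zeta>" unfolding \<zeta>_def using Z(1) by simp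
  moreover have "integrable M (\<lambda>t. \<zeta> t \<bullet> f t) \<and> l f = (\<integral>t. \<zeta> t \<bullet> f t \<partial>M)" if f: "f \<in> bounded_measurable M" for f
  proof -
    have sum: "(\<lambda>t. \<Sum>b\<in>B. (f t \<bullet> b) *\<^sub>R b) \<in> bounded_measurable M \<and>
        l (\<lambda>t. \<Sum>b\<in>B. (f t \<bullet> b) *\<^sub>R b) = (\<Sum>b\<in>B. l (\<lambda>t. (f t \<bullet> b) *\<^sub>R b))"
      if "finite B" "B \<subseteq> Basis" for B
      using that
    proof (induction B rule: finite_induct)
      case empty
      have "l (\<lambda>t. 0 *\<^sub>R f t) = 0" using scale[OF f, of 0] by simp
      then show ?case by (auto simp: bounded_measurable_def)
    next
      case (insert b B)
      have 1: "(\<lambda>t. (f t \<bullet> b) *\<^sub>R b) \<in> bounded_measurable M" using insert bm_b bm_i f by auto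
      have 2: "(\<lambda>t. \<Sum>b\<in>B. (f t \<bullet> b) *\<^sub>R b) \<in> bounded_measurable M" using insert by auto
      show ?case
        unfolding sum.insert[OF insert(1,2)]
        using add[OF 1 2] bounded_measurable_add[OF 1 2] insert by auto
    qed
    have inner: "\<zeta> t \<bullet> f t = (\<Sum>b\<in>Basis. Z b t * (f t \<bullet> b))" for t
      unfolding \<zeta>_def inner_sum_left inner_scaleR_left inner_commute[of "f t"] ..
    have int: "integrable M (\<lambda>t. Z b t * (f t \<bullet> b))" if "b \<in> Basis" for b
      using bounded_measurable_mult_integrable[OF bm_i[OF f that] Z(1)[OF that]] .
    have "l f = l (\<lambda>t. \<Sum>b\<in>Basis. (f t \<bullet> b) *\<^sub>R b)" by (simp add: euclidean_representation)
    also have "\<dots> = (\<Sum>b\<in>Basis. l (\<lambda>t. (f t \<bullet> b) *\<^sub>R b))" using sum[of Basis] by simp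
    also have "\<dots> = (\<Sum>b\<in>Basis. \<integral>t. Z b t * (f t \<bullet> b) \<partial>M)"
      using Z(2) bm_i[OF f] by (intro sum.cong) auto
    also have "\<dots> = (\<integral>t. \<zeta> t \<bullet> f t \<partial>M)"
      unfolding inner using int by (intro Bochner_Integration.integral_sum[symmetric])
    finally show ?thesis unfolding inner using int by auto
  qed
  ultimately show ?thesis using that by blast
qed

section \<open>Variational inequalities for convex integrands\<close>

text \<open>Regular normals are polar to the contingent cone. The directions vary with
  \<open>k\<close>, since the vertical component met in \<open>regular_normal_inequality\<close>
  only converges. A nonzero limit keeps the sequence eventually off the base point, which the
  punctured upper limit leaves out.\<close>

lemma regular_normal_cone_directional:
  assumes zs: "zs \<in> regular_normal_cone z \<Omega>"
    and s: "s \<longlonglongrightarrow> 0" "\<And>k. s k > 0" and D: "Dk \<longlonglongrightarrow> D" and mem: "\<And>k. z + s k *\<^sub>R Dk k \<in> \<Omega>"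
  shows "zs \<bullet> D \<le> 0"
proof (cases "D = 0")
  case False
  have lim: "Limsup (at z within \<Omega>) (\<lambda>y. ereal ((zs \<bullet> (y - z)) / norm (y - z))) \<le> 0"
    using zs by (auto simp: regular_normal_cone_def split: if_splits)
  have ne: "\<forall>\<^sub>F k in sequentially. Dk k \<noteq> 0"
    using tendsto_imp_eventually_ne[OF D False] .
  have "(\<lambda>k. z + s k *\<^sub>R Dk k) \<longlonglongrightarrow> z + 0 *\<^sub>R D" by (intro tendsto_intros s D)
  then have fl: "filterlim (\<lambda>k. z + s k *\<^sub>R Dk k) (at z within \<Omega>) sequentially"
    unfolding filterlim_at using mem ne s(2)
    by (auto elim!: eventually_mono simp: less_imp_neq[symmetric])
  have "zs \<bullet> D / norm D \<le> e" if "e > 0" for e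
  proof -
    have "\<forall>\<^sub>F y in at z within \<Omega>. ereal ((zs \<bullet> (y - z)) / norm (y - z)) < ereal e"
      using lim that by (intro Limsup_lessD) (auto intro: le_less_trans)
    with fl have "\<forall>\<^sub>F k in sequentially.
        (zs \<bullet> (s k *\<^sub>R Dk k)) / norm (s k *\<^sub>R Dk k) < e"
      by (auto simp: filterlim_iff)
    then have "\<forall>\<^sub>F k in sequentially. zs \<bullet> Dk k / norm (Dk k) \<le> e"
      using ne
    proof eventually_elim
      case (elim k)
      then show ?case using s(2)[of k] by simp
    qed
    moreover have "(\<lambda>k. zs \<bullet> Dk k / norm (Dk k)) \<longlonglongrightarrow> zs \<bullet> D / norm D"
      using False by (intro tendsto_intros D) auto
    ultimately show ?thesis by (metis tendsto_upperbound trivial_limit_sequentially)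
  qed
  then have "zs \<bullet> D / norm D \<le> 0" by (rule field_le_epsilon[of _ 0, simplified])
  then show ?thesis using False by (simp add: divide_le_0_iff)
qed simp

section \<open>Convex combinations and difference quotients\<close>

lemma convexD_3:
  assumes "convex S" "x \<in> S" "y \<in> S" "z \<in> S" "a \<ge> 0" "b \<ge> 0" "c \<ge> 0" "a + b + c = 1"
  shows "a *\<^sub>R x + b *\<^sub>R y + c *\<^sub>R z \<in> S"
proof -
  have "convex hull {x, y, z} \<subseteq> S" using assms by (intro hull_minimal) auto
  then show ?thesis using assms unfolding convex_hull_3 by blast
qed

lemma convex_gph_combine:
  assumes "convex (gph G)" "y1 \<in> G x1" "y2 \<in> G x2" "a \<ge> 0" "b \<ge> 0" "a + b = 1"
  shows "a *\<^sub>R y1 + b *\<^sub>R y2 \<in> G (a *\<^sub>R x1 + b *\<^sub>R x2)"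
  using convexD[OF assms(1), of "(x1, y1)" "(x2, y2)" a b] assms by (simp add: gph_def)

lemma has_derivative_difference_quotient:
  fixes f :: "'a::real_normed_vector \<Rightarrow> 'b::real_normed_vector"
  assumes f: "(f has_derivative f') (at x)" and s: "s \<longlonglongrightarrow> 0" "\<And>k. s k > 0"
  shows "(\<lambda>k. (1 / s k) *\<^sub>R (f (x + s k *\<^sub>R w) - f x)) \<longlonglongrightarrow> f' w"
proof (cases "w = 0")
  case True
  then show ?thesis using f by (simp add: linear_0 has_derivative_linear)
next
  case False
  have lin: "linear f'" using f by (rule has_derivative_linear)
  have lim: "((\<lambda>h. norm (f (x + h) - f x - f' h) / norm h) \<longlongrightarrow> 0) (at 0)"
    using f by (simp add: has_derivative_at)
  have "(\<lambda>k. s k *\<^sub>R w) \<longlonglongrightarrow> 0 *\<^sub>R w" by (intro tendsto_intros s)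
  then have "filterlim (\<lambda>k. s k *\<^sub>R w) (at 0) sequentially"
    unfolding filterlim_at using False s(2) by (auto simp: less_imp_neq[symmetric])
  from filterlim_compose[OF lim this]
  have "(\<lambda>k. norm (f (x + s k *\<^sub>R w) - f x - f' (s k *\<^sub>R w)) / norm (s k *\<^sub>R w) * norm w) \<longlonglongrightarrow> 0"
    by (rule tendsto_mult_left_zero)
  moreover have "norm (f (x + s k *\<^sub>R w) - f x - f' (s k *\<^sub>R w)) / norm (s k *\<^sub>R w) * norm w =
      norm ((1 / s k) *\<^sub>R (f (x + s k *\<^sub>R w) - f x) - f' w)" for k
  proof -
    have "(1 / s k) *\<^sub>R (f (x + s k *\<^sub>R w) - f x) - f' w =
        (1 / s k) *\<^sub>R (f (x + s k *\<^sub>R w) - f x - f' (s k *\<^sub>R w))"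
      using s(2)[of k] by (simp add: linear_scale[OF lin] scaleR_diff_right)
    then show ?thesis using s(2)[of k] False by simp
  qed
  ultimately have "(\<lambda>k. norm ((1 / s k) *\<^sub>R (f (x + s k *\<^sub>R w) - f x) - f' w)) \<longlonglongrightarrow> 0" by simp
  then show ?thesis using LIM_zero_cancel tendsto_norm_zero_iff by blast
qed

text \<open>Condition (c) in the form in which it is exploited: one radius and one integrable bound
  for all small displacements. The inner function does not occur, only the reference point
  \<open>z0\<close>, so the same setting serves every base point whose image stays close to
  \<open>z0\<close>.\<close>

locale convex_integrand_near = finite_measure M
  for M :: "'t measure" +
  fixes F :: "'t \<Rightarrow> 'c::euclidean_space \<Rightarrow> 'b::euclidean_space set"
    and z0 :: "'t \<Rightarrow> 'c" and r :: real and \<omega> :: "'t \<Rightarrow> real"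
  assumes F_measurable: "{(t, z, y). t \<in> space M \<and> y \<in> F t z} \<in> sets (M \<Otimes>\<^sub>M borel)"
    and F_convex: "AE t in M. convex (gph (F t))"
    and z0_measurable [measurable]: "z0 \<in> borel_measurable M"
    and r_pos: "r > 0" and \<omega>_integrable: "integrable M \<omega>"
    and F_bounded_values: "AE t in M. \<forall>h. norm h \<le> r \<longrightarrow> (\<exists>y\<in>F t (z0 t + h). norm y \<le> \<omega> t)"
begin

lemma \<omega>_measurable [measurable]: "\<omega> \<in> borel_measurable M"
  using \<omega>_integrable by simp

text \<open>The bound by \<open>\<omega>\<close> is built into the set from which the selection is
  taken, so integrability comes with it and the dominating function does not depend on
  \<open>h\<close>.\<close>

lemma bounded_selection:
  assumes [measurable]: "h \<in> borel_measurable M" and h: "AE t in M. norm (h t) \<le> r"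
  obtains y where "integrable M y" "AE t in M. y t \<in> F t (z0 t + h t)" "AE t in M. norm (y t) \<le> \<omega> t"
proof -
  define G where "G = {(t, y). t \<in> space M \<and> y \<in> F t (z0 t + h t) \<and> norm y \<le> \<omega> t}"
  let ?j = "\<lambda>(t, y). (t, z0 t + h t, y :: 'b)"
  have j: "?j \<in> measurable (M \<Otimes>\<^sub>M borel) (M \<Otimes>\<^sub>M borel)" by measurable
  have "G = (?j -` {(t, z, y). t \<in> space M \<and> y \<in> F t z} \<inter> space (M \<Otimes>\<^sub>M borel)) \<inter>
      {x \<in> space (M \<Otimes>\<^sub>M borel). norm (snd x) \<le> \<omega> (fst x)}"
    by (auto simp: G_def space_pair_measure)
  also have "\<dots> \<in> sets (M \<Otimes>\<^sub>M borel)"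
    by (intro sets.Int[OF measurable_sets[OF j F_measurable]]) measurable
  finally have G: "G \<in> sets (M \<Otimes>\<^sub>M borel)" .
  have "AE t in M. \<exists>y. (t, y) \<in> G"
    using F_bounded_values h AE_space by eventually_elim (auto simp: G_def)
  then obtain y where [measurable]: "y \<in> borel_measurable M" and y: "AE t in M. (t, y t) \<in> G"
    using measurable_selection_AE[OF finite_measure_axioms G] by blast
  have b: "AE t in M. norm (y t) \<le> \<omega> t" using y by eventually_elim (auto simp: G_def)
  then have "AE t in M. norm (y t) \<le> norm (\<omega> t)" by eventually_elim auto
  then have "integrable M y" by (rule Bochner_Integration.integrable_bound[OF \<omega>_integrable, rotated]) simp
  moreover have "AE t in M. y t \<in> F t (z0 t + h t)" using y by eventually_elim (auto simp: G_def)
  ultimately show ?thesis using that b by blast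
qed

lemma integrable_bounded_scaleR:
  fixes u :: "'t \<Rightarrow> 'd::euclidean_space"
  assumes "integrable M u" "a \<in> borel_measurable M" "AE t in M. \<bar>a t\<bar> \<le> K"
  shows "integrable M (\<lambda>t. a t *\<^sub>R u t)"
proof (rule Bochner_Integration.integrable_bound)
  show "integrable M (\<lambda>t. K * norm (u t))" using assms by simp
  show "(\<lambda>t. a t *\<^sub>R u t) \<in> borel_measurable M" using assms by measurable
  show "AE t in M. norm (a t *\<^sub>R u t) \<le> norm (K * norm (u t))"
    using assms(3) by eventually_elim (auto simp: abs_mult intro!: mult_right_mono)
qed

text \<open>The remainder \<open>e\<close> of the linearization of \<open>g t\<close> is not uniformly small in \<open>t\<close>. The weight
  \<open>\<delta> = 2 |e| / r\<close> turns it into a convex weight on a point at distance \<open>r/2\<close>,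
  where integrable selections exist, and \<open>\<delta>\<close> tends to zero boundedly.\<close>

lemma regular_normal_inequality:
  fixes g :: "'t \<Rightarrow> 'a::euclidean_space \<Rightarrow> 'c" and x0 :: 'a
  assumes normal: "(xs, - ys) \<in> regular_normal_cone (x0, integral\<^sup>L M v) (gph (expected_map M \<Phi>))"
    and v: "integrable M v" "AE t in M. v t \<in> F t (g t x0)"
    and e: "e > 0" "AE t in M. \<forall>x\<in>ball x0 e. \<Phi> t x = F t (g t x)"
    and g_meas: "\<And>x. x \<in> ball x0 e \<Longrightarrow> (\<lambda>t. g t x) \<in> borel_measurable M"
    and near: "AE t in M. norm (g t x0 - z0 t) \<le> r / 2"
    and L: "L \<ge> 0" "AE t in M. \<forall>x\<in>ball x0 e. norm (g t x - g t x0) \<le> L * norm (x - x0)"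
    and deriv: "AE t in M. (g t has_derivative A t) (at x0)"
    and y: "integrable M y" "AE t in M. y t \<in> F t (g t x0 + A t w)"
  shows "xs \<bullet> w \<le> ys \<bullet> (integral\<^sup>L M y - integral\<^sup>L M v)"
proof -
  \<comment> \<open>Upper bound for the weights \<open>\<delta>\<close>: a difference quotient and
    its limit are each at most \<open>L * norm w\<close>, and \<open>\<delta>\<close> is 2 / r times
    the norm of their difference.\<close>
  define C where "C = 4 * L * norm w / r"
  have C0: "C \<ge> 0" using L(1) r_pos by (simp add: C_def)
  \<comment> \<open>The second condition keeps the segment in the ball where \<open>\<Phi> t\<close>
    is represented by \<open>F t\<close> and \<open>g t\<close>; the third keeps the weight
    \<open>1 - s - s * \<delta>\<close> nonnegative for every step \<open>s\<close> up to
    \<open>c\<close>.\<close>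
  obtain c where c: "c > 0" "c * norm w < e" "c * (1 + C) \<le> 1"
  proof -
    define c where "c = min (e / (2 * (norm w + 1))) (1 / (1 + C))"
    have "c > 0" using e(1) C0 by (auto simp: c_def add_nonneg_pos add_pos_nonneg)
    moreover have "c * norm w \<le> e / (2 * (norm w + 1)) * norm w"
      by (intro mult_right_mono) (auto simp: c_def)
    moreover have "e / (2 * (norm w + 1)) * norm w < e"
    proof -
      have "0 < 2 * (norm w + 1)" "norm w < 2 * (norm w + 1)"
        using norm_ge_zero[of w] by (smt (verit))+
      then have "norm w / (2 * (norm w + 1)) < 1" by (simp only: divide_less_eq_1_pos)
      then have "e * (norm w / (2 * (norm w + 1))) < e * 1"
        using e(1) by (rule mult_strict_left_mono)
      then show ?thesis by simp
    qed
    moreover have "c * (1 + C) \<le> 1 / (1 + C) * (1 + C)"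
      using C0 by (intro mult_right_mono) (auto simp: c_def)
    ultimately show ?thesis using that[of c] C0 by simp
  qed
  define s where "s k = c / Suc k" for k
  have s_pos: "s k > 0" for k using c by (simp add: s_def)
  have s_le: "s k \<le> c" for k using c by (simp add: s_def divide_le_eq)
  have s_lim: "s \<longlonglongrightarrow> 0" unfolding s_def divide_inverse
    by (intro tendsto_mult_right_zero LIMSEQ_inverse_real_of_nat)
  have sw: "x0 + s k *\<^sub>R w \<in> ball x0 e" for k
  proof -
    have "s k * norm w \<le> c * norm w" by (intro mult_right_mono s_le) simp
    then show ?thesis using c(2) s_pos[of k] by (simp add: dist_norm)
  qed
  have [measurable]: "(\<lambda>t. g t (x0 + s k *\<^sub>R w)) \<in> borel_measurable M" for k by (rule g_meas[OF sw])
  have [measurable]: "(\<lambda>t. g t x0) \<in> borel_measurable M" using e(1) by (intro g_meas) simp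
  define dq where "dq k t = (1 / s k) *\<^sub>R (g t (x0 + s k *\<^sub>R w) - g t x0)" for k t
  have [measurable]: "dq k \<in> borel_measurable M" for k unfolding dq_def by measurable
  \<comment> \<open>The family \<open>A\<close> comes without measurability; the limit of the
    quotients is a measurable function equal to \<open>A t w\<close> almost everywhere.\<close>
  define q where "q t = lim (\<lambda>k. dq k t)" for t
  have [measurable]: "q \<in> borel_measurable M" unfolding q_def by measurable
  have dq_lim: "AE t in M. (\<lambda>k. dq k t) \<longlonglongrightarrow> q t \<and> q t = A t w"
    using deriv
  proof eventually_elim
    case (elim t)
    have "(\<lambda>k. dq k t) \<longlonglongrightarrow> A t w"
      unfolding dq_def by (rule has_derivative_difference_quotient[OF elim s_lim s_pos])
    then show ?case unfolding q_def by (simp add: limI)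
  qed
  have dq_bound: "AE t in M. \<forall>k. norm (dq k t) \<le> L * norm w"
    using L(2)
  proof eventually_elim
    case (elim t)
    have "norm (dq k t) \<le> L * norm w" for k
    proof -
      have "norm (g t (x0 + s k *\<^sub>R w) - g t x0) \<le> L * (s k * norm w)"
        using elim sw[of k] s_pos[of k] by fastforce
      moreover have "norm (dq k t) = norm (g t (x0 + s k *\<^sub>R w) - g t x0) / s k"
        using s_pos[of k] unfolding dq_def norm_scaleR by simp
      ultimately show ?thesis using s_pos[of k] by (simp add: pos_divide_le_eq mult_ac)
    qed
    then show ?case by blast
  qed
  define err where "err k t = dq k t - q t" for k t
  have [measurable]: "err k \<in> borel_measurable M" for k unfolding err_def by measurable
  define \<delta> where "\<delta> k t = 2 / r * norm (err k t)" for k t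
  have [measurable]: "\<delta> k \<in> borel_measurable M" for k unfolding \<delta>_def by measurable
  have \<delta>_props: "AE t in M. (\<forall>k. 0 \<le> \<delta> k t \<and> \<delta> k t \<le> C) \<and> (\<lambda>k. \<delta> k t) \<longlonglongrightarrow> 0"
    using dq_lim dq_bound
  proof eventually_elim
    case (elim t)
    have q_le: "norm (q t) \<le> L * norm w"
      by (rule LIMSEQ_le_const2[OF tendsto_norm, of "\<lambda>k. dq k t"]) (use elim in blast)+
    have dq_le: "norm (dq k t) \<le> L * norm w" for k using elim by blast
    have err_le: "norm (err k t) \<le> 2 * (L * norm w)" for k
      using norm_triangle_ineq4[of "dq k t" "q t"] q_le dq_le[of k] unfolding err_def by linarith
    have "\<delta> k t \<le> C" for k
    proof -
      have "2 / r * norm (err k t) \<le> 2 / r * (2 * (L * norm w))"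
        using r_pos err_le by (intro mult_left_mono) auto
      then show ?thesis by (simp add: \<delta>_def C_def)
    qed
    moreover have "(\<lambda>k. err k t) \<longlonglongrightarrow> q t - q t"
      unfolding err_def using elim by (intro tendsto_intros) auto
    then have "(\<lambda>k. \<delta> k t) \<longlonglongrightarrow> 0"
      unfolding \<delta>_def by (intro tendsto_mult_right_zero tendsto_norm_zero) simp
    ultimately show ?case using r_pos by (auto simp: \<delta>_def)
  qed
  \<comment> \<open>Division by \<open>\<delta>\<close> rescales a nonzero remainder to length r /
    2; where the remainder vanishes, 1 / 0 = 0 removes the term. With \<open>near\<close> the
    displacement from \<open>z0 t\<close> is at most \<open>r\<close>, so an integrably bounded
    point exists there.\<close>
  define h where "h k t = g t x0 - z0 t + (1 / \<delta> k t) *\<^sub>R err k t" for k t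
  have [measurable]: "h k \<in> borel_measurable M" for k unfolding h_def by measurable
  have h_le: "AE t in M. norm (h k t) \<le> r" for k
    using near
  proof eventually_elim
    case (elim t)
    have "norm ((1 / \<delta> k t) *\<^sub>R err k t) \<le> r / 2"
      using r_pos by (simp add: \<delta>_def)
    then show ?case using elim norm_triangle_ineq[of "g t x0 - z0 t" "(1 / \<delta> k t) *\<^sub>R err k t"]
      unfolding h_def by linarith
  qed
  have "\<exists>z. integrable M z \<and> (AE t in M. z t \<in> F t (z0 t + h k t)) \<and> (AE t in M. norm (z t) \<le> \<omega> t)" for k
    using bounded_selection[of "h k"] h_le by auto
  then obtain z where z: "\<And>k. integrable M (z k)" "\<And>k. AE t in M. z k t \<in> F t (z0 t + h k t)"
    "\<And>k. AE t in M. norm (z k t) \<le> \<omega> t"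
    by metis
  note [measurable] = borel_measurable_integrable[OF z(1)] borel_measurable_integrable[OF v(1)]
  define I where "I k = (\<integral>t. \<delta> k t *\<^sub>R (z k t - v t) \<partial>M)" for k
  have \<delta>_abs: "AE t in M. \<bar>\<delta> k t\<bar> \<le> C" for k using \<delta>_props by eventually_elim auto
  have int: "integrable M (\<lambda>t. \<delta> k t *\<^sub>R (z k t - v t))" for k
    by (rule integrable_bounded_scaleR[OF _ _ \<delta>_abs]) (use z v in auto)
  \<comment> \<open>The points \<open>z k\<close> need not converge: they are bounded by
    \<open>\<omega>\<close>, and only their weights tend to 0.\<close>
  have "I \<longlonglongrightarrow> (\<integral>t. 0 \<partial>M)"
    unfolding I_def
  proof (rule integral_dominated_convergence[where w="\<lambda>t. C * (\<omega> t + norm (v t))"])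
    show "AE t in M. (\<lambda>k. \<delta> k t *\<^sub>R (z k t - v t)) \<longlonglongrightarrow> 0"
    proof -
      have "AE t in M. \<forall>k. norm (z k t) \<le> \<omega> t" using z(3) by (simp add: AE_all_countable)
      with \<delta>_props show ?thesis
      proof eventually_elim
        case (elim t)
        have "(\<lambda>k. \<delta> k t * (\<omega> t + norm (v t))) \<longlonglongrightarrow> 0"
          using elim by (intro tendsto_mult_left_zero) auto
        then show ?case
        proof (rule Lim_null_comparison[rotated])
          show "\<forall>\<^sub>F k in sequentially. norm (\<delta> k t *\<^sub>R (z k t - v t)) \<le> \<delta> k t * (\<omega> t + norm (v t))"
          proof (rule always_eventually, rule allI)
            fix k
            have "norm (z k t - v t) \<le> \<omega> t + norm (v t)"
              using norm_triangle_ineq4[of "z k t" "v t"] elim by (meson add_right_mono order_trans)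
            then show "norm (\<delta> k t *\<^sub>R (z k t - v t)) \<le> \<delta> k t * (\<omega> t + norm (v t))"
              using elim by (simp add: mult_left_mono)
          qed
        qed
      qed
    qed
    show "AE t in M. norm (\<delta> k t *\<^sub>R (z k t - v t)) \<le> C * (\<omega> t + norm (v t))" for k
      using \<delta>_props z(3)[of k]
    proof eventually_elim
      case (elim t)
      have "norm (z k t - v t) \<le> \<omega> t + norm (v t)"
        using norm_triangle_ineq4[of "z k t" "v t"] elim by linarith
      then show ?case using elim C0 by (auto intro!: mult_mono)
    qed
  qed (use \<omega>_integrable v in auto)
  then have I_lim: "I \<longlonglongrightarrow> 0" by simp
  define D where "D k = (w, (integral\<^sup>L M y - integral\<^sup>L M v) + I k)" for k
  have "(xs, - ys) \<bullet> (w, (integral\<^sup>L M y - integral\<^sup>L M v) + 0) \<le> 0"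
  proof (rule regular_normal_cone_directional[OF normal s_lim s_pos])
    show "D \<longlonglongrightarrow> (w, (integral\<^sup>L M y - integral\<^sup>L M v) + 0)"
      unfolding D_def by (intro tendsto_intros I_lim)
    fix k
    \<comment> \<open>The combination of \<open>v\<close>, \<open>y\<close> and \<open>z k\<close>
      with weights \<open>1 - s - s * \<delta>\<close>, \<open>s\<close> and
      \<open>s * \<delta>\<close>. Combining their arguments with the same weights gives
      \<open>g t (x0 + s *\<^sub>R w)\<close> exactly, because the third one restores the remainder
      of the linearization.\<close>
    define Y where "Y t = v t + s k *\<^sub>R ((y t - v t) + \<delta> k t *\<^sub>R (z k t - v t))" for t
    have Y: "integrable M Y" unfolding Y_def using v y int by simp
    have Y_int: "integral\<^sup>L M Y = integral\<^sup>L M v + s k *\<^sub>R ((integral\<^sup>L M y - integral\<^sup>L M v) + I k)"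
      unfolding Y_def I_def using v y int by simp
    have "AE t in M. Y t \<in> \<Phi> t (x0 + s k *\<^sub>R w)"
      using F_convex v(2) y(2) z(2)[of k] e(2) dq_lim \<delta>_props
    proof eventually_elim
      case (elim t)
      let ?s = "s k" and ?d = "\<delta> k t"
      have d: "0 \<le> ?d" "?d \<le> C" using elim by auto
      have sd: "?s + ?s * ?d \<le> 1"
      proof -
        have "?s * (1 + ?d) \<le> c * (1 + C)" using d s_pos[of k] s_le[of k] c(1) by (intro mult_mono) auto
        then show ?thesis using c(3) by (simp add: algebra_simps)
      qed
      have err: "?d *\<^sub>R ((1 / ?d) *\<^sub>R err k t) = err k t"
        using r_pos by (simp add: \<delta>_def)
      have comb: "(1 - ?s - ?s * ?d) *\<^sub>R (g t x0, v t) + ?s *\<^sub>R (g t x0 + A t w, y t)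
          + (?s * ?d) *\<^sub>R (z0 t + h k t, z k t) \<in> gph (F t)"
        using sd s_pos[of k] d elim by (intro convexD_3) (auto simp: gph_def)
      moreover have "(1 - ?s - ?s * ?d) *\<^sub>R v t + ?s *\<^sub>R y t + (?s * ?d) *\<^sub>R z k t = Y t"
        by (simp add: Y_def algebra_simps)
      moreover have "(1 - ?s - ?s * ?d) *\<^sub>R g t x0 + ?s *\<^sub>R (g t x0 + A t w) + (?s * ?d) *\<^sub>R (z0 t + h k t)
          = g t (x0 + ?s *\<^sub>R w)"
      proof -
        have "(1 - ?s - ?s * ?d) *\<^sub>R g t x0 + ?s *\<^sub>R (g t x0 + A t w) + (?s * ?d) *\<^sub>R (z0 t + h k t)
          = g t x0 + ?s *\<^sub>R q t + ?s *\<^sub>R (?d *\<^sub>R ((1 / ?d) *\<^sub>R err k t))"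
          using elim by (simp add: h_def algebra_simps)
        also have "\<dots> = g t x0 + ?s *\<^sub>R dq k t" unfolding err by (simp add: err_def algebra_simps)
        also have "\<dots> = g t (x0 + ?s *\<^sub>R w)" using s_pos[of k] by (simp add: dq_def)
        finally show ?thesis .
      qed
      ultimately have "Y t \<in> F t (g t (x0 + ?s *\<^sub>R w))" by (simp add: gph_def)
      then show ?case using elim sw[of k] by auto
    qed
    then have "integral\<^sup>L M Y \<in> expected_map M \<Phi> (x0 + s k *\<^sub>R w)"
      using Y by (auto simp: expected_map_def aumann_integral_def)
    then show "(x0, integral\<^sup>L M v) + s k *\<^sub>R D k \<in> gph (expected_map M \<Phi>)"
      by (simp add: gph_def D_def Y_int)
  qed
  then show ?thesis by simp
qed

text \<open>A selection over the limit argument \<open>z0 t + q t\<close> must be moved to the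
  arguments \<open>gk k t + qk k t\<close>. Mixing it with an integrably bounded point at
  \<open>z0 t + h k t\<close> hits these arguments exactly; the weight tends to 0, so the integrals
  converge to that of \<open>y\<close>. The bounds r / 4 leave room for \<open>h\<close> in the ball
  of radius \<open>r\<close>.\<close>

lemma variational_inequality_limit:
  fixes xk :: "nat \<Rightarrow> 'a::euclidean_space" and yk :: "nat \<Rightarrow> 'b"
  assumes gk_meas: "\<And>k. gk k \<in> borel_measurable M" and gk: "AE t in M. \<forall>k. norm (gk k t - z0 t) \<le> r / 4"
      "AE t in M. (\<lambda>k. gk k t) \<longlonglongrightarrow> z0 t"
    and qk_meas: "\<And>k. qk k \<in> borel_measurable M" and qk: "AE t in M. \<forall>k. norm (qk k t) \<le> r / 4"
      "AE t in M. (\<lambda>k. qk k t) \<longlonglongrightarrow> q t" and q_meas: "q \<in> borel_measurable M"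
    and ineq: "\<And>k y. integrable M y \<Longrightarrow> AE t in M. y t \<in> F t (gk k t + qk k t) \<Longrightarrow>
        xk k \<bullet> w \<le> yk k \<bullet> (integral\<^sup>L M y - Ik k)"
    and lim: "xk \<longlonglongrightarrow> xs" "yk \<longlonglongrightarrow> ys" "Ik \<longlonglongrightarrow> I"
    and y: "integrable M y" "AE t in M. y t \<in> F t (z0 t + q t)"
  shows "xs \<bullet> w \<le> ys \<bullet> (integral\<^sup>L M y - I)"
proof -
  note [measurable] = gk_meas qk_meas q_meas borel_measurable_integrable[OF y(1)]
  define err where "err k t = gk k t + qk k t - z0 t - q t" for k t
  \<comment> \<open>The error consists of three terms of size at most r / 4, so 2 / r times its norm
    can exceed 1 and is capped. Where the cap acts, \<open>z0 t + h k t\<close> is the target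
    argument itself; elsewhere the rescaled error has length at most r / 2.\<close>
  define \<delta> where "\<delta> k t = min 1 (2 / r * norm (err k t))" for k t
  define h where "h k t = q t + (1 / \<delta> k t) *\<^sub>R err k t" for k t
  have [measurable]: "err k \<in> borel_measurable M" "\<delta> k \<in> borel_measurable M" "h k \<in> borel_measurable M" for k
    unfolding h_def \<delta>_def err_def by measurable
  have \<delta>01: "0 \<le> \<delta> k t" "\<delta> k t \<le> 1" for k t using r_pos by (auto simp: \<delta>_def)
  have err_eq: "\<delta> k t *\<^sub>R ((1 / \<delta> k t) *\<^sub>R err k t) = err k t" for k t
    using r_pos by (auto simp: \<delta>_def min_def)
  have q_le: "AE t in M. norm (q t) \<le> r / 4"
    using qk
  proof eventually_elim
    case (elim t)
    show ?case by (rule LIMSEQ_le_const2[OF tendsto_norm, of "\<lambda>k. qk k t"]) (use elim in blast)+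
  qed
  have h_le: "AE t in M. norm (h k t) \<le> r" for k
    using gk(1) qk(1) q_le
  proof eventually_elim
    case (elim t)
    show ?case
    proof (cases "2 / r * norm (err k t) \<ge> 1")
      case True
      then have "h k t = (gk k t - z0 t) + qk k t" by (simp add: h_def \<delta>_def err_def min_def)
      then have "norm (h k t) \<le> norm (gk k t - z0 t) + norm (qk k t)" by (simp only: norm_triangle_ineq)
      moreover have "norm (gk k t - z0 t) \<le> r / 4" "norm (qk k t) \<le> r / 4" using elim by auto
      ultimately show ?thesis using r_pos by linarith
    next
      case False
      then have "\<delta> k t = 2 / r * norm (err k t)" by (simp add: \<delta>_def)
      then have "norm ((1 / \<delta> k t) *\<^sub>R err k t) \<le> r / 2" using r_pos by simp
      then have "norm (h k t) \<le> r / 4 + r / 2"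
        unfolding h_def using elim(3) by (intro norm_triangle_le add_mono)
      then show ?thesis using r_pos by linarith
    qed
  qed
  have "\<exists>z. integrable M z \<and> (AE t in M. z t \<in> F t (z0 t + h k t)) \<and> (AE t in M. norm (z t) \<le> \<omega> t)" for k
    using bounded_selection[of "h k"] h_le by auto
  then obtain z where z: "\<And>k. integrable M (z k)" "\<And>k. AE t in M. z k t \<in> F t (z0 t + h k t)"
    "\<And>k. AE t in M. norm (z k t) \<le> \<omega> t"
    by metis
  note [measurable] = borel_measurable_integrable[OF z(1)]
  define Y where "Y k t = y t + \<delta> k t *\<^sub>R (z k t - y t)" for k t
  have z_le: "AE t in M. \<forall>k. norm (z k t - y t) \<le> \<omega> t + norm (y t)"
  proof -
    have "AE t in M. \<forall>k. norm (z k t) \<le> \<omega> t" using z(3) by (simp add: AE_all_countable)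
    then show ?thesis
    proof eventually_elim
      case (elim t)
      then show ?case using norm_triangle_ineq4[of "z _ t" "y t"] by (meson add_right_mono order_trans)
    qed
  qed
  have Y: "integrable M (Y k)" for k
    unfolding Y_def using y z(1)
    by (intro Bochner_Integration.integrable_add integrable_bounded_scaleR[where K=1] Bochner_Integration.integrable_diff)
      (use \<delta>01 in auto)
  have "AE t in M. Y k t \<in> F t (gk k t + qk k t)" for k
    using F_convex y(2) z(2)[of k]
  proof eventually_elim
    case (elim t)
    have "(1 - \<delta> k t) *\<^sub>R y t + \<delta> k t *\<^sub>R z k t \<in> F t ((1 - \<delta> k t) *\<^sub>R (z0 t + q t) + \<delta> k t *\<^sub>R (z0 t + h k t))"
      using elim \<delta>01 by (intro convex_gph_combine) auto
    moreover have "(1 - \<delta> k t) *\<^sub>R (z0 t + q t) + \<delta> k t *\<^sub>R (z0 t + h k t)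
        = z0 t + q t + \<delta> k t *\<^sub>R ((1 / \<delta> k t) *\<^sub>R err k t)"
      by (simp add: h_def algebra_simps)
    moreover have "\<dots> = gk k t + qk k t" unfolding err_eq by (simp add: err_def)
    moreover have "(1 - \<delta> k t) *\<^sub>R y t + \<delta> k t *\<^sub>R z k t = Y k t" by (simp add: Y_def algebra_simps)
    ultimately show ?case by simp
  qed
  then have ineqk: "xk k \<bullet> w \<le> yk k \<bullet> (integral\<^sup>L M (Y k) - Ik k)" for k
    using ineq[OF Y] by blast
  have "(\<lambda>k. integral\<^sup>L M (Y k)) \<longlonglongrightarrow> integral\<^sup>L M y"
  proof (rule integral_dominated_convergence[where w="\<lambda>t. norm (y t) + (\<omega> t + norm (y t))"])
    show "AE t in M. (\<lambda>k. Y k t) \<longlonglongrightarrow> y t"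
      using gk(2) qk(2) z_le
    proof eventually_elim
      case (elim t)
      have "(\<lambda>k. err k t) \<longlonglongrightarrow> z0 t + q t - z0 t - q t"
        unfolding err_def by (intro tendsto_intros elim)
      then have "(\<lambda>k. 2 / r * norm (err k t)) \<longlonglongrightarrow> 0"
        by (intro tendsto_mult_right_zero tendsto_norm_zero) simp
      then have "(\<lambda>k. \<delta> k t) \<longlonglongrightarrow> min 1 0"
        unfolding \<delta>_def by (intro tendsto_intros)
      then have "(\<lambda>k. \<delta> k t * (\<omega> t + norm (y t))) \<longlonglongrightarrow> 0" by (intro tendsto_mult_left_zero) simp
      then have "(\<lambda>k. \<delta> k t *\<^sub>R (z k t - y t)) \<longlonglongrightarrow> 0"
        by (rule Lim_null_comparison[rotated])
          (use elim \<delta>01 in \<open>auto intro!: always_eventually mult_left_mono\<close>)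
      then have "(\<lambda>k. Y k t) \<longlonglongrightarrow> y t + 0" unfolding Y_def by (intro tendsto_intros)
      then show ?case by simp
    qed
    show "AE t in M. norm (Y k t) \<le> norm (y t) + (\<omega> t + norm (y t))" for k
      using z_le
    proof eventually_elim
      case (elim t)
      have "norm (\<delta> k t *\<^sub>R (z k t - y t)) \<le> 1 * norm (z k t - y t)"
        using mult_right_mono[OF \<delta>01(2)[of k t] norm_ge_zero] \<delta>01(1)[of k t] by simp
      then show ?case unfolding Y_def using elim
        by (intro norm_triangle_le add_left_mono) (auto intro: order_trans)
    qed
  qed (use y \<omega>_integrable Y in auto)
  then have "(\<lambda>k. yk k \<bullet> (integral\<^sup>L M (Y k) - Ik k)) \<longlonglongrightarrow> ys \<bullet> (integral\<^sup>L M y - I)"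
    by (intro tendsto_intros lim)
  moreover have "(\<lambda>k. xk k \<bullet> w) \<longlonglongrightarrow> xs \<bullet> w" by (intro tendsto_intros lim)
  ultimately show ?thesis using ineqk by (intro LIMSEQ_le) auto
qed

text \<open>The functional \<open>p\<close> below is the sublinear hull, along the range of \<open>A\<close>, of the integral
  functional of the convex functions \<open>h \<mapsto> inf {ys \<bullet> (y - v t) | y \<in> F t (z0 t + h)}\<close>.
  Every linear functional below \<open>p\<close> agrees with \<open>xs\<close> on that range.\<close>

lemma sublinear_hull_density:
  fixes A :: "'t \<Rightarrow> 'a::euclidean_space \<Rightarrow> 'c"
  assumes v: "integrable M v" "AE t in M. v t \<in> F t (z0 t)"
    and A: "AE t in M. linear (A t)" "\<And>w. (\<lambda>t. A t w) \<in> bounded_measurable M"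
    and ineq: "\<And>w y. integrable M y \<Longrightarrow> AE t in M. y t \<in> F t (z0 t + A t w) \<Longrightarrow>
        xs \<bullet> w \<le> ys \<bullet> (integral\<^sup>L M y - integral\<^sup>L M v)"
  obtains \<zeta> where "integrable M \<zeta>"
    "\<And>h. h \<in> bounded_measurable M \<Longrightarrow> integrable M (\<lambda>t. \<zeta> t \<bullet> h t)"
    "\<And>w. (\<integral>t. \<zeta> t \<bullet> A t w \<partial>M) = xs \<bullet> w"
    "\<And>h y. h \<in> bounded_measurable M \<Longrightarrow> integrable M y \<Longrightarrow> AE t in M. y t \<in> F t (z0 t + h t) \<Longrightarrow>
        (\<integral>t. \<zeta> t \<bullet> h t \<partial>M) \<le> ys \<bullet> (integral\<^sup>L M y - integral\<^sup>L M v)"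
proof -
  define J where "J y = ys \<bullet> (integral\<^sup>L M y - integral\<^sup>L M v)" for y
  define adm where "adm h c w y \<longleftrightarrow> c > 0 \<and> integrable M y \<and>
      (AE t in M. y t \<in> F t (z0 t + (1 / c) *\<^sub>R (h t - A t w)))" for h and c :: real and w y
  \<comment> \<open>The factor \<open>c\<close> is the perspective scaling that makes a convex
    functional positively homogeneous. The shift by \<open>A t w\<close> costs
    \<open>xs \<bullet> w\<close>, so the infimum over this set charges a displacement along the
    range of \<open>A\<close> at most what \<open>xs\<close> assigns to it.\<close>
  define V where "V h = {c * J y + xs \<bullet> w | c w y. adm h c w y}" for h
  define p where "p h = Inf (V h)" for h
  have V_sum: "a + b \<in> V (\<lambda>t. f t + g t)" if ab: "a \<in> V f" "b \<in> V g" for a b f g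
  proof -
    obtain c1 w1 y1 where 1: "a = c1 * J y1 + xs \<bullet> w1" "adm f c1 w1 y1" using ab unfolding V_def by blast
    obtain c2 w2 y2 where 2: "b = c2 * J y2 + xs \<bullet> w2" "adm g c2 w2 y2" using ab unfolding V_def by blast
    define c where "c = c1 + c2"
    have c: "c1 > 0" "c2 > 0" "c > 0" "c1 / c + c2 / c = 1"
      using 1 2 by (auto simp: c_def adm_def add_divide_distrib[symmetric])
    define y where "y t = (c1 / c) *\<^sub>R y1 t + (c2 / c) *\<^sub>R y2 t" for t
    have y: "integrable M y" unfolding y_def using 1 2 by (simp add: adm_def)
    have "AE t in M. y t \<in> F t (z0 t + (1 / c) *\<^sub>R ((f t + g t) - A t (w1 + w2)))"
      using 1(2)[unfolded adm_def, THEN conjunct2, THEN conjunct2]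
        2(2)[unfolded adm_def, THEN conjunct2, THEN conjunct2] F_convex A(1)
    proof eventually_elim
      case (elim t)
      have "y t \<in> F t ((c1 / c) *\<^sub>R (z0 t + (1 / c1) *\<^sub>R (f t - A t w1)) + (c2 / c) *\<^sub>R (z0 t + (1 / c2) *\<^sub>R (g t - A t w2)))"
        unfolding y_def using elim c by (intro convex_gph_combine) auto
      also have "(c1 / c) *\<^sub>R (z0 t + (1 / c1) *\<^sub>R (f t - A t w1)) + (c2 / c) *\<^sub>R (z0 t + (1 / c2) *\<^sub>R (g t - A t w2))
          = (c1 / c + c2 / c) *\<^sub>R z0 t + (1 / c) *\<^sub>R ((f t - A t w1) + (g t - A t w2))"
        using c(1-3) by (simp add: scaleR_add_right scaleR_add_left)
      also have "\<dots> = z0 t + (1 / c) *\<^sub>R ((f t + g t) - A t (w1 + w2))"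
        unfolding c(4) linear_add[OF elim(4)] by (simp add: algebra_simps)
      finally show ?case .
    qed
    then have "adm (\<lambda>t. f t + g t) c (w1 + w2) y" using y c by (simp add: adm_def)
    moreover have "c * J y + xs \<bullet> (w1 + w2) = a + b"
    proof -
      have "integral\<^sup>L M y = (c1 / c) *\<^sub>R integral\<^sup>L M y1 + (c2 / c) *\<^sub>R integral\<^sup>L M y2"
        unfolding y_def using 1 2 by (simp add: adm_def)
      moreover have "integral\<^sup>L M v = (c1 / c) *\<^sub>R integral\<^sup>L M v + (c2 / c) *\<^sub>R integral\<^sup>L M v"
        by (simp only: scaleR_add_left[symmetric] c(4) scaleR_one)
      ultimately have "integral\<^sup>L M y - integral\<^sup>L M v =
          (c1 / c) *\<^sub>R (integral\<^sup>L M y1 - integral\<^sup>L M v) + (c2 / c) *\<^sub>R (integral\<^sup>L M y2 - integral\<^sup>L M v)"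
        by (simp add: algebra_simps)
      then have "J y = (c1 / c) * J y1 + (c2 / c) * J y2"
        unfolding J_def by (simp only: inner_add_right inner_scaleR_right)
      then have "c * J y = c1 * J y1 + c2 * J y2" using c(3) by (simp add: distrib_left)
      then show ?thesis using c 1 2 by (simp add: inner_add_right algebra_simps)
    qed
    ultimately show ?thesis unfolding V_def by (metis (mono_tags, lifting) mem_Collect_eq)
  qed
  have V_scale: "k * a \<in> V (\<lambda>t. k *\<^sub>R f t)" if a: "a \<in> V f" and k: "k > 0" for a f k
  proof -
    obtain c w y where 1: "a = c * J y + xs \<bullet> w" "adm f c w y" using a unfolding V_def by blast
    have "AE t in M. y t \<in> F t (z0 t + (1 / (k * c)) *\<^sub>R (k *\<^sub>R f t - A t (k *\<^sub>R w)))"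
      using 1(2)[unfolded adm_def, THEN conjunct2, THEN conjunct2] A(1)
    proof eventually_elim
      case (elim t)
      have "(1 / (k * c)) *\<^sub>R (k *\<^sub>R f t - A t (k *\<^sub>R w)) = (1 / c) *\<^sub>R (f t - A t w)"
        unfolding linear_scale[OF elim(2)] using k by (simp add: scaleR_diff_right[symmetric])
      then show ?case using elim by simp
    qed
    then have "adm (\<lambda>t. k *\<^sub>R f t) (k * c) (k *\<^sub>R w) y" using 1 k by (simp add: adm_def)
    then have "(k * c) * J y + xs \<bullet> (k *\<^sub>R w) \<in> V (\<lambda>t. k *\<^sub>R f t)" unfolding V_def by blast
    then show ?thesis using 1 by (simp add: algebra_simps)
  qed
  \<comment> \<open>The only use of \<open>ineq\<close>, in direction - w / c: it says that the zero
    displacement has no negative cost. Together with \<open>V_sum\<close> at \<open>h\<close> and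
    its opposite this bounds every \<open>V h\<close> from below, so \<open>p\<close> is
    finite.\<close>
  have V_zero: "a \<ge> 0" if a: "a \<in> V (\<lambda>t. 0)" for a
  proof -
    obtain c w y where 1: "a = c * J y + xs \<bullet> w" "adm (\<lambda>t. 0) c w y" using a unfolding V_def by blast
    have c: "c > 0" using 1 by (simp add: adm_def)
    have "AE t in M. y t \<in> F t (z0 t + A t (- (1 / c) *\<^sub>R w))"
      using 1(2)[unfolded adm_def, THEN conjunct2, THEN conjunct2] A(1)
    proof eventually_elim
      case (elim t)
      then show ?case by (simp add: linear_scale[OF elim(2)] linear_neg[OF elim(2)])
    qed
    then have "xs \<bullet> (- (1 / c) *\<^sub>R w) \<le> J y" unfolding J_def using 1 by (intro ineq) (auto simp: adm_def)
    then show ?thesis using c 1 by (simp add: field_simps)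
  qed
  \<comment> \<open>Passing from \<open>v t\<close> to a point bounded by \<open>\<omega>\<close>,
    at distance \<open>r\<close> in the argument, costs at most norm ys * (|\<omega>| + norm v).
    Convexity charges shorter displacements in proportion, which gives this slope.\<close>
  define \<theta> where "\<theta> t = norm ys * (\<bar>\<omega> t\<bar> + norm (v t)) / r" for t
  have \<theta>: "integrable M \<theta>" "\<And>t. \<theta> t \<ge> 0"
    unfolding \<theta>_def using \<omega>_integrable v(1) r_pos by auto
  have V_bound: "\<exists>a\<in>V h. a \<le> (\<integral>t. \<theta> t * norm (h t) \<partial>M)" if h: "h \<in> bounded_measurable M" for h
  proof -
    obtain K0 where K0: "AE t in M. norm (h t) \<le> K0" and h_meas[measurable]: "h \<in> borel_measurable M"
      using h by (auto simp: bounded_measurable_def)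
    define K where "K = \<bar>K0\<bar> + 1"
    have K1: "K > 0" by (simp add: K_def)
    have K2: "AE t in M. norm (h t) \<le> K" using K0 by eventually_elim (auto simp: K_def)
    note K = K1 K2
    \<comment> \<open>After division by \<open>c\<close> the displacement has length at most
      \<open>r\<close>. It is the fraction \<open>norm (h t) / K\<close> of \<open>u t\<close>, the
      vector of length \<open>r\<close> in the direction of \<open>h t\<close>; hence
      \<open>y\<close> mixes \<open>v\<close> and \<open>z\<close> with that weight.\<close>
    define c where "c = K / r"
    have c: "c > 0" using K r_pos by (simp add: c_def)
    define u where "u t = (r / norm (h t)) *\<^sub>R h t" for t
    have [measurable]: "u \<in> borel_measurable M" unfolding u_def by measurable
    have "AE t in M. norm (u t) \<le> r" using r_pos by (auto simp: u_def)
    then obtain z where z: "integrable M z" "AE t in M. z t \<in> F t (z0 t + u t)" "AE t in M. norm (z t) \<le> \<omega> t"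
      using bounded_selection[of u] by auto
    define a where "a t = norm (h t) / K" for t
    have [measurable]: "a \<in> borel_measurable M" unfolding a_def by measurable
    have a01: "AE t in M. 0 \<le> a t \<and> a t \<le> 1"
      using K(2) by eventually_elim (use K(1) in \<open>auto simp: a_def\<close>)
    have "AE t in M. \<bar>a t\<bar> \<le> 1" using a01 by eventually_elim auto
    then have int: "integrable M (\<lambda>t. a t *\<^sub>R (z t - v t))"
      by (rule integrable_bounded_scaleR[rotated 2]) (use z v in auto)
    define y where "y t = v t + a t *\<^sub>R (z t - v t)" for t
    have y: "integrable M y" unfolding y_def using v int by simp
    have "AE t in M. y t \<in> F t (z0 t + (1 / c) *\<^sub>R (h t - A t 0))"
      using z(2) v(2) F_convex a01 A(1)
    proof eventually_elim
      case (elim t)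
      have "(1 - a t) *\<^sub>R v t + a t *\<^sub>R z t \<in> F t ((1 - a t) *\<^sub>R z0 t + a t *\<^sub>R (z0 t + u t))"
        using elim by (intro convex_gph_combine) auto
      moreover have "(1 - a t) *\<^sub>R v t + a t *\<^sub>R z t = y t" by (simp add: y_def algebra_simps)
      moreover have "a t *\<^sub>R u t = (1 / c) *\<^sub>R h t"
        using K r_pos by (simp add: a_def u_def c_def)
      then have "(1 - a t) *\<^sub>R z0 t + a t *\<^sub>R (z0 t + u t) = z0 t + (1 / c) *\<^sub>R (h t - A t 0)"
        by (simp add: algebra_simps linear_0[OF elim(5)])
      ultimately show ?case by simp
    qed
    then have "adm h c 0 y" using y c by (simp add: adm_def)
    then have "c * J y + xs \<bullet> 0 \<in> V h" unfolding V_def by blast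
    moreover have "c * J y + xs \<bullet> 0 \<le> (\<integral>t. \<theta> t * norm (h t) \<partial>M)"
    proof -
      have "c * J y = c * (ys \<bullet> (\<integral>t. a t *\<^sub>R (z t - v t) \<partial>M))"
        unfolding J_def y_def using v int by simp
      also have "\<dots> = (\<integral>t. c * (ys \<bullet> (a t *\<^sub>R (z t - v t))) \<partial>M)"
        unfolding integral_mult_right_zero integral_inner_right[OF int] ..
      also have "\<dots> \<le> (\<integral>t. \<theta> t * norm (h t) \<partial>M)"
      proof (rule integral_mono_AE)
        show "integrable M (\<lambda>t. c * (ys \<bullet> (a t *\<^sub>R (z t - v t))))"
          by (intro integrable_mult_right integrable_inner_right int)
        have "(\<lambda>t. norm (h t)) \<in> bounded_measurable M" using h by (auto simp: bounded_measurable_def)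
        then show "integrable M (\<lambda>t. \<theta> t * norm (h t))"
          by (rule bounded_measurable_mult_integrable[OF _ \<theta>(1)])
        show "AE t in M. c * (ys \<bullet> (a t *\<^sub>R (z t - v t))) \<le> \<theta> t * norm (h t)"
          using z(3)
        proof eventually_elim
          case (elim t)
          have "ys \<bullet> (z t - v t) \<le> norm ys * norm (z t - v t)" by (rule norm_cauchy_schwarz)
          also have "norm (z t - v t) \<le> \<bar>\<omega> t\<bar> + norm (v t)"
            using norm_triangle_ineq4[of "z t" "v t"] elim by linarith
          finally have "ys \<bullet> (z t - v t) \<le> norm ys * (\<bar>\<omega> t\<bar> + norm (v t))" by (simp add: mult_left_mono)
          then have "norm (h t) / r * (ys \<bullet> (z t - v t)) \<le> norm (h t) / r * (norm ys * (\<bar>\<omega> t\<bar> + norm (v t)))"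
            using r_pos by (intro mult_left_mono) auto
          moreover have "c * (ys \<bullet> (a t *\<^sub>R (z t - v t))) = norm (h t) / r * (ys \<bullet> (z t - v t))"
            using K by (simp add: a_def c_def)
          ultimately show ?case by (simp add: \<theta>_def mult.commute)
        qed
      qed
      finally show ?thesis by simp
    qed
    ultimately show ?thesis by blast
  qed
  have V_ne: "V h \<noteq> {}" if "h \<in> bounded_measurable M" for h using V_bound[OF that] by blast
  have V_bdd: "bdd_below (V h)" if h: "h \<in> bounded_measurable M" for h
  proof -
    obtain b where b: "b \<in> V (\<lambda>t. (-1) *\<^sub>R h t)" using V_ne[OF bounded_measurable_scaleR[OF h, of "-1"]] by blast
    have "- b \<le> a" if a: "a \<in> V h" for a
      using V_zero[of "a + b"] V_sum[OF a b] by simp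
    then show ?thesis by (rule bdd_belowI)
  qed
  have p_le: "p h \<le> a" if "a \<in> V h" "h \<in> bounded_measurable M" for a h
    unfolding p_def using that V_bdd by (intro cInf_lower)
  obtain l where l_add: "\<And>f g. f \<in> bounded_measurable M \<Longrightarrow> g \<in> bounded_measurable M \<Longrightarrow> l (\<lambda>t. f t + g t) = l f + l g"
    and l_scale: "\<And>f c. f \<in> bounded_measurable M \<Longrightarrow> l (\<lambda>t. c *\<^sub>R f t) = c * l f"
    and l_le: "\<And>f. f \<in> bounded_measurable M \<Longrightarrow> l f \<le> p f"
  proof (rule sublinear_dominates_linear[of "bounded_measurable M" p])
    fix f g :: "'t \<Rightarrow> 'c" and c :: real
    assume f: "f \<in> bounded_measurable M"
    show "(\<lambda>t. c *\<^sub>R f t) \<in> bounded_measurable M" by (rule bounded_measurable_scaleR[OF f])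
    show "p (\<lambda>t. c *\<^sub>R f t) \<le> c * p f" if c: "c > 0"
    proof -
      have "p (\<lambda>t. c *\<^sub>R f t) / c \<le> a" if "a \<in> V f" for a
        using p_le[OF V_scale[OF that c] bounded_measurable_scaleR[OF f]] c by (simp add: field_simps)
      then have "p (\<lambda>t. c *\<^sub>R f t) / c \<le> p f" unfolding p_def[of f] using V_ne[OF f] by (intro cInf_greatest)
      then show ?thesis using c by (simp add: field_simps)
    qed
    assume g: "g \<in> bounded_measurable M"
    show fg: "(\<lambda>t. f t + g t) \<in> bounded_measurable M" by (rule bounded_measurable_add[OF f g])
    have *: "p (\<lambda>t. f t + g t) - a \<le> p g" if "a \<in> V f" for a
      unfolding p_def[of g] using V_ne[OF g] p_le[OF V_sum[OF that] fg]
      by (intro cInf_greatest) (auto simp: diff_le_eq add.commute)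
    have "p (\<lambda>t. f t + g t) - p g \<le> p f"
      unfolding p_def[of f] using V_ne[OF f] *
      by (intro cInf_greatest) (auto simp: diff_le_eq add.commute)
    then show "p (\<lambda>t. f t + g t) \<le> p f + p g" by simp
  qed blast
  have l_bound: "l f \<le> (\<integral>t. \<theta> t * norm (f t) \<partial>M)" if f: "f \<in> bounded_measurable M" for f
    using V_bound[OF f] p_le[OF _ f] l_le[OF f] by force
  obtain \<zeta> where \<zeta>: "integrable M \<zeta>"
    "\<And>f. f \<in> bounded_measurable M \<Longrightarrow> integrable M (\<lambda>t. \<zeta> t \<bullet> f t)"
    "\<And>f. f \<in> bounded_measurable M \<Longrightarrow> l f = (\<integral>t. \<zeta> t \<bullet> f t \<partial>M)"
  proof (rule vector_dominated_functional_density[OF finite_measure_axioms \<theta>, of l])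
    fix f g :: "'t \<Rightarrow> 'c" and c :: real
    assume f: "f \<in> bounded_measurable M"
    show "l (\<lambda>t. c *\<^sub>R f t) = c * l f" by (rule l_scale[OF f])
    show "l f \<le> (\<integral>t. \<theta> t * norm (f t) \<partial>M)" by (rule l_bound[OF f])
    assume g: "g \<in> bounded_measurable M"
    show "l (\<lambda>t. f t + g t) = l f + l g" by (rule l_add[OF f g])
  qed blast
  \<comment> \<open>With scaling 1, selection \<open>v\<close> and shift
    \<open>k *\<^sub>R w\<close> the cost is exactly \<open>k * (xs \<bullet> w)\<close>. The cases
    \<open>k = 1\<close> and \<open>k = -1\<close> together turn the inequality into an equality on
    the range of \<open>A\<close>.\<close>
  have l_A_le: "l (\<lambda>t. k *\<^sub>R A t w) \<le> k * (xs \<bullet> w)" for k w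
  proof -
    have bm: "(\<lambda>t. k *\<^sub>R A t w) \<in> bounded_measurable M" by (rule bounded_measurable_scaleR[OF A(2)])
    have "AE t in M. v t \<in> F t (z0 t + (1 / 1) *\<^sub>R (k *\<^sub>R A t w - A t (k *\<^sub>R w)))"
      using v(2) A(1) by eventually_elim (simp add: linear_scale)
    then have "adm (\<lambda>t. k *\<^sub>R A t w) 1 (k *\<^sub>R w) v" using v by (simp add: adm_def)
    then have "1 * J v + xs \<bullet> (k *\<^sub>R w) \<in> V (\<lambda>t. k *\<^sub>R A t w)" unfolding V_def by blast
    from p_le[OF this bm] l_le[OF bm] show ?thesis by (simp add: J_def)
  qed
  have "l (\<lambda>t. A t w) = xs \<bullet> w" for w
    using l_A_le[of 1 w] l_A_le[of "-1" w] l_scale[OF A(2), of "-1" w] by simp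
  then have "(\<integral>t. \<zeta> t \<bullet> A t w \<partial>M) = xs \<bullet> w" for w
    using \<zeta>(3)[OF A(2)] by simp
  moreover have "(\<integral>t. \<zeta> t \<bullet> h t \<partial>M) \<le> J y"
    if h: "h \<in> bounded_measurable M" and y: "integrable M y" "AE t in M. y t \<in> F t (z0 t + h t)" for h y
  proof -
    have "AE t in M. y t \<in> F t (z0 t + (1 / 1) *\<^sub>R (h t - A t 0))"
      using y(2) A(1) by eventually_elim (simp add: linear_0)
    then have "adm h 1 0 y" using y by (simp add: adm_def)
    then have "1 * J y + xs \<bullet> 0 \<in> V h" unfolding V_def by blast
    from p_le[OF this h] l_le[OF h] \<zeta>(3)[OF h] show ?thesis by simp
  qed
  ultimately show ?thesis using that[of \<zeta>] \<zeta>(1,2) unfolding J_def by blast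
qed

text \<open>A displacement can be switched off outside a measurable set by taking h = 0 and y = v
  there. If the pointwise inequality failed on a nonnull set of \<open>t\<close>, a measurable
  selection of violating pairs, used on a set of positive measure only, would contradict the
  integral inequality.\<close>

lemma integral_inequality_localizes:
  assumes v: "integrable M v" "AE t in M. v t \<in> F t (z0 t)" and \<zeta>: "integrable M \<zeta>"
    "\<And>h. h \<in> bounded_measurable M \<Longrightarrow> integrable M (\<lambda>t. \<zeta> t \<bullet> h t)"
    and ineq: "\<And>h y. h \<in> bounded_measurable M \<Longrightarrow> integrable M y \<Longrightarrow> AE t in M. y t \<in> F t (z0 t + h t) \<Longrightarrow>
        (\<integral>t. \<zeta> t \<bullet> h t \<partial>M) \<le> ys \<bullet> (integral\<^sup>L M y - integral\<^sup>L M v)"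
  shows "AE t in M. \<forall>z. \<forall>y\<in>F t z. \<zeta> t \<bullet> (z - z0 t) \<le> ys \<bullet> (y - v t)"
proof (rule ccontr)
  assume neg: "\<not> ?thesis"
  note [measurable] = borel_measurable_integrable[OF v(1)] borel_measurable_integrable[OF \<zeta>(1)]
  define G where "G = {(t, z, y). t \<in> space M \<and> y \<in> F t z} \<inter>
    {x \<in> space (M \<Otimes>\<^sub>M borel). ys \<bullet> (snd (snd x) - v (fst x)) < \<zeta> (fst x) \<bullet> (fst (snd x) - z0 (fst x))}"
  have "{x \<in> space (M \<Otimes>\<^sub>M (borel \<Otimes>\<^sub>M borel)). ys \<bullet> (snd (snd x) - v (fst x)) < \<zeta> (fst x) \<bullet> (fst (snd x) - z0 (fst x))}
      \<in> sets (M \<Otimes>\<^sub>M ((borel :: 'c measure) \<Otimes>\<^sub>M (borel :: 'b measure)))"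
    by measurable
  then have "{x \<in> space (M \<Otimes>\<^sub>M borel). ys \<bullet> (snd (snd x) - v (fst x)) < \<zeta> (fst x) \<bullet> (fst (snd x) - z0 (fst x))}
      \<in> sets (M \<Otimes>\<^sub>M (borel :: ('c \<times> 'b) measure))"
    by (simp only: borel_prod)
  then have G: "G \<in> sets (M \<Otimes>\<^sub>M borel)" unfolding G_def by (rule sets.Int[OF F_measurable])
  have memG: "(t, z, y) \<in> G \<longleftrightarrow> t \<in> space M \<and> y \<in> F t z \<and> ys \<bullet> (y - v t) < \<zeta> t \<bullet> (z - z0 t)" for t z y
    by (auto simp: G_def space_pair_measure)
  have "\<not> (AE t in M. \<forall>x. (t, x) \<notin> G)"
  proof
    assume "AE t in M. \<forall>x. (t, x) \<notin> G"
    then have "AE t in M. \<forall>z. \<forall>y\<in>F t z. \<zeta> t \<bullet> (z - z0 t) \<le> ys \<bullet> (y - v t)"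
      using AE_space by eventually_elim (auto simp: memG not_less)
    with neg show False by blast
  qed
  then obtain B f where B[measurable]: "B \<in> sets M" and B_pos: "emeasure M B > 0"
    and f: "f \<in> borel_measurable M" and fG: "\<And>t. t \<in> B \<Longrightarrow> (t, f t) \<in> G"
    by (rule measurable_selection_positive[OF finite_measure_axioms G]) blast
  define z where "z t = fst (f t)" for t
  define y where "y t = snd (f t)" for t
  have [measurable]: "f \<in> measurable M (borel \<Otimes>\<^sub>M borel)" using f by (simp only: borel_prod)
  have [measurable]: "z \<in> borel_measurable M" "y \<in> borel_measurable M" unfolding z_def y_def by measurable
  have fG: "y t \<in> F t (z t)" "ys \<bullet> (y t - v t) < \<zeta> t \<bullet> (z t - z0 t)" if "t \<in> B" for t
    using fG[OF that] memG[of t "z t" "y t"] by (auto simp: z_def y_def)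
  \<comment> \<open>Truncation makes the displacement bounded and the modified selection integrable;
    these sets exhaust \<open>B\<close>, so one of them would have to be nonnull.\<close>
  define Bn where "Bn n = {t \<in> space M. t \<in> B \<and> norm (z t - z0 t) \<le> real n \<and> norm (y t) \<le> real n}" for n
  have Bn[measurable]: "Bn n \<in> sets M" for n unfolding Bn_def by measurable
  have null: "Bn n \<in> null_sets M" for n
  proof -
    define h where "h t = indicator (Bn n) t *\<^sub>R (z t - z0 t)" for t
    define y' where "y' t = (if t \<in> Bn n then y t else v t)" for t
    have [measurable]: "h \<in> borel_measurable M" "y' \<in> borel_measurable M"
      unfolding h_def y'_def by measurable
    have h: "h \<in> bounded_measurable M"
      unfolding bounded_measurable_def
      by (auto intro!: exI[of _ "real n"] AE_I2 simp: h_def Bn_def split: split_indicator)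
    have y': "integrable M y'"
    proof (rule Bochner_Integration.integrable_bound)
      show "integrable M (\<lambda>t. norm (v t) + real n)" using v by simp
      show "AE t in M. norm (y' t) \<le> norm (norm (v t) + real n)"
        by (rule AE_I2) (auto simp: y'_def Bn_def intro: add_increasing)
    qed simp
    have "AE t in M. y' t \<in> F t (z0 t + h t)"
      using v(2) by eventually_elim (use fG in \<open>auto simp: y'_def h_def Bn_def split: split_indicator\<close>)
    then have le: "(\<integral>t. \<zeta> t \<bullet> h t \<partial>M) \<le> ys \<bullet> (integral\<^sup>L M y' - integral\<^sup>L M v)"
      by (rule ineq[OF h y'])
    define d where "d t = \<zeta> t \<bullet> h t - ys \<bullet> (y' t - v t)" for t
    have d: "integrable M d" unfolding d_def using \<zeta>(2)[OF h] y' v by simp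
    have d_nonneg: "d t \<ge> 0" for t
      using fG[of t] by (auto simp: d_def h_def y'_def Bn_def split: split_indicator)
    have "integral\<^sup>L M d \<le> 0"
      unfolding d_def using le \<zeta>(2)[OF h] y' v by simp
    moreover have "integral\<^sup>L M d \<ge> 0" using d_nonneg by (intro integral_nonneg_AE) auto
    ultimately have "integral\<^sup>L M d = 0" by simp
    then have "AE t in M. d t = 0" using integral_nonneg_eq_0_iff_AE[OF d] d_nonneg by auto
    then have "AE t in M. t \<notin> Bn n"
    proof eventually_elim
      case (elim t)
      show ?case
      proof
        assume t: "t \<in> Bn n"
        then have "t \<in> B" by (simp add: Bn_def)
        then show False using elim t fG(2)[of t] by (simp add: d_def h_def y'_def)
      qed
    qed
    then show ?thesis by (simp add: AE_iff_null_sets)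
  qed
  have "B \<subseteq> (\<Union>n. Bn n)"
  proof
    fix t assume t: "t \<in> B"
    obtain n :: nat where "max (norm (z t - z0 t)) (norm (y t)) \<le> n" using real_arch_simple by blast
    then show "t \<in> (\<Union>n. Bn n)" using t sets.sets_into_space[OF B] by (auto simp: Bn_def)
  qed
  moreover have "(\<Union>n. Bn n) \<in> null_sets M" using null by (rule null_sets_UN)
  ultimately have "B \<in> null_sets M" using B null_sets_subset by blast
  then show False using B_pos by auto
qed

end

section \<open>The composite integrand\<close>

text \<open>\<open>h\<close> is the average over the basis of the vectors
  \<open>(D * (h \<bullet> b)) *\<^sub>R b\<close> with \<open>D\<close> the dimension, and the
  bound on \<open>h\<close> puts each of them on the segment between two opposite axis
  points.\<close>

lemma convex_contains_ball_of_axes: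
  fixes S :: "'a::euclidean_space set"
  assumes S: "convex S" and \<eta>: "\<eta> > 0" and pm: "\<And>b. b \<in> Basis \<Longrightarrow> \<eta> *\<^sub>R b \<in> S \<and> (- \<eta>) *\<^sub>R b \<in> S"
    and h: "norm h \<le> \<eta> / DIM('a)"
  shows "h \<in> S"
proof -
  define D where "D = real DIM('a)"
  have D: "D > 0" by (simp add: D_def)
  have axis: "(D * (h \<bullet> b)) *\<^sub>R b \<in> S" if b: "b \<in> Basis" for b
  proof -
    define u where "u = (1 + D * (h \<bullet> b) / \<eta>) / 2"
    have "\<bar>h \<bullet> b\<bar> \<le> \<eta> / D" using Basis_le_norm[OF b, of h] h by (simp add: D_def)
    then have "\<bar>D * (h \<bullet> b)\<bar> \<le> \<eta>" using D by (simp add: abs_mult field_simps)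
    then have u: "0 \<le> u" "u \<le> 1" using \<eta> by (auto simp: u_def field_simps)
    have "u *\<^sub>R (\<eta> *\<^sub>R b) + (1 - u) *\<^sub>R ((- \<eta>) *\<^sub>R b) \<in> S"
      using S pm[OF b] u by (intro convexD) auto
    also have "u *\<^sub>R (\<eta> *\<^sub>R b) + (1 - u) *\<^sub>R ((- \<eta>) *\<^sub>R b) = ((2 * u - 1) * \<eta>) *\<^sub>R b"
    proof -
      have "u * \<eta> + (1 - u) * (- \<eta>) = (2 * u - 1) * \<eta>" by (simp add: algebra_simps)
      then show ?thesis by (simp only: scaleR_scaleR scaleR_add_left[symmetric])
    qed
    also have "(2 * u - 1) * \<eta> = D * (h \<bullet> b)" using \<eta> by (simp add: u_def field_simps)
    finally show ?thesis .
  qed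
  have "(\<Sum>b\<in>Basis. (1 / D) *\<^sub>R ((D * (h \<bullet> b)) *\<^sub>R b)) \<in> S"
    using D by (intro convex_sum[OF _ S] axis) (auto simp: D_def)
  then show ?thesis using D by (simp add: euclidean_representation)
qed

lemma convex_bounded_section:
  assumes "convex (gph G)"
  shows "convex {h. \<exists>y\<in>G (z + h). norm y \<le> c}"
proof (rule convexI)
  fix h1 h2 and a b :: real
  assume "h1 \<in> {h. \<exists>y\<in>G (z + h). norm y \<le> c}" "h2 \<in> {h. \<exists>y\<in>G (z + h). norm y \<le> c}"
    and ab: "0 \<le> a" "0 \<le> b" "a + b = 1"
  then obtain y1 y2 where y: "y1 \<in> G (z + h1)" "norm y1 \<le> c" "y2 \<in> G (z + h2)" "norm y2 \<le> c" by blast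
  have "a *\<^sub>R y1 + b *\<^sub>R y2 \<in> G (a *\<^sub>R (z + h1) + b *\<^sub>R (z + h2))"
    by (rule convex_gph_combine[OF assms y(1,3) ab])
  moreover have "a *\<^sub>R (z + h1) + b *\<^sub>R (z + h2) = (a + b) *\<^sub>R z + (a *\<^sub>R h1 + b *\<^sub>R h2)"
    by (simp add: algebra_simps)
  moreover have "norm (a *\<^sub>R y1 + b *\<^sub>R y2) \<le> c"
    using convexD[OF convex_cball[of 0 c], of y1 y2 a b] y ab by simp
  ultimately show "a *\<^sub>R h1 + b *\<^sub>R h2 \<in> {h. \<exists>y\<in>G (z + h). norm y \<le> c}" using ab by auto
qed

text \<open>The slack 1 stands in for attainment of the infimum; the empty set is excluded since its
  distance is infinite.\<close>

lemma set_distance_finite: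
  fixes S :: "'a::real_normed_vector set"
  assumes "set_distance 0 S < \<infinity>"
  obtains y where "y \<in> S" "norm y \<le> enn2real (set_distance 0 S) + 1"
proof -
  have "set_distance 0 S < ennreal (enn2real (set_distance 0 S) + 1)"
  proof -
    have "ennreal (enn2real (set_distance 0 S)) < ennreal (enn2real (set_distance 0 S) + 1)"
      by (intro ennreal_lessI add_nonneg_pos) auto
    then show ?thesis using assms by (simp add: ennreal_enn2real)
  qed
  then obtain y where "y \<in> S" "ennreal (dist 0 y) < ennreal (enn2real (set_distance 0 S) + 1)"
    unfolding set_distance_def INF_less_iff by blast
  moreover have "norm y < enn2real (set_distance 0 S) + 1"
    using calculation(2) unfolding dist_0_norm by (subst (asm) ennreal_less_iff) auto
  ultimately show ?thesis using that by simp
qed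

text \<open>Integrability for each single \<open>h\<close> gives bounds and null sets that depend on
  \<open>h\<close>. Only the finitely many axis points are used: the sum of their distances gives
  one \<open>\<omega>\<close> and one null set, and convexity of the sections carries the bound to a
  smaller ball.\<close>

lemma convex_integrand_near_if_integrable_distance:
  fixes F :: "'t \<Rightarrow> 'c::euclidean_space \<Rightarrow> 'b::euclidean_space set"
  assumes M: "finite_measure M" and F: "convex_normal_integrand M F"
    and z0: "z0 \<in> borel_measurable M" and \<eta>: "\<eta> > 0"
    and dist: "\<And>h. norm h \<le> \<eta> \<Longrightarrow> ennreal_integrable M (\<lambda>t. set_distance 0 (F t (z0 t + h)))"
  obtains r \<omega> where "convex_integrand_near M F z0 r \<omega>"
proof -
  interpret finite_measure M by fact
  define d where "d h t = enn2real (set_distance 0 (F t (z0 t + h)))" for h t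
  define r where "r = \<eta> / DIM('c)"
  define P where "P = (\<lambda>b::'c. \<eta> *\<^sub>R b) ` Basis \<union> (\<lambda>b. (- \<eta>) *\<^sub>R b) ` Basis"
  define \<omega> where "\<omega> t = (\<Sum>h\<in>P. d h t) + 1" for t
  have P: "finite P" "\<And>h. h \<in> P \<Longrightarrow> norm h \<le> \<eta>" using \<eta> by (auto simp: P_def)
  have fin: "AE t in M. set_distance 0 (F t (z0 t + h)) < \<infinity>" if "h \<in> P" for h
  proof -
    have "AE t in M. set_distance 0 (F t (z0 t + h)) \<noteq> \<infinity>"
      by (rule nn_integral_PInf_AE) (use dist[OF P(2)[OF that]] in \<open>auto simp: ennreal_integrable_def\<close>)
    then show ?thesis by eventually_elim (simp add: less_top)
  qed
  have d_int: "integrable M (d h)" if "h \<in> P" for h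
  proof (rule integrableI_nonneg)
    have meas [measurable]: "(\<lambda>t. set_distance 0 (F t (z0 t + h))) \<in> borel_measurable M"
      using dist[OF P(2)[OF that]] by (simp add: ennreal_integrable_def)
    show "d h \<in> borel_measurable M" unfolding d_def by measurable
    show "AE t in M. 0 \<le> d h t" by (simp add: d_def)
    have "(\<integral>\<^sup>+t. ennreal (d h t) \<partial>M) = (\<integral>\<^sup>+t. set_distance 0 (F t (z0 t + h)) \<partial>M)"
      by (rule nn_integral_cong_AE) (use fin[OF that] in eventually_elim, auto simp: d_def less_top)
    then show "(\<integral>\<^sup>+t. ennreal (d h t) \<partial>M) < \<infinity>"
      using dist[OF P(2)[OF that]] by (simp add: ennreal_integrable_def)
  qed
  have "convex_integrand_near M F z0 r \<omega>"
  proof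
    show "{(t, z, y). t \<in> space M \<and> y \<in> F t z} \<in> sets (M \<Otimes>\<^sub>M borel)" "AE t in M. convex (gph (F t))"
      using F by (auto simp: convex_normal_integrand_def normal_integrand_def)
    show "z0 \<in> borel_measurable M" by fact
    show "r > 0" using \<eta> by (simp add: r_def)
    show "integrable M \<omega>" unfolding \<omega>_def using d_int by (intro Bochner_Integration.integrable_add Bochner_Integration.integrable_sum) auto
    have "AE t in M. \<forall>h\<in>P. set_distance 0 (F t (z0 t + h)) < \<infinity>"
      using fin P(1) by (simp add: AE_finite_all)
    moreover have "AE t in M. convex (gph (F t))" using F by (simp add: convex_normal_integrand_def)
    ultimately show "AE t in M. \<forall>h. norm h \<le> r \<longrightarrow> (\<exists>y\<in>F t (z0 t + h). norm y \<le> \<omega> t)"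
    proof eventually_elim
      case (elim t)
      let ?S = "{h. \<exists>y\<in>F t (z0 t + h). norm y \<le> \<omega> t}"
      have PS: "h \<in> ?S" if h: "h \<in> P" for h
      proof -
        obtain y where "y \<in> F t (z0 t + h)" "norm y \<le> d h t + 1"
          using set_distance_finite elim h unfolding d_def by blast
        moreover have "d h t \<le> (\<Sum>h\<in>P. d h t)"
          using P(1) h by (intro member_le_sum) (auto simp: d_def)
        ultimately show ?thesis by (auto simp: \<omega>_def intro!: bexI[of _ y])
      qed
      have "h \<in> ?S" if "norm h \<le> r" for h
      proof (rule convex_contains_ball_of_axes[OF _ \<eta>])
        show "convex ?S" using elim by (intro convex_bounded_section) auto
        show "norm h \<le> \<eta> / DIM('c)" using that by (simp add: r_def)
        show "\<eta> *\<^sub>R b \<in> ?S \<and> (- \<eta>) *\<^sub>R b \<in> ?S" if b: "b \<in> Basis" for b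
        proof (intro conjI PS)
          show "\<eta> *\<^sub>R b \<in> P" "(- \<eta>) *\<^sub>R b \<in> P" unfolding P_def using b by blast+
        qed
      qed
      then show ?case by blast
    qed
  qed
  then show ?thesis using that by blast
qed

section \<open>Derivatives of the inner functions and their measurability\<close>

lemma C1_around_has_derivative:
  "C1_around f x \<Longrightarrow> (f has_derivative frechet_derivative f (at x)) (at x)"
  unfolding C1_around_def by (metis frechet_derivative_at)

lemma C1_around_frechet_derivative_tendsto:
  assumes "C1_around f x" "X \<longlonglongrightarrow> x"
  shows "(\<lambda>k. frechet_derivative f (at (X k)) w) \<longlonglongrightarrow> frechet_derivative f (at x) w"
proof -
  obtain V f' where V: "open V" "x \<in> V" and f': "\<And>z. z \<in> V \<Longrightarrow> (f has_derivative blinfun_apply (f' z)) (at z)"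
    and cont: "continuous_on V f'"
    using assms(1) unfolding C1_around_def by blast
  have eq: "blinfun_apply (f' z) = frechet_derivative f (at z)" if "z \<in> V" for z
    by (rule frechet_derivative_at[OF f'[OF that]])
  have "isCont f' x" using cont V by (simp add: continuous_on_eq_continuous_at)
  then have "(\<lambda>k. f' (X k)) \<longlonglongrightarrow> f' x" using assms(2) by (rule isCont_tendsto_compose)
  then have "(\<lambda>k. blinfun_apply (f' (X k)) w) \<longlonglongrightarrow> blinfun_apply (f' x) w"
    by (intro tendsto_intros)
  moreover have "\<forall>\<^sub>F k in sequentially. blinfun_apply (f' (X k)) w = frechet_derivative f (at (X k)) w"
    using topological_tendstoD[OF assms(2) V] by eventually_elim (simp add: eq)
  ultimately show ?thesis unfolding eq[OF V(2)] by (rule Lim_transform_eventually)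
qed

text \<open>Steps independent of \<open>t\<close> keep the quotients measurable; scaling them by
  \<open>norm w + 1\<close> keeps the points in the ball and avoids a zero divisor for w =
  0.\<close>

lemma measurable_difference_quotients:
  fixes g :: "'t \<Rightarrow> 'a::euclidean_space \<Rightarrow> 'c::euclidean_space"
  assumes e: "e > 0" and g: "\<And>x. x \<in> ball x0 e \<Longrightarrow> (\<lambda>t. g t x) \<in> borel_measurable M"
  obtains dq :: "nat \<Rightarrow> 't \<Rightarrow> 'c" where "\<And>k. dq k \<in> borel_measurable M"
    "\<And>t A. (g t has_derivative A) (at x0) \<Longrightarrow> (\<lambda>k. dq k t) \<longlonglongrightarrow> A w"
proof -
  define s where "s k = e / (norm w + 1) / Suc k" for k
  have pos: "0 < norm w + 1" by (smt (verit) norm_ge_zero)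
  have s_pos: "s k > 0" for k unfolding s_def using e pos by simp
  have s_lim: "s \<longlonglongrightarrow> 0" unfolding s_def divide_inverse[of _ "real _"]
    by (intro tendsto_mult_right_zero LIMSEQ_inverse_real_of_nat)
  have sw: "x0 + s k *\<^sub>R w \<in> ball x0 e" for k
  proof -
    have "s k \<le> e / (norm w + 1)" unfolding s_def using e pos by (simp add: divide_le_eq)
    then have "s k * norm w \<le> e / (norm w + 1) * norm w" by (rule mult_right_mono) simp
    also have "\<dots> = e * (norm w / (norm w + 1))" by simp
    also have "\<dots> < e * 1" using e pos by (intro mult_strict_left_mono) auto
    finally show ?thesis using s_pos[of k] by (simp add: dist_norm)
  qed
  define dq where "dq k t = (1 / s k) *\<^sub>R (g t (x0 + s k *\<^sub>R w) - g t x0)" for k t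
  have [measurable]: "(\<lambda>t. g t (x0 + s k *\<^sub>R w)) \<in> borel_measurable M" "(\<lambda>t. g t x0) \<in> borel_measurable M" for k
    using g[OF sw[of k]] g[of x0] e by auto
  have "dq k \<in> borel_measurable M" for k
    unfolding dq_def by measurable
  moreover have "(\<lambda>k. dq k t) \<longlonglongrightarrow> A w" if "(g t has_derivative A) (at x0)" for t A
    unfolding dq_def by (rule has_derivative_difference_quotient[OF that s_lim s_pos])
  ultimately show ?thesis using that by blast
qed

lemma measurable_directional_derivative:
  fixes g :: "'t \<Rightarrow> 'a::euclidean_space \<Rightarrow> 'c::euclidean_space"
  assumes "e > 0" and "\<And>x. x \<in> ball x0 e \<Longrightarrow> (\<lambda>t. g t x) \<in> borel_measurable M"
    and "\<And>t. t \<in> space M \<Longrightarrow> (g t has_derivative A t) (at x0)"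
  shows "(\<lambda>t. A t w) \<in> borel_measurable M"
proof -
  obtain dq where dq: "\<And>k. dq k \<in> borel_measurable M"
    "\<And>t A. (g t has_derivative A) (at x0) \<Longrightarrow> (\<lambda>k. dq k t) \<longlonglongrightarrow> A w"
    by (rule measurable_difference_quotients[of e x0 g M w, OF assms(1,2)]) blast+
  show ?thesis by (rule borel_measurable_LIMSEQ_metric[OF dq(1) dq(2)[OF assms(3)]])
qed

text \<open>For the moving base points, where differentiability is available only for almost every
  \<open>t\<close>: a measurable version of the directional derivative replaces the derivative
  itself.\<close>

lemma measurable_directional_derivative_AE:
  fixes g :: "'t \<Rightarrow> 'a::euclidean_space \<Rightarrow> 'c::euclidean_space"
  assumes "e > 0" and "\<And>x. x \<in> ball x0 e \<Longrightarrow> (\<lambda>t. g t x) \<in> borel_measurable M"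
    and "AE t in M. (g t has_derivative A t) (at x0)"
  obtains q where "q \<in> borel_measurable M" "AE t in M. q t = A t w"
proof -
  obtain dq where [measurable]: "\<And>k. dq k \<in> borel_measurable M"
    and dq: "\<And>t A. (g t has_derivative A) (at x0) \<Longrightarrow> (\<lambda>k. dq k t) \<longlonglongrightarrow> A w"
    by (rule measurable_difference_quotients[of e x0 g M w, OF assms(1,2)]) blast+
  have "(\<lambda>t. lim (\<lambda>k. dq k t)) \<in> borel_measurable M" by measurable
  moreover have "AE t in M. lim (\<lambda>k. dq k t) = A t w"
    using assms(3) by eventually_elim (use dq limI in blast)
  ultimately show ?thesis using that by blast
qed

text \<open>An inequality on the whole graph makes the difference quotient nonpositive everywhere,
  which gives a regular normal; constant sequences show that it is a limiting one.\<close>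

lemma coderivative_contains_subgradient:
  fixes G :: "'a::euclidean_space \<Rightarrow> 'b::euclidean_space set"
  assumes "y0 \<in> G x0" and "\<And>x y. y \<in> G x \<Longrightarrow> xs \<bullet> (x - x0) \<le> ys \<bullet> (y - y0)"
  shows "xs \<in> coderivative G x0 y0 ys"
proof -
  have "(xs, - ys) \<in> regular_normal_cone (x0, y0) (gph G)"
  proof -
    have "\<forall>\<^sub>F z in at (x0, y0) within gph G.
        ereal (((xs, - ys) \<bullet> (z - (x0, y0))) / norm (z - (x0, y0))) \<le> 0"
      unfolding eventually_at_filter
      by (rule always_eventually) (auto simp: gph_def divide_le_0_iff assms(2))
    then show ?thesis
      using assms(1) by (auto simp: regular_normal_cone_def gph_def intro!: Limsup_bounded)
  qed
  then show ?thesis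
    unfolding coderivative_def limiting_normal_cone_def
    by (simp, intro exI[of _ "\<lambda>_. (x0, y0)"] exI[of _ "\<lambda>_. (xs, - ys)"]) auto
qed

text \<open>The common end of both inclusions: once \<open>ineq\<close> holds for all
  \<open>w\<close> and \<open>y\<close>, it no longer matters whether \<open>xs\<close> came from a
  regular or a limiting normal.\<close>

lemma (in convex_integrand_near) aumann_integral_of_coderivatives:
  fixes g :: "'t \<Rightarrow> 'a::euclidean_space \<Rightarrow> 'c"
  assumes v: "integrable M v" "AE t in M. v t \<in> F t (z0 t)"
    and z0: "\<And>t. z0 t = g t x0"
    and deriv: "\<And>t. t \<in> space M \<Longrightarrow> (g t has_derivative frechet_derivative (g t) (at x0)) (at x0)"
    and bm: "\<And>w. (\<lambda>t. frechet_derivative (g t) (at x0) w) \<in> bounded_measurable M"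
    and ineq: "\<And>w y. integrable M y \<Longrightarrow>
        AE t in M. y t \<in> F t (z0 t + frechet_derivative (g t) (at x0) w) \<Longrightarrow>
        xs \<bullet> w \<le> ys \<bullet> (integral\<^sup>L M y - integral\<^sup>L M v)"
  shows "xs \<in> aumann_integral M (\<lambda>t. adj_gradient (g t) x0 ` coderivative (F t) (g t x0) (v t) ys)"
proof -
  define A where "A t = frechet_derivative (g t) (at x0)" for t
  have lin: "linear (A t)" if "t \<in> space M" for t
    unfolding A_def using deriv[OF that] by (rule has_derivative_linear)
  have A_bm: "(\<lambda>t. A t w) \<in> bounded_measurable M" for w unfolding A_def by (rule bm)
  have A_ineq: "xs \<bullet> w \<le> ys \<bullet> (integral\<^sup>L M y - integral\<^sup>L M v)"
    if "integrable M y" "AE t in M. y t \<in> F t (z0 t + A t w)" for w y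
    using that unfolding A_def by (rule ineq)
  have lin_AE: "AE t in M. linear (A t)" using lin by (rule AE_I2)
  obtain \<zeta> where \<zeta>: "integrable M \<zeta>"
    "\<And>h. h \<in> bounded_measurable M \<Longrightarrow> integrable M (\<lambda>t. \<zeta> t \<bullet> h t)"
    "\<And>w. (\<integral>t. \<zeta> t \<bullet> A t w \<partial>M) = xs \<bullet> w"
    "\<And>h y. h \<in> bounded_measurable M \<Longrightarrow> integrable M y \<Longrightarrow> AE t in M. y t \<in> F t (z0 t + h t) \<Longrightarrow>
        (\<integral>t. \<zeta> t \<bullet> h t \<partial>M) \<le> ys \<bullet> (integral\<^sup>L M y - integral\<^sup>L M v)"
  proof (rule sublinear_hull_density[OF v lin_AE A_bm, of xs ys])
    show "xs \<bullet> w \<le> ys \<bullet> (integral\<^sup>L M y - integral\<^sup>L M v)"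
      if "integrable M y" "AE t in M. y t \<in> F t (z0 t + A t w)" for w y
      using that by (rule A_ineq)
  qed blast
  have loc: "AE t in M. \<forall>z. \<forall>y\<in>F t z. \<zeta> t \<bullet> (z - z0 t) \<le> ys \<bullet> (y - v t)"
    by (rule integral_inequality_localizes[OF v \<zeta>(1,2,4)])
  \<comment> \<open>The adjoint applied to \<open>\<zeta> t\<close>, written in coordinates: its
    components are integrable, and their integrals are the coordinates of \<open>xs\<close>.\<close>
  define u where "u t = (\<Sum>b\<in>Basis. (\<zeta> t \<bullet> A t b) *\<^sub>R b)" for t
  have u_int: "integrable M u" unfolding u_def using \<zeta>(2)[OF A_bm] by simp
  have u_adj: "u t = adj_gradient (g t) x0 (\<zeta> t)" if "t \<in> space M" for t
  proof -
    have "u t \<bullet> b = adj_gradient (g t) x0 (\<zeta> t) \<bullet> b" if "b \<in> Basis" for b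
    proof -
      have "u t \<bullet> b = \<zeta> t \<bullet> A t b" unfolding u_def using that by (rule inner_sum_left_Basis)
      then show ?thesis
        using adjoint_works[OF lin[OF \<open>t \<in> space M\<close>], of b "\<zeta> t"]
        by (simp add: adj_gradient_def A_def inner_commute)
    qed
    then show ?thesis by (rule euclidean_eqI)
  qed
  have "integral\<^sup>L M u = (\<Sum>b\<in>Basis. (\<integral>t. \<zeta> t \<bullet> A t b \<partial>M) *\<^sub>R b)"
    unfolding u_def using \<zeta>(2)[OF A_bm] by simp
  then have "integral\<^sup>L M u = xs" by (simp add: \<zeta>(3) euclidean_representation)
  moreover have "AE t in M. u t \<in> adj_gradient (g t) x0 ` coderivative (F t) (g t x0) (v t) ys"
    using loc v(2) AE_space
  proof eventually_elim
    case (elim t)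
    then have "\<zeta> t \<in> coderivative (F t) (g t x0) (v t) ys"
      using z0 by (intro coderivative_contains_subgradient) auto
    then show ?case using u_adj elim by blast
  qed
  ultimately show ?thesis using u_int unfolding aumann_integral_def by blast
qed

section \<open>The inclusions for regular and limiting coderivatives\<close>

theorem theorem6p5:
  fixes M :: "'t measure"
    and \<Phi> :: "'t \<Rightarrow> real ^ 'n \<Rightarrow> (real ^ 'm) set"
    and F :: "'t \<Rightarrow> real ^ 'q \<Rightarrow> (real ^ 'm) set"
    and g :: "'t \<Rightarrow> real ^ 'n \<Rightarrow> real ^ 'q"
    and U :: "(real ^ 'n) set"
    and xbar :: "real ^ 'n" and ybar :: "real ^ 'm"
    and \<rho> \<eta> :: real and \<kappa> :: "'t \<Rightarrow> real"
  assumes "finite_measure M" and "complete_measure M"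
    and "normal_integrand M \<Phi>"
    and "(xbar, ybar) \<in> gph (expected_map M \<Phi>)"
    and "integrably_amenable M \<Phi> xbar ybar U F g"
    and a: "\<rho> > 0" "integrable M \<kappa>" "AE t in M. \<kappa> t > 0"
      "AE t in M. \<forall>x\<in>cball xbar \<rho>. \<Phi> t x \<subseteq> cball 0 (\<kappa> t)"
    and b: "\<eta> > 0" "cball xbar \<eta> \<subseteq> U"
      "\<exists>L. AE t in M. \<forall>x\<in>cball xbar \<eta>.
         g t differentiable (at x) \<and> onorm (frechet_derivative (g t) (at x)) \<le> L"
    and c: "\<And>h. norm h \<le> \<eta> \<Longrightarrow>
         ennreal_integrable M (\<lambda>t. set_distance 0 (F t (g t xbar + h)))"
  shows "(\<forall>v\<in>integrable_selections M \<Phi> xbar ybar. \<forall>ystar.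
            regular_coderivative (expected_map M \<Phi>) xbar ybar ystar
              \<subseteq> aumann_integral M
                  (\<lambda>t. adj_gradient (g t) xbar ` coderivative (F t) (g t xbar) (v t) ystar))
       \<and> (selections_inner_semicompact M \<Phi> xbar ybar \<longrightarrow>
          (\<forall>ystar.
            coderivative (expected_map M \<Phi>) xbar ybar ystar
              \<subseteq> (\<Union>v\<in>integrable_selections M \<Phi> xbar ybar.
                   aumann_integral M
                     (\<lambda>t. adj_gradient (g t) xbar ` coderivative (F t) (g t xbar) (v t) ystar))))"
proof -
  have F: "convex_normal_integrand M F"
    and g_meas: "\<And>x. x \<in> U \<Longrightarrow> (\<lambda>t. g t x) \<in> borel_measurable M"
    and C1: "\<And>t. t \<in> space M \<Longrightarrow> C1_around (g t) xbar"
    and comp: "AE t in M. \<forall>x\<in>U. \<Phi> t x = F t (g t x)"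
    and xbar: "xbar \<in> U"
    using assms(5) unfolding integrably_amenable_def by auto
  define z0 where "z0 t = g t xbar" for t
  have z0_meas: "z0 \<in> borel_measurable M" unfolding z0_def by (rule g_meas[OF xbar])
  obtain r \<omega> where near: "convex_integrand_near M F z0 r \<omega>"
    using convex_integrand_near_if_integrable_distance[OF assms(1) F z0_meas b(1)] c
    unfolding z0_def by blast
  interpret convex_integrand_near M F z0 r \<omega> by (rule near)
  \<comment> \<open>The gradient bound is enlarged to a positive one because
    \<open>\<epsilon>\<close> and later \<open>c\<close> divide by it.\<close>
  obtain L where L_pos: "L > 0"
    and L: "AE t in M. \<forall>x\<in>cball xbar \<eta>. g t differentiable (at x) \<and> onorm (frechet_derivative (g t) (at x)) \<le> L"
  proof -
    obtain L0 where "AE t in M. \<forall>x\<in>cball xbar \<eta>. g t differentiable (at x) \<and> onorm (frechet_derivative (g t) (at x)) \<le> L0"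
      using b(3) by blast
    then have "AE t in M. \<forall>x\<in>cball xbar \<eta>. g t differentiable (at x) \<and> onorm (frechet_derivative (g t) (at x)) \<le> \<bar>L0\<bar> + 1"
      by eventually_elim fastforce
    then show ?thesis using that[of "\<bar>L0\<bar> + 1"] by simp
  qed
  have lip: "AE t in M. \<forall>x\<in>cball xbar \<eta>. \<forall>x'\<in>cball xbar \<eta>. norm (g t x - g t x') \<le> L * norm (x - x')"
    using L
  proof eventually_elim
    case (elim t)
    show ?case
      by (intro ballI differentiable_bound[where f'="\<lambda>x. frechet_derivative (g t) (at x)" and S="cball xbar \<eta>"])
        (use elim in \<open>auto simp: frechet_derivative_works intro: has_derivative_at_withinI\<close>)
  qed
  define A where "A t x = frechet_derivative (g t) (at x)" for t x
  have A_deriv: "AE t in M. \<forall>x\<in>cball xbar \<eta>. (g t has_derivative A t x) (at x)"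
    using L by eventually_elim (auto simp: A_def frechet_derivative_works)
  have A_bound: "AE t in M. \<forall>x\<in>cball xbar \<eta>. \<forall>w. norm (A t x w) \<le> L * norm w"
    using L A_deriv
  proof eventually_elim
    case (elim t)
    have "norm (A t x w) \<le> L * norm w" if x: "x \<in> cball xbar \<eta>" for x w
    proof -
      have "bounded_linear (A t x)" using elim x by (auto intro: has_derivative_bounded_linear)
      then have "norm (A t x w) \<le> onorm (A t x) * norm w" by (rule onorm)
      also have "\<dots> \<le> L * norm w" using elim x by (auto simp: A_def intro!: mult_right_mono)
      finally show ?thesis .
    qed
    then show ?case by blast
  qed
  \<comment> \<open>The first bound keeps balls of radius \<eta> / 2 about nearby base points inside
    \<open>cball xbar \<eta>\<close>. The second keeps \<open>g t x0\<close> within r / 4 of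
    \<open>z0 t\<close>, as the passage to the limit requires.\<close>
  define \<epsilon> where "\<epsilon> = min (\<eta> / 2) (r / (4 * L))"
  have \<epsilon>: "\<epsilon> > 0" "\<epsilon> \<le> \<eta> / 2" "L * \<epsilon> \<le> r / 4"
  proof -
    show "\<epsilon> > 0" "\<epsilon> \<le> \<eta> / 2" using b(1) r_pos L_pos by (auto simp: \<epsilon>_def)
    have "L * \<epsilon> \<le> L * (r / (4 * L))" using L_pos by (intro mult_left_mono) (auto simp: \<epsilon>_def)
    then show "L * \<epsilon> \<le> r / 4" using L_pos by simp
  qed
  have xbar_cball: "xbar \<in> cball xbar \<eta>" using b(1) by simp
  have cball_sub: "ball x0 (\<eta> / 2) \<subseteq> cball xbar \<eta>" if "x0 \<in> cball xbar \<epsilon>" for x0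
  proof
    fix x assume "x \<in> ball x0 (\<eta> / 2)"
    then show "x \<in> cball xbar \<eta>" using that \<epsilon> dist_triangle[of xbar x x0] by simp
  qed
  have ball_meas: "(\<lambda>t. g t x) \<in> borel_measurable M" if "x0 \<in> cball xbar \<epsilon>" "x \<in> ball x0 (\<eta> / 2)" for x0 x
    using cball_sub[OF that(1)] that(2) b(2) by (intro g_meas) blast
  have \<epsilon>_\<eta>: "x0 \<in> cball xbar \<eta>" if "x0 \<in> cball xbar \<epsilon>" for x0
    using cball_sub[OF that] b(1) by (auto simp: subset_iff)
  have near_bound: "AE t in M. norm (g t x0 - z0 t) \<le> r / 4" if x0: "x0 \<in> cball xbar \<epsilon>" for x0
    using lip
  proof eventually_elim
    case (elim t)
    have "norm (g t x0 - z0 t) \<le> L * norm (x0 - xbar)"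
      unfolding z0_def using elim \<epsilon>_\<eta>[OF x0] xbar_cball by blast
    also have "\<dots> \<le> L * \<epsilon>" using x0 L_pos by (intro mult_left_mono) (auto simp: dist_norm norm_minus_commute)
    finally show ?case using \<epsilon> by simp
  qed
  have selF: "AE t in M. v t \<in> F t (g t x0)"
    if "v \<in> integrable_selections M \<Phi> x0 y0" "x0 \<in> cball xbar \<epsilon>" for v x0 y0
  proof -
    have "AE t in M. v t \<in> \<Phi> t x0" using that(1) by (simp add: integrable_selections_def)
    then show ?thesis using comp by eventually_elim (use b(2) \<epsilon>_\<eta>[OF that(2)] in blast)
  qed
  \<comment> \<open>Proved for every base point in the \<epsilon>-ball: the first inclusion uses it
    at \<open>xbar\<close>, the second at the moving points.\<close>
  have inequality: "xs \<bullet> w \<le> ys \<bullet> (integral\<^sup>L M y - y0)"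
    if normal: "(xs, - ys) \<in> regular_normal_cone (x0, y0) (gph (expected_map M \<Phi>))"
      and x0: "x0 \<in> cball xbar \<epsilon>" and v: "v \<in> integrable_selections M \<Phi> x0 y0"
      and y: "integrable M y" "AE t in M. y t \<in> F t (g t x0 + A t x0 w)" for xs ys x0 y0 v w y
  proof -
    have v': "integrable M v" "y0 = integral\<^sup>L M v" using v by (auto simp: integrable_selections_def)
    have "xs \<bullet> w \<le> ys \<bullet> (integral\<^sup>L M y - integral\<^sup>L M v)"
    proof (rule regular_normal_inequality[where g=g and e="\<eta> / 2" and L=L and A="\<lambda>t. A t x0"])
      show "(xs, - ys) \<in> regular_normal_cone (x0, integral\<^sup>L M v) (gph (expected_map M \<Phi>))"
        using normal v' by simp
      show "AE t in M. v t \<in> F t (g t x0)" by (rule selF[OF v x0])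
      show "AE t in M. \<forall>x\<in>ball x0 (\<eta> / 2). \<Phi> t x = F t (g t x)"
        using comp by eventually_elim (use cball_sub[OF x0] b(2) in blast)
      show "AE t in M. norm (g t x0 - z0 t) \<le> r / 2"
        using near_bound[OF x0] by eventually_elim (use r_pos in linarith)
      show "AE t in M. \<forall>x\<in>ball x0 (\<eta> / 2). norm (g t x - g t x0) \<le> L * norm (x - x0)"
        using lip by eventually_elim (use cball_sub[OF x0] \<epsilon>_\<eta>[OF x0] in blast)
      show "AE t in M. (g t has_derivative A t x0) (at x0)"
        using A_deriv by eventually_elim (use \<epsilon>_\<eta>[OF x0] in blast)
      show "(\<lambda>t. g t x) \<in> borel_measurable M" if "x \<in> ball x0 (\<eta> / 2)" for x
        by (rule ball_meas[OF x0 that])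
    qed (use b(1) L_pos v' y in auto)
    then show ?thesis using v' by simp
  qed
  have xbar_\<epsilon>: "xbar \<in> cball xbar \<epsilon>" using \<epsilon> by simp
  have deriv_xbar: "(g t has_derivative A t xbar) (at xbar)" if "t \<in> space M" for t
    unfolding A_def by (rule C1_around_has_derivative[OF C1[OF that]])
  have A_bm: "(\<lambda>t. A t xbar w) \<in> bounded_measurable M" for w
  proof -
    have "(\<lambda>t. A t xbar w) \<in> borel_measurable M"
      by (rule measurable_directional_derivative[where e="\<eta> / 2", OF _ ball_meas[OF xbar_\<epsilon>] deriv_xbar]) (use b(1) in auto)
    moreover have "AE t in M. norm (A t xbar w) \<le> L * norm w"
      using A_bound by eventually_elim (use xbar_cball in blast)
    ultimately show ?thesis by (auto simp: bounded_measurable_def)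
  qed
  have conclude: "xs \<in> aumann_integral M (\<lambda>t. adj_gradient (g t) xbar ` coderivative (F t) (g t xbar) (v t) ys)"
    if v: "v \<in> integrable_selections M \<Phi> xbar ybar"
      and ineq: "\<And>w y. integrable M y \<Longrightarrow> AE t in M. y t \<in> F t (z0 t + A t xbar w) \<Longrightarrow>
        xs \<bullet> w \<le> ys \<bullet> (integral\<^sup>L M y - ybar)" for v xs ys
  proof (rule aumann_integral_of_coderivatives)
    show "z0 t = g t xbar" for t by (rule z0_def)
    show "integrable M v" using v by (simp add: integrable_selections_def)
    show "AE t in M. v t \<in> F t (z0 t)" using selF[OF v xbar_\<epsilon>] by (simp add: z0_def)
    show "(g t has_derivative frechet_derivative (g t) (at xbar)) (at xbar)" if "t \<in> space M" for t
      using deriv_xbar[OF that] by (simp add: A_def)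
    show "(\<lambda>t. frechet_derivative (g t) (at xbar) w) \<in> bounded_measurable M" for w
      using A_bm[of w] by (simp add: A_def)
    show "xs \<bullet> w \<le> ys \<bullet> (integral\<^sup>L M y - integral\<^sup>L M v)"
      if "integrable M y" "AE t in M. y t \<in> F t (z0 t + frechet_derivative (g t) (at xbar) w)" for w y
      using ineq[of y w] that v by (simp add: A_def integrable_selections_def)
  qed
  have part1: "xs \<in> aumann_integral M (\<lambda>t. adj_gradient (g t) xbar ` coderivative (F t) (g t xbar) (v t) ys)"
    if v: "v \<in> integrable_selections M \<Phi> xbar ybar"
      and xs: "xs \<in> regular_coderivative (expected_map M \<Phi>) xbar ybar ys" for v xs ys
  proof (rule conclude[OF v])
    show "xs \<bullet> w \<le> ys \<bullet> (integral\<^sup>L M y - ybar)"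
      if "integrable M y" "AE t in M. y t \<in> F t (z0 t + A t xbar w)" for w y
      by (rule inequality[OF _ xbar_\<epsilon> v])
        (use that xs in \<open>auto simp: regular_coderivative_def z0_def\<close>)
  qed
  have part2: "\<exists>v\<in>integrable_selections M \<Phi> xbar ybar.
      xs \<in> aumann_integral M (\<lambda>t. adj_gradient (g t) xbar ` coderivative (F t) (g t xbar) (v t) ys)"
    if isc: "selections_inner_semicompact M \<Phi> xbar ybar"
      and xs: "xs \<in> coderivative (expected_map M \<Phi>) xbar ybar ys" for xs ys
  proof -
    obtain z w where z: "z \<longlonglongrightarrow> (xbar, ybar)" and w: "w \<longlonglongrightarrow> (xs, - ys)"
      and nrm: "\<And>k. w k \<in> regular_normal_cone (z k) (gph (expected_map M \<Phi>))"
      using xs unfolding coderivative_def limiting_normal_cone_def by blast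
    define X where "X k = fst (z k)" for k
    define Y where "Y k = snd (z k)" for k
    have X: "X \<longlonglongrightarrow> xbar" and Y: "Y \<longlonglongrightarrow> ybar"
      using tendsto_fst[OF z] tendsto_snd[OF z] by (simp_all add: X_def[abs_def] Y_def[abs_def])
    \<comment> \<open>The regular normal cone is empty off the graph, so a normal at
      \<open>z k\<close> provides a selection there; inner semicompactness becomes
      applicable.\<close>
    have ne: "integrable_selections M \<Phi> (X k) (Y k) \<noteq> {}" for k
    proof -
      have "(X k, Y k) \<in> gph (expected_map M \<Phi>)"
        using nrm[of k] by (auto simp: regular_normal_cone_def X_def Y_def split: if_splits)
      then show ?thesis
        by (auto simp: gph_def expected_map_def aumann_integral_def integrable_selections_def)
    qed
    have "X \<longlonglongrightarrow> xbar \<and> Y \<longlonglongrightarrow> ybar \<and> (\<forall>k. integrable_selections M \<Phi> (X k) (Y k) \<noteq> {})"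
      using X Y ne by blast
    from isc[unfolded selections_inner_semicompact_def, THEN spec, THEN spec, THEN mp, OF this]
    obtain V \<sigma> v where V: "\<And>k. V k \<in> integrable_selections M \<Phi> (X k) (Y k)"
      and \<sigma>: "strict_mono (\<sigma> :: nat \<Rightarrow> nat)" and v: "integrable M v"
      and L1: "(\<lambda>j. \<integral>t. norm (V (\<sigma> j) t - v t) \<partial>M) \<longlonglongrightarrow> 0"
      by blast
    have Vint: "integrable M (V k)" "integral\<^sup>L M (V k) = Y k" "AE t in M. V k t \<in> \<Phi> t (X k)" for k
      using V[of k] by (auto simp: integrable_selections_def)
    \<comment> \<open>Norm convergence settles the integral of \<open>v\<close>; almost everywhere
      convergence along a further subsequence is needed to pass to the limit in the closed graphs of
      \<open>\<Phi> t\<close>.\<close>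
    obtain \<tau> where \<tau>: "strict_mono (\<tau> :: nat \<Rightarrow> nat)" and ae: "AE t in M. (\<lambda>j. V (\<sigma> (\<tau> j)) t - v t) \<longlonglongrightarrow> 0"
      using tendsto_L1_AE_subseq[OF _ L1] v Vint(1) by auto
    define s where "s j = \<sigma> (\<tau> j)" for j
    have s: "strict_mono s" unfolding s_def using \<sigma> \<tau> by (auto simp: strict_mono_def)
    have Xs: "(\<lambda>j. X (s j)) \<longlonglongrightarrow> xbar" and Ys: "(\<lambda>j. Y (s j)) \<longlonglongrightarrow> ybar"
      using LIMSEQ_subseq_LIMSEQ[OF X s] LIMSEQ_subseq_LIMSEQ[OF Y s] by (simp_all add: o_def)
    have v_sel: "v \<in> integrable_selections M \<Phi> xbar ybar"
    proof -
      have "AE t in M. \<forall>j. V (s j) t \<in> \<Phi> t (X (s j))" using Vint(3) by (simp add: AE_all_countable)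
      then have "AE t in M. v t \<in> \<Phi> t xbar"
        using ae AE_space
      proof eventually_elim
        case (elim t)
        have "(\<lambda>j. (V (s j) t - v t) + v t) \<longlonglongrightarrow> 0 + v t"
          unfolding s_def using elim by (intro tendsto_intros)
        then have "(\<lambda>j. (X (s j), V (s j) t)) \<longlonglongrightarrow> (xbar, v t)" by (intro tendsto_intros Xs) simp
        moreover have "closed (gph (\<Phi> t))" using assms(3) elim by (simp add: normal_integrand_def)
        moreover have "(X (s j), V (s j) t) \<in> gph (\<Phi> t)" for j using elim by (simp add: gph_def)
        ultimately have "(xbar, v t) \<in> gph (\<Phi> t)"
          using closed_sequentially[of "gph (\<Phi> t)" "\<lambda>j. (X (s j), V (s j) t)"] by blast
        then show ?case by (simp add: gph_def)
      qed
      moreover have "integral\<^sup>L M v = ybar"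
      proof -
        have "(\<lambda>j. Y (\<sigma> j) - integral\<^sup>L M v) \<longlonglongrightarrow> 0"
        proof (rule Lim_null_comparison[OF _ L1], rule always_eventually, rule allI)
          fix j
          have "Y (\<sigma> j) - integral\<^sup>L M v = (\<integral>t. V (\<sigma> j) t - v t \<partial>M)"
            using Vint v by simp
          then show "norm (Y (\<sigma> j) - integral\<^sup>L M v) \<le> (\<integral>t. norm (V (\<sigma> j) t - v t) \<partial>M)"
            by (simp only: integral_norm_bound)
        qed
        then have "(\<lambda>j. Y (\<sigma> j)) \<longlonglongrightarrow> integral\<^sup>L M v" by (rule LIM_zero_cancel)
        moreover have "(\<lambda>j. Y (\<sigma> j)) \<longlonglongrightarrow> ybar" using LIMSEQ_subseq_LIMSEQ[OF Y \<sigma>] by (simp add: o_def)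
        ultimately show ?thesis by (rule LIMSEQ_unique)
      qed
      ultimately show ?thesis using v by (simp add: integrable_selections_def)
    qed
    have "\<forall>\<^sub>F j in sequentially. X (s j) \<in> cball xbar \<epsilon>"
      using tendstoD[OF Xs \<epsilon>(1)] by eventually_elim (simp add: dist_commute less_imp_le)
    \<comment> \<open>The initial terms are dropped because every base point must lie in the ball
      where \<open>inequality\<close> holds.\<close>
    then obtain N where N: "\<And>j. j \<ge> N \<Longrightarrow> X (s j) \<in> cball xbar \<epsilon>"
      unfolding eventually_sequentially by blast
    define p where "p j = s (j + N)" for j
    have p: "strict_mono p" using s by (auto simp: p_def strict_mono_def)
    have Xp: "X (p j) \<in> cball xbar \<epsilon>" for j using N by (simp add: p_def)
    have Xp_lim: "(\<lambda>j. X (p j)) \<longlonglongrightarrow> xbar" and Yp_lim: "(\<lambda>j. Y (p j)) \<longlonglongrightarrow> ybar"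
      and wp_lim: "(\<lambda>j. w (p j)) \<longlonglongrightarrow> (xs, - ys)"
      using LIMSEQ_subseq_LIMSEQ[OF X p] LIMSEQ_subseq_LIMSEQ[OF Y p] LIMSEQ_subseq_LIMSEQ[OF w p]
      by (simp_all add: o_def)
    have xk_lim: "(\<lambda>j. fst (w (p j))) \<longlonglongrightarrow> xs" and yk_lim: "(\<lambda>j. - snd (w (p j))) \<longlonglongrightarrow> ys"
      using tendsto_fst[OF wp_lim] tendsto_minus[OF tendsto_snd[OF wp_lim]] by simp_all
    \<comment> \<open>Restricted to short \<open>d\<close>, so that the directional derivatives at
      the moving points stay below r / 4.\<close>
    have small: "xs \<bullet> d \<le> ys \<bullet> (integral\<^sup>L M y - ybar)"
      if d: "L * norm d \<le> r / 4" and y: "integrable M y" "AE t in M. y t \<in> F t (z0 t + A t xbar d)" for d y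
    proof -
      have "\<exists>q. q \<in> borel_measurable M \<and> (AE t in M. q t = A t (X (p j)) d)" for j
      proof -
        have dA: "AE t in M. (g t has_derivative A t (X (p j))) (at (X (p j)))"
          using A_deriv by eventually_elim (use \<epsilon>_\<eta>[OF Xp] in blast)
        have "0 < \<eta> / 2" using b(1) by simp
        from measurable_directional_derivative_AE[where w=d, OF this ball_meas[OF Xp[of j]] dA]
        obtain q where "q \<in> borel_measurable M" "AE t in M. q t = A t (X (p j)) d"
          by blast
        then show ?thesis by blast
      qed
      then obtain q where q: "\<And>j. q j \<in> borel_measurable M" "\<And>j. AE t in M. q j t = A t (X (p j)) d"
        by metis
      have q_all: "AE t in M. \<forall>j. q j t = A t (X (p j)) d" using q(2) by (simp add: AE_all_countable)
      show ?thesis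
      proof (rule variational_inequality_limit[where gk="\<lambda>j t. g t (X (p j))" and qk=q
            and q="\<lambda>t. A t xbar d" and xk="\<lambda>j. fst (w (p j))" and yk="\<lambda>j. - snd (w (p j))" and Ik="\<lambda>j. Y (p j)"])
        show "(\<lambda>t. g t (X (p j))) \<in> borel_measurable M" for j
          using \<epsilon>_\<eta>[OF Xp] b(2) by (intro g_meas) blast
        show "AE t in M. \<forall>j. norm (g t (X (p j)) - z0 t) \<le> r / 4"
          using near_bound[OF Xp] by (simp add: AE_all_countable)
        show "AE t in M. (\<lambda>j. g t (X (p j))) \<longlonglongrightarrow> z0 t"
        proof (rule AE_I2)
          fix t assume "t \<in> space M"
          then have "isCont (g t) xbar" using deriv_xbar has_derivative_continuous by blast
          then show "(\<lambda>j. g t (X (p j))) \<longlonglongrightarrow> z0 t"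
            unfolding z0_def using Xp_lim by (rule isCont_tendsto_compose)
        qed
        show "q j \<in> borel_measurable M" for j by (rule q(1))
        show "AE t in M. \<forall>j. norm (q j t) \<le> r / 4"
          using q_all A_bound
        proof eventually_elim
          case (elim t)
          have "norm (A t (X (p j)) d) \<le> L * norm d" for j using elim \<epsilon>_\<eta>[OF Xp] by blast
          then show ?case using elim d by (metis order_trans)
        qed
        show "AE t in M. (\<lambda>j. q j t) \<longlonglongrightarrow> A t xbar d"
          using q_all AE_space
        proof eventually_elim
          case (elim t)
          then show ?case
            using C1_around_frechet_derivative_tendsto[OF C1 Xp_lim, of t d] by (simp add: A_def)
        qed
        show "(\<lambda>t. A t xbar d) \<in> borel_measurable M" using A_bm[of d] by (simp add: bounded_measurable_def)
        fix j u assume u: "integrable M u" "AE t in M. u t \<in> F t (g t (X (p j)) + q j t)"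
        have "AE t in M. u t \<in> F t (g t (X (p j)) + A t (X (p j)) d)"
          using u(2) q(2)[of j] by eventually_elim simp
        then show "fst (w (p j)) \<bullet> d \<le> - snd (w (p j)) \<bullet> (integral\<^sup>L M u - Y (p j))"
          by (intro inequality[OF _ Xp V u(1)]) (use nrm[of "p j"] in \<open>auto simp: X_def Y_def\<close>)
      qed (use xk_lim yk_lim Yp_lim y in auto)
    qed
    \<comment> \<open>Replacing \<open>y\<close> by
      \<open>(1 - c) *\<^sub>R v t + c *\<^sub>R y t\<close> scales the displacement to
      \<open>c *\<^sub>R d\<close> and both sides of the inequality by \<open>c\<close>, since
      \<open>v\<close> has integral \<open>ybar\<close>; short directions therefore suffice.\<close>
    have "xs \<bullet> d \<le> ys \<bullet> (integral\<^sup>L M y - ybar)"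
      if y: "integrable M y" "AE t in M. y t \<in> F t (z0 t + A t xbar d)" for d y
    proof -
      define c where "c = min 1 (r / (4 * L * (norm d + 1)))"
      have nd: "norm d + 1 > 0" by (smt (verit) norm_ge_zero)
      have c: "c > 0" "c \<le> 1" using r_pos L_pos nd by (auto simp: c_def)
      have "L * norm (c *\<^sub>R d) \<le> r / 4"
      proof -
        have "c * (4 * L * (norm d + 1)) \<le> r / (4 * L * (norm d + 1)) * (4 * L * (norm d + 1))"
          using L_pos nd by (intro mult_right_mono) (auto simp: c_def)
        also have "\<dots> = r" using L_pos nd by simp
        finally have "4 * (L * (c * norm d)) + 4 * (L * c) \<le> r" by (simp add: algebra_simps)
        moreover have "0 \<le> L * c" using L_pos c by simp
        ultimately show ?thesis using c by simp
      qed
      moreover have "integrable M (\<lambda>t. (1 - c) *\<^sub>R v t + c *\<^sub>R y t)" using y v by simp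
      moreover have "AE t in M. (1 - c) *\<^sub>R v t + c *\<^sub>R y t \<in> F t (z0 t + A t xbar (c *\<^sub>R d))"
        using F_convex y(2) selF[OF v_sel xbar_\<epsilon>] AE_space
      proof eventually_elim
        case (elim t)
        have "(1 - c) *\<^sub>R v t + c *\<^sub>R y t \<in> F t ((1 - c) *\<^sub>R z0 t + c *\<^sub>R (z0 t + A t xbar d))"
          using elim c by (intro convex_gph_combine) (auto simp: z0_def)
        moreover have "(1 - c) *\<^sub>R z0 t + c *\<^sub>R (z0 t + A t xbar d) = z0 t + A t xbar (c *\<^sub>R d)"
          using linear_scale[OF has_derivative_linear[OF deriv_xbar]] elim by (simp add: algebra_simps)
        ultimately show ?case by simp
      qed
      ultimately have "xs \<bullet> (c *\<^sub>R d) \<le> ys \<bullet> (integral\<^sup>L M (\<lambda>t. (1 - c) *\<^sub>R v t + c *\<^sub>R y t) - ybar)"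
        by (rule small)
      also have "integral\<^sup>L M (\<lambda>t. (1 - c) *\<^sub>R v t + c *\<^sub>R y t) - ybar = c *\<^sub>R (integral\<^sup>L M y - ybar)"
        using y v v_sel by (simp add: integrable_selections_def algebra_simps)
      finally show ?thesis using c by simp
    qed
    then show ?thesis using conclude[OF v_sel] v_sel by blast
  qed
  show ?thesis using part1 part2 by blast
qed

end
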